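(* Let $\mathbb{T}$ be a cellular globular theory, presented as the colimit $\mathbb{T}=\mathbb{T}_\omega$ of a chain of globular theories $\Theta_0=\mathbb{T}_0\to\mathbb{T}_1\to\cdots\to\mathbb{T}_n\to\mathbb{T}_{n+1}\to\cdots$ in which each $J^n_{n+1}:\mathbb{T}_n\to\mathbb{T}_{n+1}$ is obtained by freely adjoining liftings for a family of parallel pairs in $\mathbb{T}_n$. Then for all $m<n\le\omega$ the connecting functor $J^m_n:\mathbb{T}_m\to\mathbb{T}_n$ is faithful.
   Context: **Globular sets.** The globe category $\mathbb{G}$ has the natural numbers as objects and is generated by maps $\sigma_n,\tau_n:n-1\to n$ ($n\ge1$) subject to $\sigma_{n+1}\sigma_n=\tau_{n+1}\sigma_n$ and $\sigma_{n+1}\tau_n=\tau_{n+1}\tau_n$. For $n<m$ there are exactly two maps $n\to m$, namely $\sigma=\sigma_m\cdots\sigma_{n+1}$ and $\tau=\tau_m\cdots\tau_{n+1}$. Globular sets are the objects of $[\mathbb{G}^{op},\mathbf{Set}]$, and $Y$ is the Yoneda embedding. **Globular sums and $\Theta_0$.** A table of dimensions is a sequence $\vec n=(n_1,\dots,n_k)$ of natural numbers of odd length with $n_{2i-1}>n_{2i}<n_{2i+1}$. For $D:\mathbb{G}\to\mathcal{C}$ the globular sum $D(\vec n)$ is the colimit of $Dn_1\xleftarrow{D\tau}Dn_2\xrightarrow{D\sigma}Dn_3\xleftarrow{D\tau}\cdots\xrightarrow{D\sigma}Dn_k$. The category $\Theta_0$ has tables of dimensions as objects and $\Theta_0(\vec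 n,\vec m)=[\mathbb{G}^{op},\mathbf{Set}](Y(\vec n),Y(\vec m))$, where $Y(\vec n)$ is the globular sum for $Y$. There is a functor $D:\mathbb{G}\to\Theta_0$ with $Dn=(n)$. **Globular theories.** A globular theory is an identity-on-objects functor $J:\Theta_0\to\mathbb{T}$ preserving globular sums. Morphisms of globular theories are functors under $\Theta_0$; $\Theta_0$ itself (with the identity) is the initial globular theory. **Freely adjoining liftings.** A pair $u,v:(n)\rightrightarrows\vec m$ in $\mathbb{T}$ is parallel if $n=0$, or $u\sigma_n=v\sigma_n$ and $u\tau_n=v\tau_n$. A lifting of it is $h:(n+1)\to\vec m$ with $h\sigma_{n+1}=u$ and $h\tau_{n+1}=v$. Given a (set-indexed) family $\mathcal{I}$ of parallel pairs $u_i,v_i:(n_i)\rightrightarrows\vec m_i$ ($i\in I$) in $\mathbb{T}$, the theory $\mathbb{T}_{\mathcal I}$ obtained by freely adjoining liftings is the globular theory with a morphism $J_{\mathcal I}:\mathbb{T}\to\mathbb{T}_{\mathcal I}$ and liftings $\phi_i$ of $(J_{\mathcal I}u_i,J_{\mathcal I}v_i)$ that is universal: for each morphism of globular theories $Q:\mathbb{T}\to\mathbb{S}$ and liftings $\theta_i$ of $(Qu_i,Qv_i)$, there is a unique morphism $\overline Q:\mathbb{T}_{\mathcal I}\to\mathbb{S}$ with $\overline QJ_{\mathcal I}=Q$ and $\overline Q\phi_i=\theta_i$ for all $i$. **Cellular.** A globular theory is cellular if it is the colimit, in the category of globular theories, of a chain $\Theta_0=\mathbb{T}_0\to\mathbb{T}_1\to\cdots$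 in which each $J^n_{n+1}$ is of the form $J_{\mathcal I_{n+1}}:\mathbb{T}_n\to(\mathbb{T}_n)_{\mathcal I_{n+1}}$ for a family $\mathcal{I}_{n+1}$ of parallel pairs in $\mathbb{T}_n$. The $J^m_n$ ($m<n<\omega$) are the composites and the $J^m_\omega$ are the colimit coprojections. *)

theory Defs
  imports Main "HOL-Library.FuncSet" "HOL-Library.Extended_Nat"
begin

section \<open>Categories and functors\<close>

record ('o, 'm) cat =
  Obj :: "'o set"
  Arr :: "'m set"
  Dom :: "'m \<Rightarrow> 'o"
  Cod :: "'m \<Rightarrow> 'o"
  Idn :: "'o \<Rightarrow> 'm"
  Comp :: "'m \<Rightarrow> 'm \<Rightarrow> 'm"  (* Comp g f is g after f *)

definition hom :: "('o, 'm, 'z) cat_scheme \<Rightarrow> 'o \<Rightarrow> 'o \<Rightarrow> 'm set" where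
  "hom C a b = {f \<in> Arr C. Dom C f = a \<and> Cod C f = b}"

locale category =
  fixes C :: "('o, 'm, 'z) cat_scheme"
  assumes dom_obj: "f \<in> Arr C \<Longrightarrow> Dom C f \<in> Obj C"
    and cod_obj: "f \<in> Arr C \<Longrightarrow> Cod C f \<in> Obj C"
    and idn_hom: "a \<in> Obj C \<Longrightarrow> Idn C a \<in> hom C a a"
    and comp_hom: "f \<in> hom C a b \<Longrightarrow> g \<in> hom C b c \<Longrightarrow> Comp C g f \<in> hom C a c"
    and idn_left: "f \<in> hom C a b \<Longrightarrow> Comp C (Idn C b) f = f"
    and idn_right: "f \<in> hom C a b \<Longrightarrow> Comp C f (Idn C a) = f"
    and comp_assoc: "f \<in> hom C a b \<Longrightarrow> g \<in> hom C b c \<Longrightarrow> h \<in> hom C c d \<Longrightarrow>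
        Comp C h (Comp C g f) = Comp C (Comp C h g) f"

locale cat_functor = A: category A + B: category B
  for A :: "('o, 'm, 'z) cat_scheme" and B :: "('p, 'n, 'y) cat_scheme" +
  fixes Fo :: "'o \<Rightarrow> 'p" and Fa :: "'m \<Rightarrow> 'n"
  assumes obj_map: "a \<in> Obj A \<Longrightarrow> Fo a \<in> Obj B"
    and arr_map: "f \<in> hom A a b \<Longrightarrow> Fa f \<in> hom B (Fo a) (Fo b)"
    and idn_map: "a \<in> Obj A \<Longrightarrow> Fa (Idn A a) = Idn B (Fo a)"
    and comp_map: "f \<in> hom A a b \<Longrightarrow> g \<in> hom A b c \<Longrightarrow>
        Fa (Comp A g f) = Comp B (Fa g) (Fa f)"

definition faithful :: "('o, 'm, 'z) cat_scheme \<Rightarrow> ('m \<Rightarrow> 'n) \<Rightarrow> bool" where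
  "faithful A Fa \<longleftrightarrow> (\<forall>a\<in>Obj A. \<forall>b\<in>Obj A. inj_on Fa (hom A a b))"


section \<open>The globe category and globular sets\<close>

text \<open>For \<open>n < m\<close>, \<open>Sig n m\<close> and \<open>Tau n m\<close> are the two maps \<open>n \<rightarrow> m\<close>, so that the generators
  \<open>\<sigma>\<^sub>n, \<tau>\<^sub>n : n - 1 \<rightarrow> n\<close> are \<open>Sig (n - 1) n\<close> and \<open>Tau (n - 1) n\<close>.  By the
  relations, which of the two maps a composite of non-identities is depends only on the map that
  is applied first.\<close>

datatype garr = Ident nat | Sig nat nat | Tau nat nat

fun gdom :: "garr \<Rightarrow> nat" where
  "gdom (Ident n) = n" | "gdom (Sig n m) = n" | "gdom (Tau n m) = n"

fun gcod :: "garr \<Rightarrow> nat" where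
  "gcod (Ident n) = n" | "gcod (Sig n m) = m" | "gcod (Tau n m) = m"

fun gcomp :: "garr \<Rightarrow> garr \<Rightarrow> garr" where
  "gcomp g (Ident n) = g"
| "gcomp g (Sig n m) = Sig n (gcod g)"
| "gcomp g (Tau n m) = Tau n (gcod g)"

definition globe :: "(nat, garr) cat" where
  "globe = \<lparr>Obj = UNIV,
    Arr = range Ident \<union> {Sig n m |n m. n < m} \<union> {Tau n m |n m. n < m},
    Dom = gdom, Cod = gcod, Idn = Ident, Comp = gcomp\<rparr>"

lemma globe_hom:
  "Ident k \<in> hom globe n m \<longleftrightarrow> k = n \<and> k = m"
  "Sig k l \<in> hom globe n m \<longleftrightarrow> k = n \<and> l = m \<and> n < m"
  "Tau k l \<in> hom globe n m \<longleftrightarrow> k = n \<and> l = m \<and> n < m"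
  by (auto simp: hom_def globe_def)

lemma globe_homD: "f \<in> hom globe n m \<Longrightarrow> gdom f = n \<and> gcod f = m"
  by (auto simp: hom_def globe_def)

lemma gcomp_hom: "f \<in> hom globe n m \<Longrightarrow> g \<in> hom globe m k \<Longrightarrow> gcomp g f \<in> hom globe n k"
  by (cases f; cases g) (auto simp: globe_hom)

lemma gcomp_assoc: "gcomp h (gcomp g f) = gcomp (gcomp h g) f"
  by (cases f; cases g) auto

lemma gcomp_Ident: "f \<in> hom globe n m \<Longrightarrow> gcomp (Ident m) f = f"
  by (cases f) (auto simp: globe_hom)

lemma category_globe: "category globe"
proof -
  have "Comp globe = gcomp" "Idn globe = Ident" "Obj globe = UNIV"
    by (auto simp: globe_def)
  then show ?thesis
    by unfold_locales
      (auto simp: globe_hom gcomp_assoc gcomp_Ident intro: gcomp_hom)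
qed

lemma globe_relations:
  "gcomp (Sig n (n + 1)) (Sig k n) = gcomp (Tau n (n + 1)) (Sig k n)"
  "gcomp (Sig n (n + 1)) (Tau k n) = gcomp (Tau n (n + 1)) (Tau k n)"
  by simp_all

text \<open>Presheaves on the globe category; \<open>act\<close> is the contravariant action.\<close>

record 'x gset =
  cells :: "nat \<Rightarrow> 'x set"
  act :: "garr \<Rightarrow> 'x \<Rightarrow> 'x"

definition globular_set :: "'x gset \<Rightarrow> bool" where
  "globular_set X \<longleftrightarrow>
     (\<forall>n m. \<forall>f\<in>hom globe n m. \<forall>x\<in>cells X m. act X f x \<in> cells X n) \<and>
     (\<forall>n. \<forall>x\<in>cells X n. act X (Ident n) x = x) \<and>
     (\<forall>n m k. \<forall>f\<in>hom globe n m. \<forall>g\<in>hom globe m k. \<forall>x\<in>cells X k.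
        act X (gcomp g f) x = act X f (act X g x))"

text \<open>Natural transformations, with components extensional so that equality of
  transformations is equality in HOL.\<close>

definition gset_map :: "'x gset \<Rightarrow> 'y gset \<Rightarrow> (nat \<Rightarrow> 'x \<Rightarrow> 'y) \<Rightarrow> bool" where
  "gset_map X Y \<alpha> \<longleftrightarrow>
     (\<forall>n. \<alpha> n \<in> cells X n \<rightarrow>\<^sub>E cells Y n) \<and>
     (\<forall>n m. \<forall>f\<in>hom globe n m. \<forall>x\<in>cells X m. \<alpha> n (act X f x) = act Y f (\<alpha> m x))"

definition yoneda :: "nat \<Rightarrow> garr gset" where
  "yoneda n = \<lparr>cells = (\<lambda>d. hom globe d n), act = (\<lambda>g f. gcomp f g)\<rparr>"

lemma globular_set_yoneda: "globular_set (yoneda n)"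
  by (auto simp: globular_set_def yoneda_def gcomp_assoc intro: gcomp_hom)


section \<open>Globular sums\<close>

text \<open>Lists are indexed from \<open>0\<close>: the entries \<open>n\<^sub>2, n\<^sub>4, \<dots>\<close> of a table sit at the odd indices.\<close>

definition tables :: "nat list set" where
  "tables = {ns. odd (length ns) \<and>
     (\<forall>i<length ns. odd i \<longrightarrow> ns ! i < ns ! (i - 1) \<and> ns ! i < ns ! (i + 1))}"

definition globular_cocone ::
  "('o, 'm, 'z) cat_scheme \<Rightarrow> (nat \<Rightarrow> 'o) \<Rightarrow> (garr \<Rightarrow> 'm) \<Rightarrow> nat list \<Rightarrow> 'o \<Rightarrow> (nat \<Rightarrow> 'm) \<Rightarrow> bool"
where
  "globular_cocone C Do Da ns c p \<longleftrightarrow> c \<in> Obj C \<and>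
     (\<forall>i<length ns. p i \<in> hom C (Do (ns ! i)) c) \<and>
     (\<forall>i<length ns. odd i \<longrightarrow>
        Comp C (p (i - 1)) (Da (Tau (ns ! i) (ns ! (i - 1)))) = p i \<and>
        Comp C (p (i + 1)) (Da (Sig (ns ! i) (ns ! (i + 1)))) = p i)"

definition globular_sum ::
  "('o, 'm, 'z) cat_scheme \<Rightarrow> (nat \<Rightarrow> 'o) \<Rightarrow> (garr \<Rightarrow> 'm) \<Rightarrow> nat list \<Rightarrow> 'o \<Rightarrow> (nat \<Rightarrow> 'm) \<Rightarrow> bool"
where
  "globular_sum C Do Da ns c p \<longleftrightarrow> globular_cocone C Do Da ns c p \<and>
     (\<forall>c' q. globular_cocone C Do Da ns c' q \<longrightarrow>
        (\<exists>!h. h \<in> hom C c c' \<and> (\<forall>i<length ns. Comp C h (p i) = q i)))"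

text \<open>The globular sum \<open>Y(ns)\<close> in globular sets, constructed pointwise as the quotient of the
  disjoint union of the \<open>yoneda (ns ! i)\<close>.  Its universal property is \<open>ysum_colimit\<close> below.\<close>

definition yelems :: "nat list \<Rightarrow> nat \<Rightarrow> (nat \<times> garr) set" where
  "yelems ns d = {(i, f). i < length ns \<and> f \<in> cells (yoneda (ns ! i)) d}"

definition glue_step :: "nat list \<Rightarrow> nat \<Rightarrow> ((nat \<times> garr) \<times> (nat \<times> garr)) set" where
  "glue_step ns d =
     {((i, f), (i - 1, gcomp (Tau (ns ! i) (ns ! (i - 1))) f)) |i f. (i, f) \<in> yelems ns d \<and> odd i} \<union>
     {((i, f), (i + 1, gcomp (Sig (ns ! i) (ns ! (i + 1))) f)) |i f. (i, f) \<in> yelems ns d \<and> odd i}"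

definition glue :: "nat list \<Rightarrow> nat \<Rightarrow> ((nat \<times> garr) \<times> (nat \<times> garr)) set" where
  "glue ns d = (glue_step ns d \<union> (glue_step ns d)\<inverse>)\<^sup>*"

type_synonym ycell = "(nat \<times> garr) set"

definition ysum :: "nat list \<Rightarrow> ycell gset" where
  "ysum ns = \<lparr>cells = (\<lambda>d. yelems ns d // glue ns d),
     act = (\<lambda>g c. glue ns (gdom g) `` ((\<lambda>(i, f). (i, gcomp f g)) ` c))\<rparr>"

definition ycls :: "nat list \<Rightarrow> nat \<Rightarrow> nat \<Rightarrow> garr \<Rightarrow> ycell" where
  "ycls ns d i f = glue ns d `` {(i, f)}"

lemma yelems_iff: "(i, f) \<in> yelems ns d \<longleftrightarrow> i < length ns \<and> f \<in> hom globe d (ns ! i)"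
  by (simp add: yelems_def yoneda_def)

lemma glue_equiv: "equiv UNIV (glue ns d)"
  unfolding glue_def
  by (intro equivI refl_rtrancl sym_rtrancl trans_rtrancl) (auto simp: sym_def)

lemma ycls_eq_iff: "ycls ns d i f = ycls ns d j h \<longleftrightarrow> ((i, f), (j, h)) \<in> glue ns d"
  unfolding ycls_def using equiv_class_eq_iff[OF glue_equiv] by auto

lemma ycls_cases:
  assumes "x \<in> cells (ysum ns) d"
  obtains i f where "i < length ns" "f \<in> hom globe d (ns ! i)" "x = ycls ns d i f"
  using assms by (auto simp: ysum_def ycls_def quotient_def yelems_iff)

lemma ycls_cell:
  "i < length ns \<Longrightarrow> f \<in> hom globe d (ns ! i) \<Longrightarrow> ycls ns d i f \<in> cells (ysum ns) d"
  by (auto simp: ysum_def ycls_def quotient_def yelems_iff)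

lemma tables_odd:
  assumes "ns \<in> tables" "i < length ns" "odd i"
  shows "i - 1 < length ns" "i + 1 < length ns" "ns ! i < ns ! (i - 1)" "ns ! i < ns ! (i + 1)"
proof -
  have "odd (length ns)" using assms(1) by (simp add: tables_def)
  then have "i + 1 \<noteq> length ns" using assms(3) by (metis even_add odd_one)
  then show "i + 1 < length ns" using assms(2) by simp
qed (use assms in \<open>auto simp: tables_def\<close>)

lemma ycls_glue:
  assumes "i < length ns" "odd i" "f \<in> hom globe d (ns ! i)"
  shows "ycls ns d (i - 1) (gcomp (Tau (ns ! i) (ns ! (i - 1))) f) = ycls ns d i f"
    and "ycls ns d (i + 1) (gcomp (Sig (ns ! i) (ns ! (i + 1))) f) = ycls ns d i f"
proof -
  have "((i, f), (i - 1, gcomp (Tau (ns ! i) (ns ! (i - 1))) f)) \<in> glue_step ns d"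
    "((i, f), (i + 1, gcomp (Sig (ns ! i) (ns ! (i + 1))) f)) \<in> glue_step ns d"
    using assms by (auto simp: glue_step_def yelems_iff)
  then show "ycls ns d (i - 1) (gcomp (Tau (ns ! i) (ns ! (i - 1))) f) = ycls ns d i f"
    "ycls ns d (i + 1) (gcomp (Sig (ns ! i) (ns ! (i + 1))) f) = ycls ns d i f"
    by (auto simp: ycls_eq_iff glue_def)
qed

lemma glue_respects:
  assumes step: "\<And>i f. i < length ns \<Longrightarrow> odd i \<Longrightarrow> f \<in> hom globe d (ns ! i) \<Longrightarrow>
      \<psi> (i - 1, gcomp (Tau (ns ! i) (ns ! (i - 1))) f) = \<psi> (i, f) \<and>
      \<psi> (i + 1, gcomp (Sig (ns ! i) (ns ! (i + 1))) f) = \<psi> (i, f)"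
    and "(x, y) \<in> glue ns d"
  shows "\<psi> x = \<psi> y"
  using assms(2) unfolding glue_def
proof (induction rule: rtrancl_induct)
  case (step y z)
  have *: "\<psi> a = \<psi> b" if ab: "(a, b) \<in> glue_step ns d" for a b
    using ab unfolding glue_step_def
  proof (elim UnE CollectE exE conjE)
    fix i f
    assume "(a, b) = ((i, f), (i - 1, gcomp (Tau (ns ! i) (ns ! (i - 1))) f))"
      "(i, f) \<in> yelems ns d" "odd i"
    then show ?thesis using assms(1)[of i f] by (metis Pair_inject yelems_iff)
  next
    fix i f
    assume "(a, b) = ((i, f), (i + 1, gcomp (Sig (ns ! i) (ns ! (i + 1))) f))"
      "(i, f) \<in> yelems ns d" "odd i"
    then show ?thesis using assms(1)[of i f] by (metis Pair_inject yelems_iff)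
  qed
  from step(2) have "\<psi> y = \<psi> z" using *[of y z] *[of z y] by auto
  with step(3) show ?case by simp
qed simp

lemma act_ycls:
  assumes "i < length ns" "f \<in> hom globe d (ns ! i)" "g \<in> hom globe e d"
  shows "act (ysum ns) g (ycls ns d i f) = ycls ns e i (gcomp f g)"
proof -
  define \<psi> where "\<psi> = (\<lambda>(j, h). ycls ns e j (gcomp h g))"
  have "\<psi> (i, f) = \<psi> (j, h)" if "((i, f), (j, h)) \<in> glue ns d" for j h
  proof (rule glue_respects[OF _ that])
    fix k h assume k: "k < length ns" "odd k" "h \<in> hom globe d (ns ! k)"
    have "gcomp h g \<in> hom globe e (ns ! k)" using k assms(3) by (blast intro: gcomp_hom)
    from ycls_glue[OF k(1,2) this]
    show "\<psi> (k - 1, gcomp (Tau (ns ! k) (ns ! (k - 1))) h) = \<psi> (k, h) \<and>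
       \<psi> (k + 1, gcomp (Sig (ns ! k) (ns ! (k + 1))) h) = \<psi> (k, h)"
      by (simp add: \<psi>_def gcomp_assoc)
  qed
  then have eq: "ycls ns e j (gcomp h g) = ycls ns e i (gcomp f g)" if "(j, h) \<in> ycls ns d i f" for j h
    using that by (auto simp: \<psi>_def ycls_def[of ns d])
  have self: "(i, f) \<in> ycls ns d i f" by (auto simp: ycls_def glue_def)
  have "act (ysum ns) g (ycls ns d i f) = (\<Union>(j, h)\<in>ycls ns d i f. ycls ns e j (gcomp h g))"
    using globe_homD[OF assms(3)] by (auto simp: ysum_def ycls_def[of ns e])
  also have "\<dots> = ycls ns e i (gcomp f g)"
  proof (rule equalityI)
    show "(\<Union>(j, h)\<in>ycls ns d i f. ycls ns e j (gcomp h g)) \<subseteq> ycls ns e i (gcomp f g)"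
      using eq by (auto split: prod.splits)
    show "ycls ns e i (gcomp f g) \<subseteq> (\<Union>(j, h)\<in>ycls ns d i f. ycls ns e j (gcomp h g))"
      by (rule UN_upper[OF self, of "\<lambda>(j, h). ycls ns e j (gcomp h g)", simplified])
  qed
  finally show ?thesis .
qed

lemma globular_set_ysum: "globular_set (ysum ns)"
  unfolding globular_set_def
proof (intro conjI allI ballI)
  fix n m f x assume "f \<in> hom globe n m" "x \<in> cells (ysum ns) m"
  then show "act (ysum ns) f x \<in> cells (ysum ns) n"
    by (auto elim!: ycls_cases simp: act_ycls intro!: ycls_cell gcomp_hom)
next
  fix n x assume "x \<in> cells (ysum ns) n"
  then obtain i h where h: "i < length ns" "h \<in> hom globe n (ns ! i)" "x = ycls ns n i h"
    by (rule ycls_cases)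
  have "Ident n \<in> hom globe n n" by (simp add: globe_hom)
  with h show "act (ysum ns) (Ident n) x = x" by (simp add: act_ycls)
next
  fix n m k f g x
  assume f: "f \<in> hom globe n m" and g: "g \<in> hom globe m k" and x: "x \<in> cells (ysum ns) k"
  from x obtain i h where h: "i < length ns" "h \<in> hom globe k (ns ! i)" "x = ycls ns k i h"
    by (rule ycls_cases)
  have "gcomp g f \<in> hom globe n k" "gcomp h g \<in> hom globe m (ns ! i)"
    using f g h by (blast intro: gcomp_hom)+
  then show "act (ysum ns) (gcomp g f) x = act (ysum ns) f (act (ysum ns) g x)"
    using f g h by (simp add: act_ycls gcomp_assoc)
qed

text \<open>\<open>ysum ns\<close> is the colimit of the zigzag of representables: its universal property with respect
  to cocones \<open>q\<close> into globular sets \<open>X\<close> with cells of any type.\<close>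

definition yincl :: "nat list \<Rightarrow> nat \<Rightarrow> nat \<Rightarrow> garr \<Rightarrow> ycell" where
  "yincl ns i = (\<lambda>d. \<lambda>f\<in>cells (yoneda (ns ! i)) d. ycls ns d i f)"

lemma yincl_map: "i < length ns \<Longrightarrow> gset_map (yoneda (ns ! i)) (ysum ns) (yincl ns i)"
  by (auto simp: gset_map_def yincl_def yoneda_def ycls_cell act_ycls gcomp_hom)

lemma yincl_cocone:
  assumes "ns \<in> tables" "i < length ns" "odd i" "f \<in> hom globe d (ns ! i)"
  shows "yincl ns (i - 1) d (gcomp (Tau (ns ! i) (ns ! (i - 1))) f) = yincl ns i d f"
    and "yincl ns (i + 1) d (gcomp (Sig (ns ! i) (ns ! (i + 1))) f) = yincl ns i d f"
proof -
  note t = tables_odd[OF assms(1-3)]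
  have "gcomp (Tau (ns ! i) (ns ! (i - 1))) f \<in> hom globe d (ns ! (i - 1))"
    "gcomp (Sig (ns ! i) (ns ! (i + 1))) f \<in> hom globe d (ns ! (i + 1))"
    using assms(4) t by (auto intro: gcomp_hom simp: globe_hom)
  then show "yincl ns (i - 1) d (gcomp (Tau (ns ! i) (ns ! (i - 1))) f) = yincl ns i d f"
    "yincl ns (i + 1) d (gcomp (Sig (ns ! i) (ns ! (i + 1))) f) = yincl ns i d f"
    using assms ycls_glue[OF assms(2-4)] by (simp_all add: yincl_def yoneda_def)
qed

lemma ysum_colimit:
  assumes ns: "ns \<in> tables"
    and X: "globular_set X"
    and q: "\<And>i. i < length ns \<Longrightarrow> gset_map (yoneda (ns ! i)) X (q i)"
    and glued: "\<And>i d f. i < length ns \<Longrightarrow> odd i \<Longrightarrow> f \<in> hom globe d (ns ! i) \<Longrightarrow>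
        q (i - 1) d (gcomp (Tau (ns ! i) (ns ! (i - 1))) f) = q i d f \<and>
        q (i + 1) d (gcomp (Sig (ns ! i) (ns ! (i + 1))) f) = q i d f"
  shows "\<exists>!\<alpha>. gset_map (ysum ns) X \<alpha> \<and>
           (\<forall>i<length ns. \<forall>d. \<forall>f\<in>hom globe d (ns ! i). \<alpha> d (yincl ns i d f) = q i d f)"
proof -
  define \<alpha> where "\<alpha> = (\<lambda>d. \<lambda>x\<in>cells (ysum ns) d. let (i, f) = (SOME r. r \<in> x) in q i d f)"
  have cls: "\<alpha> d (ycls ns d i f) = q i d f" if i: "i < length ns" "f \<in> hom globe d (ns ! i)" for d i f
  proof -
    define \<psi> where "\<psi> = (\<lambda>(j, h). q j d h)"
    obtain j h where jh: "(SOME r. r \<in> ycls ns d i f) = (j, h)" by (meson surj_pair)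
    have "(i, f) \<in> ycls ns d i f" by (auto simp: ycls_def glue_def)
    then have "(j, h) \<in> ycls ns d i f" using jh by (metis someI)
    then have "((i, f), (j, h)) \<in> glue ns d" by (simp add: ycls_def)
    then have "\<psi> (i, f) = \<psi> (j, h)"
      by (rule glue_respects[rotated]) (use glued in \<open>auto simp: \<psi>_def\<close>)
    then show ?thesis using ycls_cell[OF i] jh by (simp add: \<alpha>_def \<psi>_def)
  qed
  have map: "gset_map (ysum ns) X \<alpha>"
    unfolding gset_map_def
  proof (intro conjI allI ballI)
    fix n show "\<alpha> n \<in> cells (ysum ns) n \<rightarrow>\<^sub>E cells X n"
    proof (rule PiE_I)
      fix x assume "x \<in> cells (ysum ns) n"
      then obtain i f where i: "i < length ns" "f \<in> hom globe n (ns ! i)" "x = ycls ns n i f"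
        by (rule ycls_cases)
      then show "\<alpha> n x \<in> cells X n" using q[OF i(1)] cls
        by (auto simp: gset_map_def yoneda_def PiE_iff)
    qed (simp add: \<alpha>_def)
  next
    fix n m f x assume f: "f \<in> hom globe n m" and "x \<in> cells (ysum ns) m"
    then obtain i h where h: "i < length ns" "h \<in> hom globe m (ns ! i)" "x = ycls ns m i h"
      by (metis ycls_cases)
    have "gcomp h f \<in> hom globe n (ns ! i)" using f h by (blast intro: gcomp_hom)
    then show "\<alpha> n (act (ysum ns) f x) = act X f (\<alpha> m x)"
      using h f q[OF h(1)] by (simp add: act_ycls cls gset_map_def yoneda_def)
  qed
  show ?thesis
  proof (rule ex1I[of _ \<alpha>])
    show "gset_map (ysum ns) X \<alpha> \<and>
        (\<forall>i<length ns. \<forall>d. \<forall>f\<in>hom globe d (ns ! i). \<alpha> d (yincl ns i d f) = q i d f)"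
      using map by (auto simp: yincl_def yoneda_def cls)
  next
    fix \<beta> assume \<beta>: "gset_map (ysum ns) X \<beta> \<and>
        (\<forall>i<length ns. \<forall>d. \<forall>f\<in>hom globe d (ns ! i). \<beta> d (yincl ns i d f) = q i d f)"
    show "\<beta> = \<alpha>"
    proof (intro ext)
      fix d x
      show "\<beta> d x = \<alpha> d x"
      proof (cases "x \<in> cells (ysum ns) d")
        case True
        then obtain i f where i: "i < length ns" "f \<in> hom globe d (ns ! i)" "x = ycls ns d i f"
          by (rule ycls_cases)
        then have "x = yincl ns i d f" by (simp add: yincl_def yoneda_def)
        then show ?thesis using \<beta> i cls by metis
      next
        case False
        then show ?thesis using \<beta> map unfolding gset_map_def PiE_iff extensional_def by auto
      qed
    qed
  qed
qed


section \<open>The category \<open>\<Theta>\<^sub>0\<close>\<close>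

type_synonym theta_arr = "nat list \<times> nat list \<times> (nat \<Rightarrow> ycell \<Rightarrow> ycell)"

definition theta :: "(nat list, theta_arr) cat" where
  "theta = \<lparr>Obj = tables,
     Arr = {(ns, ms, \<alpha>). ns \<in> tables \<and> ms \<in> tables \<and> gset_map (ysum ns) (ysum ms) \<alpha>},
     Dom = (\<lambda>(ns, ms, \<alpha>). ns),
     Cod = (\<lambda>(ns, ms, \<alpha>). ms),
     Idn = (\<lambda>ns. (ns, ns, \<lambda>d. \<lambda>x\<in>cells (ysum ns) d. x)),
     Comp = (\<lambda>(ms, ks, \<beta>) (ns, _, \<alpha>). (ns, ks, \<lambda>d. compose (cells (ysum ns) d) (\<beta> d) (\<alpha> d)))\<rparr>"

lemma theta_hom:
  "x \<in> hom theta ns ms \<longleftrightarrow>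
     ns \<in> tables \<and> ms \<in> tables \<and> (\<exists>\<alpha>. x = (ns, ms, \<alpha>) \<and> gset_map (ysum ns) (ysum ms) \<alpha>)"
  by (auto simp: hom_def theta_def)

lemma theta_simps:
  "Obj theta = tables"
  "Idn theta ns = (ns, ns, \<lambda>d. \<lambda>x\<in>cells (ysum ns) d. x)"
  "Comp theta (ms', ks, \<beta>) (ns, ms, \<alpha>) = (ns, ks, \<lambda>d. compose (cells (ysum ns) d) (\<beta> d) (\<alpha> d))"
  by (simp_all add: theta_def)

lemma gset_map_cell: "gset_map X Y \<alpha> \<Longrightarrow> x \<in> cells X d \<Longrightarrow> \<alpha> d x \<in> cells Y d"
  by (auto simp: gset_map_def)

lemma gset_map_ext: "gset_map X Y \<alpha> \<Longrightarrow> \<alpha> d \<in> extensional (cells X d)"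
  by (auto simp: gset_map_def PiE_def)

lemma globular_set_act:
  "globular_set X \<Longrightarrow> f \<in> hom globe n m \<Longrightarrow> x \<in> cells X m \<Longrightarrow> act X f x \<in> cells X n"
  by (auto simp: globular_set_def)

lemma gset_map_eqI:
  assumes "gset_map X Y \<alpha>" "gset_map X Y \<beta>"
    and "\<And>d x. x \<in> cells X d \<Longrightarrow> \<alpha> d x = \<beta> d x"
  shows "\<alpha> = \<beta>"
  by (rule ext, rule extensionalityI[OF gset_map_ext[OF assms(1)] gset_map_ext[OF assms(2)] assms(3)])

lemma gset_map_id: "globular_set X \<Longrightarrow> gset_map X X (\<lambda>d. \<lambda>x\<in>cells X d. x)"
  by (auto simp: gset_map_def globular_set_act)

lemma gset_map_comp:
  assumes "globular_set X" "gset_map X Y \<alpha>" "gset_map Y Z \<beta>"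
  shows "gset_map X Z (\<lambda>d. compose (cells X d) (\<beta> d) (\<alpha> d))"
  unfolding gset_map_def
proof (intro conjI allI ballI)
  fix n show "compose (cells X n) (\<beta> n) (\<alpha> n) \<in> cells X n \<rightarrow>\<^sub>E cells Z n"
    using assms(2,3) by (auto simp: compose_def intro: gset_map_cell)
next
  fix n m f x assume "f \<in> hom globe n m" "x \<in> cells X m"
  then show "compose (cells X n) (\<beta> n) (\<alpha> n) (act X f x) = act Z f (compose (cells X m) (\<beta> m) (\<alpha> m) x)"
    using assms globular_set_act[OF assms(1)] gset_map_cell[OF assms(2)]
    by (simp add: compose_def gset_map_def)
qed

lemma category_theta: "category theta"
proof
  fix f assume "f \<in> Arr theta"
  then show "Dom theta f \<in> Obj theta" "Cod theta f \<in> Obj theta" by (auto simp: theta_def)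
next
  fix ns assume "ns \<in> Obj theta"
  then show "Idn theta ns \<in> hom theta ns ns"
    by (simp add: theta_simps theta_hom gset_map_id globular_set_ysum)
next
  fix f g a b c assume "f \<in> hom theta a b" "g \<in> hom theta b c"
  then show "Comp theta g f \<in> hom theta a c"
    by (auto simp: theta_simps theta_hom intro: gset_map_comp[OF globular_set_ysum])
next
  fix f a b assume "f \<in> hom theta a b"
  then obtain \<alpha> where \<alpha>: "f = (a, b, \<alpha>)" "gset_map (ysum a) (ysum b) \<alpha>"
    by (auto simp: theta_hom)
  have "compose (cells (ysum a) d) (\<lambda>x\<in>cells (ysum b) d. x) (\<alpha> d) = \<alpha> d"
    "compose (cells (ysum a) d) (\<alpha> d) (\<lambda>x\<in>cells (ysum a) d. x) = \<alpha> d" for d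
    using gset_map_cell[OF \<alpha>(2)] gset_map_ext[OF \<alpha>(2), of d]
    by (auto simp: compose_def extensional_def fun_eq_iff)
  then show "Comp theta (Idn theta b) f = f" "Comp theta f (Idn theta a) = f"
    by (simp_all add: \<alpha> theta_simps)
next
  fix f g h a b c d
  assume "f \<in> hom theta a b" "g \<in> hom theta b c" "h \<in> hom theta c d"
  then show "Comp theta h (Comp theta g f) = Comp theta (Comp theta h g) f"
    by (auto simp: theta_hom theta_simps compose_def fun_eq_iff dest: gset_map_cell)
qed

text \<open>The functor \<open>D : globe \<rightarrow> \<Theta>\<^sub>0\<close>, \<open>n \<mapsto> (n)\<close>.  A cell of \<open>ysum [n]\<close> is a singleton \<open>{(0, h)}\<close>,
  and \<open>D f\<close> sends it to \<open>{(0, f h)}\<close>.\<close>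

abbreviation D_obj :: "nat \<Rightarrow> nat list" where
  "D_obj n \<equiv> [n]"

definition D_arr :: "garr \<Rightarrow> theta_arr" where
  "D_arr f = ([gdom f], [gcod f],
     \<lambda>d. \<lambda>c\<in>cells (ysum [gdom f]) d. (\<lambda>(i, h). (i, gcomp f h)) ` c)"

lemma single_table: "[n] \<in> tables"
  by (simp add: tables_def)

lemma ycls_single: "ycls [n] d i f = {(i, f)}"
proof -
  have "glue_step [n] d = {}"
    by (auto simp: glue_step_def yelems_iff)
  then show ?thesis by (simp add: ycls_def glue_def)
qed

lemma ysum_single: "cells (ysum [n]) d = (\<lambda>f. {(0, f)}) ` hom globe d n"
  by (auto simp: ycls_single intro!: ycls_cell[of 0 "[n]", simplified ycls_single] elim!: ycls_cases)

lemma cat_functor_D: "cat_functor globe theta D_obj D_arr"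
proof -
  have map: "D_arr f \<in> hom theta [n] [m]" if f: "f \<in> hom globe n m" for f n m
  proof -
    have "gset_map (ysum [n]) (ysum [m]) (\<lambda>d. \<lambda>c\<in>cells (ysum [n]) d. (\<lambda>(i, h). (i, gcomp f h)) ` c)"
      unfolding gset_map_def
    proof (intro conjI allI ballI)
      fix d
      show "(\<lambda>c\<in>cells (ysum [n]) d. (\<lambda>(i, h). (i, gcomp f h)) ` c)
          \<in> cells (ysum [n]) d \<rightarrow>\<^sub>E cells (ysum [m]) d"
        using f by (auto simp: ysum_single intro: gcomp_hom)
    next
      fix d e g x assume g: "g \<in> hom globe d e" and "x \<in> cells (ysum [n]) e"
      then obtain h where h: "h \<in> hom globe e n" "x = {(0, h)}" by (auto simp: ysum_single)
      have 1: "act (ysum [k]) g {(0, l)} = {(0, gcomp l g)}" if "l \<in> hom globe e k" for k l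
        using act_ycls[of 0 "[k]" l e g d] that g by (simp add: ycls_single)
      have 2: "gcomp f h \<in> hom globe e m" "gcomp h g \<in> hom globe d n"
        using f g h by (blast intro: gcomp_hom)+
      show "(\<lambda>c\<in>cells (ysum [n]) d. (\<lambda>(i, h). (i, gcomp f h)) ` c) (act (ysum [n]) g x) =
          act (ysum [m]) g ((\<lambda>c\<in>cells (ysum [n]) e. (\<lambda>(i, h). (i, gcomp f h)) ` c) x)"
        using h 2 by (simp add: 1 ysum_single gcomp_assoc)
    qed
    then show ?thesis using globe_homD[OF f] by (simp add: theta_hom D_arr_def single_table)
  qed
  have "category globe" "category theta" by (rule category_globe category_theta)+
  moreover have "cat_functor_axioms globe theta D_obj D_arr"
  proof (standard, goal_cases)
    case (1 a)
    show ?case by (simp add: theta_simps single_table)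
  next
    case (2 f a b)
    then show ?case by (rule map)
  next
    case (3 a)
    have "(\<lambda>d. \<lambda>c\<in>cells (ysum [a]) d. (\<lambda>(i, h). (i, gcomp (Ident a) h)) ` c) =
        (\<lambda>d. \<lambda>x\<in>cells (ysum [a]) d. x)"
      by (intro ext) (auto simp: ysum_single gcomp_Ident restrict_def)
    then show ?case by (simp add: D_arr_def theta_simps globe_def)
  next
    case (4 f a b g c)
    have gf: "gcomp g f \<in> hom globe a c" using 4 by (rule gcomp_hom)
    have "(\<lambda>d. \<lambda>x\<in>cells (ysum [a]) d. (\<lambda>(i, h). (i, gcomp (gcomp g f) h)) ` x) =
        (\<lambda>d. compose (cells (ysum [a]) d) (\<lambda>x\<in>cells (ysum [b]) d. (\<lambda>(i, h). (i, gcomp g h)) ` x)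
          (\<lambda>x\<in>cells (ysum [a]) d. (\<lambda>(i, h). (i, gcomp f h)) ` x))"
      using 4 by (intro ext)
        (auto simp: ysum_single compose_def restrict_def gcomp_assoc image_iff intro: gcomp_hom)
    moreover have "Comp globe g f = gcomp g f" by (simp add: globe_def)
    ultimately show ?case
      using globe_homD[OF 4(1)] globe_homD[OF 4(2)] globe_homD[OF gf]
      by (simp add: D_arr_def theta_simps)
  qed
  ultimately show ?thesis by (simp add: cat_functor_def)
qed

text \<open>Every table \<open>ns\<close> is itself the globular sum \<open>D(ns)\<close> in \<open>\<Theta>\<^sub>0\<close>.\<close>

definition theta_incl :: "nat list \<Rightarrow> nat \<Rightarrow> theta_arr" where
  "theta_incl ns i =
     ([ns ! i], ns, \<lambda>d. \<lambda>c\<in>cells (ysum [ns ! i]) d. yincl ns i d (snd (the_elem c)))"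

lemma single_map_eqI:
  assumes "gset_map (ysum [n]) X \<alpha>" "gset_map (ysum [n]) X \<beta>"
    and "\<And>d f. f \<in> hom globe d n \<Longrightarrow> \<alpha> d {(0, f)} = \<beta> d {(0, f)}"
  shows "\<alpha> = \<beta>"
  using gset_map_eqI[OF assms(1,2)] assms(3) by (auto simp: ysum_single)

lemma act_single: "l \<in> hom globe e k \<Longrightarrow> g \<in> hom globe d e \<Longrightarrow> act (ysum [k]) g {(0, l)} = {(0, gcomp l g)}"
  using act_ycls[of 0 "[k]" l e g d] by (simp add: ycls_single)

lemma theta_incl_hom:
  assumes "ns \<in> tables" "i < length ns"
  shows "theta_incl ns i \<in> hom theta [ns ! i] ns"
proof -
  have "gset_map (ysum [ns ! i]) (ysum ns)
      (\<lambda>d. \<lambda>c\<in>cells (ysum [ns ! i]) d. yincl ns i d (snd (the_elem c)))"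
    using assms(2) unfolding gset_map_def
    by (auto simp: ysum_single yincl_def yoneda_def act_single act_ycls
        intro!: ycls_cell imageI gcomp_hom)
  then show ?thesis using assms(1) by (simp add: theta_hom theta_incl_def single_table)
qed

lemma theta_globular_sum:
  assumes ns: "ns \<in> tables"
  shows "globular_sum theta D_obj D_arr ns ns (theta_incl ns)"
proof -
  interpret category theta by (rule category_theta)
  interpret D: cat_functor globe theta D_obj D_arr by (rule cat_functor_D)
  have comp: "Comp theta (k, l, \<alpha>) (D_arr g) = (([n], l, \<beta>)) \<longleftrightarrow>
      (\<forall>d. \<forall>f\<in>hom globe d n. \<alpha> d {(0, gcomp g f)} = \<beta> d {(0, f)})"
    if "g \<in> hom globe n m" "(k, l, \<alpha>) \<in> hom theta [m] l" "([n], l, \<beta>) \<in> hom theta [n] l"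
    for k l m n g \<alpha> \<beta>
  proof -
    have \<beta>: "gset_map (ysum [n]) (ysum l) \<beta>" using that(3) by (auto simp: theta_hom)
    have c: "Comp theta (k, l, \<alpha>) (D_arr g) \<in> hom theta [n] l"
      using comp_hom[OF D.arr_map[OF that(1)] that(2)] .
    define \<gamma> where "\<gamma> = snd (snd (Comp theta (k, l, \<alpha>) (D_arr g)))"
    have \<gamma>: "Comp theta (k, l, \<alpha>) (D_arr g) = ([n], l, \<gamma>)" "gset_map (ysum [n]) (ysum l) \<gamma>"
      using c by (auto simp: theta_hom \<gamma>_def)
    have "\<gamma> d {(0, f)} = \<alpha> d {(0, gcomp g f)}" if "f \<in> hom globe d n" for d f
      using that globe_homD[OF \<open>g \<in> hom globe n m\<close>]
      by (simp add: \<gamma>_def D_arr_def theta_simps compose_def ysum_single)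
    then show ?thesis using \<gamma> single_map_eqI[OF \<gamma>(2) \<beta>] by auto
  qed
  have incl: "snd (snd (theta_incl ns i)) d {(0, f)} = yincl ns i d f"
    if "f \<in> hom globe d (ns ! i)" for i d f
    using that by (simp add: theta_incl_def ysum_single)
  have cocone: "globular_cocone theta D_obj D_arr ns c q \<longleftrightarrow> c \<in> tables \<and>
      (\<forall>i<length ns. q i \<in> hom theta [ns ! i] c) \<and>
      (\<forall>i<length ns. odd i \<longrightarrow> (\<forall>d. \<forall>f\<in>hom globe d (ns ! i).
         snd (snd (q (i - 1))) d {(0, gcomp (Tau (ns ! i) (ns ! (i - 1))) f)} = snd (snd (q i)) d {(0, f)} \<and>
         snd (snd (q (i + 1))) d {(0, gcomp (Sig (ns ! i) (ns ! (i + 1))) f)} = snd (snd (q i)) d {(0, f)}))"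
    for c q
  proof -
    have "(Comp theta (q (i - 1)) (D_arr (Tau (ns ! i) (ns ! (i - 1)))) = q i \<and>
          Comp theta (q (i + 1)) (D_arr (Sig (ns ! i) (ns ! (i + 1)))) = q i) \<longleftrightarrow>
        (\<forall>d. \<forall>f\<in>hom globe d (ns ! i).
         snd (snd (q (i - 1))) d {(0, gcomp (Tau (ns ! i) (ns ! (i - 1))) f)} = snd (snd (q i)) d {(0, f)} \<and>
         snd (snd (q (i + 1))) d {(0, gcomp (Sig (ns ! i) (ns ! (i + 1))) f)} = snd (snd (q i)) d {(0, f)})"
      if q: "\<forall>i<length ns. q i \<in> hom theta [ns ! i] c" and i: "i < length ns" "odd i" for i
    proof -
      note t = tables_odd[OF ns i]
      obtain \<alpha> where \<alpha>: "q (i - 1) = ([ns ! (i - 1)], c, \<alpha>)" using q t(1) by (metis theta_hom)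
      obtain \<beta> where \<beta>: "q i = ([ns ! i], c, \<beta>)" using q i(1) by (metis theta_hom)
      obtain \<gamma> where \<gamma>: "q (i + 1) = ([ns ! (i + 1)], c, \<gamma>)" using q t(2) by (metis theta_hom)
      have h: "([ns ! (i - 1)], c, \<alpha>) \<in> hom theta [ns ! (i - 1)] c"
        "([ns ! i], c, \<beta>) \<in> hom theta [ns ! i] c"
        "([ns ! (i + 1)], c, \<gamma>) \<in> hom theta [ns ! (i + 1)] c"
        using q t(1,2) i(1) \<alpha> \<beta> \<gamma> by metis+
      have g: "Tau (ns ! i) (ns ! (i - 1)) \<in> hom globe (ns ! i) (ns ! (i - 1))"
        "Sig (ns ! i) (ns ! (i + 1)) \<in> hom globe (ns ! i) (ns ! (i + 1))"
        using t(3,4) by (simp_all add: globe_hom)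
      show ?thesis
        unfolding \<alpha> \<beta> \<gamma> comp[OF g(1) h(1,2)] comp[OF g(2) h(3,2)] snd_conv by blast
    qed
    note eq = this
    show ?thesis
      unfolding globular_cocone_def theta_simps(1)
      by (rule conj_cong[OF refl], rule conj_cong[OF refl], rule all_cong, rule imp_cong[OF refl])
        (rule eq)
  qed
  have can: "globular_cocone theta D_obj D_arr ns ns (theta_incl ns)"
    unfolding cocone
  proof (intro conjI allI impI ballI)
    fix i d f assume i: "i < length ns" "odd i" and f: "f \<in> hom globe d (ns ! i)"
    note t = tables_odd[OF ns i]
    have "gcomp (Tau (ns ! i) (ns ! (i - 1))) f \<in> hom globe d (ns ! (i - 1))"
      "gcomp (Sig (ns ! i) (ns ! (i + 1))) f \<in> hom globe d (ns ! (i + 1))"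
      using f t by (auto intro: gcomp_hom simp: globe_hom)
    then show "snd (snd (theta_incl ns (i - 1))) d {(0, gcomp (Tau (ns ! i) (ns ! (i - 1))) f)} =
          snd (snd (theta_incl ns i)) d {(0, f)}"
      "snd (snd (theta_incl ns (i + 1))) d {(0, gcomp (Sig (ns ! i) (ns ! (i + 1))) f)} =
          snd (snd (theta_incl ns i)) d {(0, f)}"
      using yincl_cocone[OF ns i f] f by (simp_all only: incl)
  qed (use ns theta_incl_hom in auto)
  have univ: "\<exists>!h. h \<in> hom theta ns c \<and> (\<forall>i<length ns. Comp theta h (theta_incl ns i) = q i)"
    if "globular_cocone theta D_obj D_arr ns c q" for c q
  proof -
    define q' where "q' = (\<lambda>i d. \<lambda>f\<in>hom globe d (ns ! i). snd (snd (q i)) d {(0, f)})"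
    from that have c: "c \<in> tables" and qh: "\<And>i. i < length ns \<Longrightarrow> q i \<in> hom theta [ns ! i] c"
      unfolding cocone by auto
    have qm: "gset_map (ysum [ns ! i]) (ysum c) (snd (snd (q i)))"
      and qe: "q i = ([ns ! i], c, snd (snd (q i)))" if "i < length ns" for i
      using qh[OF that] by (auto simp: theta_hom)
    have q'm: "gset_map (yoneda (ns ! i)) (ysum c) (q' i)" if "i < length ns" for i
    proof -
      have "snd (snd (q i)) d {(0, f)} \<in> cells (ysum c) d" if "f \<in> hom globe d (ns ! i)" for d f
        using gset_map_cell[OF qm[OF \<open>i < length ns\<close>]] that by (simp add: ysum_single)
      moreover have "snd (snd (q i)) d {(0, gcomp f g)} = act (ysum c) g (snd (snd (q i)) e {(0, f)})"
        if "f \<in> hom globe e (ns ! i)" "g \<in> hom globe d e" for d e f g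
        using qm[OF \<open>i < length ns\<close>] that
        by (simp add: gset_map_def act_single[symmetric] ysum_single)
      ultimately show ?thesis
        by (auto simp: gset_map_def q'_def yoneda_def gcomp_hom)
    qed
    have glued: "q' (i - 1) d (gcomp (Tau (ns ! i) (ns ! (i - 1))) f) = q' i d f \<and>
        q' (i + 1) d (gcomp (Sig (ns ! i) (ns ! (i + 1))) f) = q' i d f"
      if i: "i < length ns" "odd i" and f: "f \<in> hom globe d (ns ! i)" for i d f
    proof -
      note t = tables_odd[OF ns i]
      have "gcomp (Tau (ns ! i) (ns ! (i - 1))) f \<in> hom globe d (ns ! (i - 1))"
        "gcomp (Sig (ns ! i) (ns ! (i + 1))) f \<in> hom globe d (ns ! (i + 1))"
        using f t by (auto intro: gcomp_hom simp: globe_hom)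
      then show ?thesis
        using \<open>globular_cocone theta D_obj D_arr ns c q\<close>[unfolded cocone] i f
        unfolding q'_def by simp
    qed
    have comp_incl: "Comp theta (ns, c, \<alpha>) (theta_incl ns i) = q i \<longleftrightarrow>
        (\<forall>d. \<forall>f\<in>hom globe d (ns ! i). \<alpha> d (yincl ns i d f) = q' i d f)"
      if i: "i < length ns" and \<alpha>: "gset_map (ysum ns) (ysum c) \<alpha>" for i \<alpha>
    proof -
      have a: "(ns, c, \<alpha>) \<in> hom theta ns c" using ns c \<alpha> by (simp add: theta_hom)
      define \<gamma> where "\<gamma> = snd (snd (Comp theta (ns, c, \<alpha>) (theta_incl ns i)))"
      have \<gamma>: "Comp theta (ns, c, \<alpha>) (theta_incl ns i) = ([ns ! i], c, \<gamma>)"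
        "gset_map (ysum [ns ! i]) (ysum c) \<gamma>"
        using comp_hom[OF theta_incl_hom[OF ns i] a] by (auto simp: theta_hom \<gamma>_def)
      have "\<gamma> d {(0, f)} = \<alpha> d (yincl ns i d f)" if "f \<in> hom globe d (ns ! i)" for d f
        using that by (simp add: \<gamma>_def theta_incl_def theta_simps compose_def ysum_single)
      then have "\<gamma> = snd (snd (q i)) \<longleftrightarrow>
          (\<forall>d. \<forall>f\<in>hom globe d (ns ! i). \<alpha> d (yincl ns i d f) = q' i d f)"
        using single_map_eqI[OF \<gamma>(2) qm[OF i]] by (auto simp: q'_def)
      then show ?thesis using \<gamma>(1) qe[OF i] by (metis Pair_inject)
    qed
    define U where "U = (\<lambda>\<alpha>. gset_map (ysum ns) (ysum c) \<alpha> \<and>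
        (\<forall>i<length ns. \<forall>d. \<forall>f\<in>hom globe d (ns ! i). \<alpha> d (yincl ns i d f) = q' i d f))"
    have "\<exists>!\<alpha>. U \<alpha>"
      unfolding U_def
    proof (rule ysum_colimit[OF ns globular_set_ysum])
      show "gset_map (yoneda (ns ! i)) (ysum c) (q' i)" if "i < length ns" for i
        using that by (rule q'm)
      show "q' (i - 1) d (gcomp (Tau (ns ! i) (ns ! (i - 1))) f) = q' i d f \<and>
          q' (i + 1) d (gcomp (Sig (ns ! i) (ns ! (i + 1))) f) = q' i d f"
        if "i < length ns" "odd i" "f \<in> hom globe d (ns ! i)" for i d f
        using that by (rule glued)
    qed
    then obtain \<alpha> where *: "U \<alpha> \<and> (\<forall>\<beta>. U \<beta> \<longrightarrow> \<beta> = \<alpha>)"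
      unfolding Ex1_def by (rule exE)
    then have U: "\<beta> = \<alpha>" if "U \<beta>" for \<beta>
      using that by (elim conjE allE impE)
    from * have \<alpha>: "gset_map (ysum ns) (ysum c) \<alpha>"
      "\<And>i d f. i < length ns \<Longrightarrow> f \<in> hom globe d (ns ! i) \<Longrightarrow> \<alpha> d (yincl ns i d f) = q' i d f"
      by (simp_all add: U_def)
    have uniq: "\<beta> = \<alpha>" if "gset_map (ysum ns) (ysum c) \<beta>"
      "\<forall>i<length ns. \<forall>d. \<forall>f\<in>hom globe d (ns ! i). \<beta> d (yincl ns i d f) = q' i d f" for \<beta>
      by (rule U) (simp add: U_def that)
    show ?thesis
    proof (rule ex1I[of _ "(ns, c, \<alpha>)"])
      show "(ns, c, \<alpha>) \<in> hom theta ns c \<and>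
          (\<forall>i<length ns. Comp theta (ns, c, \<alpha>) (theta_incl ns i) = q i)"
        using ns c \<alpha> comp_incl by (simp add: theta_hom)
    next
      fix h assume h: "h \<in> hom theta ns c \<and> (\<forall>i<length ns. Comp theta h (theta_incl ns i) = q i)"
      then obtain \<beta> where \<beta>: "h = (ns, c, \<beta>)" "gset_map (ysum ns) (ysum c) \<beta>"
        by (auto simp: theta_hom)
      have "\<beta> = \<alpha>"
      proof (rule uniq[OF \<beta>(2)], intro allI impI)
        fix i d assume i: "i < length ns"
        then show "\<forall>f\<in>hom globe d (ns ! i). \<beta> d (yincl ns i d f) = q' i d f"
          using h comp_incl[OF i \<beta>(2)] by (simp add: \<beta>(1))
      qed
      then show "h = (ns, c, \<alpha>)" using \<beta> by simp
    qed
  qed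
  show ?thesis unfolding globular_sum_def using can univ by blast
qed


section \<open>Globular theories\<close>

text \<open>The functor from \<open>\<Theta>\<^sub>0\<close> is the identity on objects, so only its action \<open>Str\<close> on arrows
  is recorded.\<close>

record 'm gtheory = "(nat list, 'm) cat" +
  Str :: "theta_arr \<Rightarrow> 'm"

locale globular_theory = J: cat_functor theta T "\<lambda>ns. ns" "Str T"
  for T :: "'m gtheory" +
  assumes obj_eq: "Obj T = tables"
    and preserves_sums: "ns \<in> tables \<Longrightarrow> globular_sum theta D_obj D_arr ns c p \<Longrightarrow>
        globular_sum T D_obj (\<lambda>f. Str T (D_arr f)) ns c (\<lambda>i. Str T (p i))"

text \<open>\<open>\<Theta>\<^sub>0\<close> with the identity is a globular theory; preservation of globular sums is not vacuous by
  \<open>theta_globular_sum\<close>.\<close>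

definition theta_theory :: "theta_arr gtheory" where
  "theta_theory = cat.extend theta \<lparr>Str = id\<rparr>"

lemma globular_theory_theta: "globular_theory theta_theory"
proof -
  have f: "Obj theta_theory = Obj theta" "Arr theta_theory = Arr theta"
    "Dom theta_theory = Dom theta" "Cod theta_theory = Cod theta"
    "Idn theta_theory = Idn theta" "Comp theta_theory = Comp theta" "Str theta_theory = id"
    by (simp_all add: theta_theory_def cat.extend_def)
  have h: "hom theta_theory = hom theta" by (simp add: hom_def f fun_eq_iff)
  have "category theta_theory"
    using category_theta by (simp add: category_def f h)
  then show ?thesis
    using category_theta
    by (simp add: globular_theory_def cat_functor_def cat_functor_axioms_def
        globular_theory_axioms_def globular_sum_def globular_cocone_def f h theta_simps(1))
qed

definition theory_morphism :: "'m gtheory \<Rightarrow> 'n gtheory \<Rightarrow> ('m \<Rightarrow> 'n) \<Rightarrow> bool" where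
  "theory_morphism T S Q \<longleftrightarrow> cat_functor T S (\<lambda>ns. ns) Q \<and>
     (\<forall>x\<in>Arr theta. Q (Str T x) = Str S x)"


section \<open>Freely adjoining liftings\<close>

definition parallel :: "'m gtheory \<Rightarrow> nat \<Rightarrow> nat list \<Rightarrow> 'm \<Rightarrow> 'm \<Rightarrow> bool" where
  "parallel T n ms u v \<longleftrightarrow> ms \<in> tables \<and> u \<in> hom T [n] ms \<and> v \<in> hom T [n] ms \<and>
     (n = 0 \<or>
       Comp T u (Str T (D_arr (Sig (n - 1) n))) = Comp T v (Str T (D_arr (Sig (n - 1) n))) \<and>
       Comp T u (Str T (D_arr (Tau (n - 1) n))) = Comp T v (Str T (D_arr (Tau (n - 1) n))))"

definition lifting :: "'m gtheory \<Rightarrow> nat \<Rightarrow> nat list \<Rightarrow> 'm \<Rightarrow> 'm \<Rightarrow> 'm \<Rightarrow> bool" where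
  "lifting T n ms u v h \<longleftrightarrow> h \<in> hom T [n + 1] ms \<and>
     Comp T h (Str T (D_arr (Sig n (n + 1)))) = u \<and>
     Comp T h (Str T (D_arr (Tau n (n + 1)))) = v"

record ('i, 'm) pair_family =
  idx :: "'i set"
  dim :: "'i \<Rightarrow> nat"
  tab :: "'i \<Rightarrow> nat list"
  lft :: "'i \<Rightarrow> 'm"
  rgt :: "'i \<Rightarrow> 'm"

definition parallel_family :: "'m gtheory \<Rightarrow> ('i, 'm) pair_family \<Rightarrow> bool" where
  "parallel_family T F \<longleftrightarrow> (\<forall>i\<in>idx F. parallel T (dim F i) (tab F i) (lft F i) (rgt F i))"

definition liftings_along ::
  "('m \<Rightarrow> 'n) \<Rightarrow> 'n gtheory \<Rightarrow> ('i, 'm) pair_family \<Rightarrow> ('i \<Rightarrow> 'n) \<Rightarrow> bool" where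
  "liftings_along Q S F \<theta> \<longleftrightarrow>
     (\<forall>i\<in>idx F. lifting S (dim F i) (tab F i) (Q (lft F i)) (Q (rgt F i)) (\<theta> i))"

text \<open>\<open>P : T \<rightarrow> T'\<close> exhibits \<open>T'\<close>, with the liftings \<open>\<phi>\<close>, as obtained from \<open>T\<close> by freely adjoining
  liftings for the family \<open>F\<close>.  Here and in \<open>chain_colimit\<close> the type \<open>'m\<close> of arrows is arbitrary
  and plays the role of the universe: the category of globular theories is that of all theories
  with arrows in \<open>'m\<close>, and universal properties are tested against its objects.  (Testing against
  more theories could only make these predicates harder to satisfy.)  Morphisms are compared on
  arrows of their domain only, as their values elsewhere are irrelevant.\<close>

definition free_liftings ::
  "'m gtheory \<Rightarrow> ('i, 'm) pair_family \<Rightarrow> 'm gtheory \<Rightarrow> ('m \<Rightarrow> 'm) \<Rightarrow> ('i \<Rightarrow> 'm) \<Rightarrow> bool" where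
  "free_liftings T F T' P \<phi> \<longleftrightarrow>
     globular_theory T \<and> parallel_family T F \<and>
     globular_theory T' \<and> theory_morphism T T' P \<and> liftings_along P T' F \<phi> \<and>
     (\<forall>(S :: 'm gtheory) Q \<theta>. globular_theory S \<and> theory_morphism T S Q \<and> liftings_along Q S F \<theta> \<longrightarrow>
        (\<exists>R. (theory_morphism T' S R \<and> (\<forall>f\<in>Arr T. R (P f) = Q f) \<and> (\<forall>i\<in>idx F. R (\<phi> i) = \<theta> i)) \<and>
          (\<forall>R'. theory_morphism T' S R' \<and> (\<forall>f\<in>Arr T. R' (P f) = Q f) \<and> (\<forall>i\<in>idx F. R' (\<phi> i) = \<theta> i)
             \<longrightarrow> (\<forall>f\<in>Arr T'. R' f = R f))))"


section \<open>Cellular globular theories\<close>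

definition chain_cocone ::
  "(nat \<Rightarrow> 'm gtheory) \<Rightarrow> (nat \<Rightarrow> 'm \<Rightarrow> 'm) \<Rightarrow> 'm gtheory \<Rightarrow> (nat \<Rightarrow> 'm \<Rightarrow> 'm) \<Rightarrow> bool" where
  "chain_cocone T P S K \<longleftrightarrow> globular_theory S \<and> (\<forall>n. theory_morphism (T n) S (K n)) \<and>
     (\<forall>n. \<forall>f\<in>Arr (T n). K (Suc n) (P n f) = K n f)"

definition chain_colimit ::
  "(nat \<Rightarrow> 'm gtheory) \<Rightarrow> (nat \<Rightarrow> 'm \<Rightarrow> 'm) \<Rightarrow> 'm gtheory \<Rightarrow> (nat \<Rightarrow> 'm \<Rightarrow> 'm) \<Rightarrow> bool" where
  "chain_colimit T P T\<omega> K \<longleftrightarrow> chain_cocone T P T\<omega> K \<and>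
     (\<forall>S L. chain_cocone T P S L \<longrightarrow>
        (\<exists>R. (theory_morphism T\<omega> S R \<and> (\<forall>n. \<forall>f\<in>Arr (T n). R (K n f) = L n f)) \<and>
          (\<forall>R'. theory_morphism T\<omega> S R' \<and> (\<forall>n. \<forall>f\<in>Arr (T n). R' (K n f) = L n f)
             \<longrightarrow> (\<forall>f\<in>Arr T\<omega>. R' f = R f))))"

text \<open>\<open>T 0\<close> is \<open>\<Theta>\<^sub>0\<close> up to isomorphism under \<open>\<Theta>\<^sub>0\<close>: its arrows have to live in the universe \<open>'m\<close>.\<close>

definition cellular_presentation ::
  "(nat \<Rightarrow> 'm gtheory) \<Rightarrow> (nat \<Rightarrow> 'm \<Rightarrow> 'm) \<Rightarrow> (nat \<Rightarrow> ('i, 'm) pair_family) \<Rightarrow> (nat \<Rightarrow> 'i \<Rightarrow> 'm)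
     \<Rightarrow> 'm gtheory \<Rightarrow> (nat \<Rightarrow> 'm \<Rightarrow> 'm) \<Rightarrow> bool" where
  "cellular_presentation T P F \<phi> T\<omega> K \<longleftrightarrow>
     globular_theory (T 0) \<and> bij_betw (Str (T 0)) (Arr theta) (Arr (T 0)) \<and>
     (\<forall>n. free_liftings (T n) (F n) (T (Suc n)) (P n) (\<phi> n)) \<and>
     chain_colimit T P T\<omega> K"

primrec chain_map :: "(nat \<Rightarrow> 'm \<Rightarrow> 'm) \<Rightarrow> nat \<Rightarrow> nat \<Rightarrow> 'm \<Rightarrow> 'm" where
  "chain_map P m 0 = id"
| "chain_map P m (Suc n) = (if m \<le> n then P n \<circ> chain_map P m n else id)"

text \<open>The connecting functor from stage \<open>m\<close> to stage \<open>n\<close>, for \<open>m \<le> n \<le> \<omega>\<close>, where \<open>\<infinity> :: enat\<close> stands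
  for \<open>\<omega>\<close>.\<close>

definition connecting ::
  "(nat \<Rightarrow> 'm \<Rightarrow> 'm) \<Rightarrow> (nat \<Rightarrow> 'm \<Rightarrow> 'm) \<Rightarrow> nat \<Rightarrow> enat \<Rightarrow> 'm \<Rightarrow> 'm" where
  "connecting P K m n = (case n of enat k \<Rightarrow> chain_map P m k | \<infinity> \<Rightarrow> K m)"

end

theory Submission
  imports Defs
begin

text \<open>Every globular set \<open>X\<close> embeds into one in which each parallel pair of cells has a filler.  Take
  for \<open>X\<close> the globular set represented by an object \<open>b\<close> of \<open>T m\<close>, and let \<open>Y\<close> be such a completion.
  The structure of a model of \<open>T 0\<close>, \<open>T 1\<close>, \<dots> can be put on \<open>Y\<close> one stage at a time: up to stage \<open>m\<close> an
  adjoined lifting acts as in \<open>X\<close> on the shapes that lie in \<open>X\<close> and by an arbitrary choice of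
  filler elsewhere; beyond stage \<open>m\<close> all choices are arbitrary.  So \<open>Y\<close> is a model of \<open>T\<omega>\<close>, and two
  arrows of \<open>T m\<close> into \<open>b\<close> that become equal in \<open>T\<omega>\<close> act equally on the identity of \<open>b\<close>, hence are
  equal.

  A model structure on \<open>Y\<close> is a morphism into the endomorphism theory of \<open>Y\<close>.  That theory has too many
  arrows to be a test object for the universal properties, so it is replaced by a subtheory that has at
  most as many arrows as \<open>'m\<close> has elements.\<close>

section \<open>Universal properties of globular theories\<close>

text \<open>The obstacle is that neither globular set serves alone. The represented \<open>X\<close>
  is a model of \<open>T m\<close>, but it may lack fillers for the pairs of later families; its
  completion \<open>Y\<close> has them all, but comes without an action of \<open>T m\<close>. Since
  freeness only yields maps out of one stage from maps out of the preceding one, the action on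
  \<open>Y\<close> has to be rebuilt from \<open>T 0\<close>, with \<open>X\<close> kept as a
  submodel up to stage \<open>m\<close>. The invariant recording this is \<open>agrees\<close>.
  Arrows of a freely generated theory have no normal forms here; a property is carried from the
  generators to all arrows by an induction principle extracted from the universal property itself.
  It asks for closure under composition and under tupling over globular sums, and the same two
  closures shape the small subtheory. Its size matters because the universal properties quantify
  over theories with arrows in one type \<open>'m\<close>: a test object from elsewhere must be
  copied into \<open>'m\<close> along an injection.\<close>

lemma globular_cocone_image:
  assumes "cat_functor A B (\<lambda>ns. ns) Q" and "globular_cocone A D_obj Da ns c p"
    and ns: "ns \<in> tables" and Da: "\<And>f k l. f \<in> hom globe k l \<Longrightarrow> Da f \<in> hom A [k] [l]"
  shows "globular_cocone B D_obj (\<lambda>f. Q (Da f)) ns c (\<lambda>i. Q (p i))"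
proof -
  interpret Q: cat_functor A B "\<lambda>ns. ns" Q by fact
  note p = assms(2)[unfolded globular_cocone_def]
  have "Comp B (Q (p (i - 1))) (Q (Da (Tau (ns ! i) (ns ! (i - 1))))) = Q (p i) \<and>
        Comp B (Q (p (i + 1))) (Q (Da (Sig (ns ! i) (ns ! (i + 1))))) = Q (p i)"
    if i: "i < length ns" "odd i" for i
  proof -
    note t = tables_odd[OF ns i]
    have "Da (Tau (ns ! i) (ns ! (i - 1))) \<in> hom A [ns ! i] [ns ! (i - 1)]"
      "Da (Sig (ns ! i) (ns ! (i + 1))) \<in> hom A [ns ! i] [ns ! (i + 1)]"
      using t by (auto intro!: Da simp: globe_hom)
    moreover have "p (i - 1) \<in> hom A [ns ! (i - 1)] c" "p (i + 1) \<in> hom A [ns ! (i + 1)] c"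
      using p t by auto
    ultimately show ?thesis using p i by (metis Q.comp_map)
  qed
  then show ?thesis
    using p by (auto simp: globular_cocone_def intro: Q.obj_map Q.arr_map)
qed

lemma D_arr_hom: "f \<in> hom globe k l \<Longrightarrow> D_arr f \<in> hom theta [k] [l]"
  using cat_functor.arr_map[OF cat_functor_D] .

lemma globular_sum_cocone: "globular_sum C Do Da ns c p \<Longrightarrow> globular_cocone C Do Da ns c p"
  by (simp add: globular_sum_def)

lemma globular_sum_hom: "globular_sum C Do Da ns c p \<Longrightarrow> i < length ns \<Longrightarrow> p i \<in> hom C (Do (ns ! i)) c"
  by (simp add: globular_sum_def globular_cocone_def)

lemma globular_sum_tuple:
  assumes "globular_sum C Do Da ns c p" "globular_cocone C Do Da ns c' q"
  obtains h where "h \<in> hom C c c'" "\<And>i. i < length ns \<Longrightarrow> Comp C h (p i) = q i"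
  using assms unfolding globular_sum_def by blast

lemma (in category) cocone_comp:
  assumes "globular_cocone C Do Da ns c p" "h \<in> hom C c c'"
    and "ns \<in> tables" and Da: "\<And>f k l. f \<in> hom globe k l \<Longrightarrow> Da f \<in> hom C (Do k) (Do l)"
  shows "globular_cocone C Do Da ns c' (\<lambda>i. Comp C h (p i))"
proof -
  have "c' \<in> Obj C" using assms(2) cod_obj by (auto simp: hom_def)
  moreover have "Comp C (Comp C h (p (i - 1))) (Da (Tau (ns ! i) (ns ! (i - 1)))) = Comp C h (p i) \<and>
        Comp C (Comp C h (p (i + 1))) (Da (Sig (ns ! i) (ns ! (i + 1)))) = Comp C h (p i)"
    if i: "i < length ns" "odd i" for i
  proof -
    note t = tables_odd[OF assms(3) i]
    have "Da (Tau (ns ! i) (ns ! (i - 1))) \<in> hom C (Do (ns ! i)) (Do (ns ! (i - 1)))"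
      "Da (Sig (ns ! i) (ns ! (i + 1))) \<in> hom C (Do (ns ! i)) (Do (ns ! (i + 1)))"
      using t by (auto intro!: Da simp: globe_hom)
    moreover have "p (i - 1) \<in> hom C (Do (ns ! (i - 1))) c" "p (i + 1) \<in> hom C (Do (ns ! (i + 1))) c"
      "Comp C (p (i - 1)) (Da (Tau (ns ! i) (ns ! (i - 1)))) = p i"
      "Comp C (p (i + 1)) (Da (Sig (ns ! i) (ns ! (i + 1)))) = p i"
      using assms(1) t i unfolding globular_cocone_def by blast+
    ultimately show ?thesis
      using assms(2) by (simp only: comp_assoc[symmetric])
  qed
  ultimately show ?thesis
    using assms(1,2) by (auto simp: globular_cocone_def intro: comp_hom)
qed

text \<open>Both arrows mediate the cocone obtained by composing the coprojections with
  \<open>k\<close>, so the coprojections are jointly epic.\<close>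

lemma (in category) globular_sum_ext:
  assumes "globular_sum C Do Da ns c p" "h \<in> hom C c c'" "k \<in> hom C c c'"
    and "\<And>i. i < length ns \<Longrightarrow> Comp C h (p i) = Comp C k (p i)"
    and "ns \<in> tables" "\<And>f k l. f \<in> hom globe k l \<Longrightarrow> Da f \<in> hom C (Do k) (Do l)"
  shows "h = k"
proof -
  have "globular_cocone C Do Da ns c' (\<lambda>i. Comp C k (p i))"
    using assms by (blast intro: cocone_comp globular_sum_cocone)
  then show ?thesis
    using assms(1-4) unfolding globular_sum_def by blast
qed

text \<open>All globular sums over \<open>ns\<close> in \<open>\<Theta>\<^sub>0\<close> are isomorphic to the canonical one, and functors preserve
  isomorphisms.\<close>

lemma globular_theoryI:
  assumes F: "cat_functor theta T (\<lambda>ns. ns) (Str T)" and obj: "Obj T = tables"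
    and can: "\<And>ns. ns \<in> tables \<Longrightarrow>
      globular_sum T D_obj (\<lambda>f. Str T (D_arr f)) ns ns (\<lambda>i. Str T (theta_incl ns i))"
  shows "globular_theory T"
proof -
  interpret F: cat_functor theta T "\<lambda>ns. ns" "Str T" by fact
  have Da: "Str T (D_arr f) \<in> hom T [k] [l]" if "f \<in> hom globe k l" for f k l
    using that by (blast intro: F.arr_map D_arr_hom)
  have "globular_sum T D_obj (\<lambda>f. Str T (D_arr f)) ns c (\<lambda>i. Str T (p i))"
    if ns: "ns \<in> tables" and sum: "globular_sum theta D_obj D_arr ns c p" for ns c p
  proof -
    note inc = theta_globular_sum[OF ns]
    obtain a where a: "a \<in> hom theta ns c" "\<And>i. i < length ns \<Longrightarrow> Comp theta a (theta_incl ns i) = p i"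
      using globular_sum_tuple[OF inc globular_sum_cocone[OF sum]] by metis
    obtain b where b: "b \<in> hom theta c ns" "\<And>i. i < length ns \<Longrightarrow> Comp theta b (p i) = theta_incl ns i"
      using globular_sum_tuple[OF sum globular_sum_cocone[OF inc]] by metis
    note p = globular_sum_hom[OF sum] and t = theta_incl_hom[OF ns]
    have c: "c \<in> Obj theta" using globular_sum_cocone[OF sum] by (simp add: globular_cocone_def)
    \<comment> \<open>This one identity carries the transfer: any \<open>k\<close> out of
      \<open>c\<close> is recovered from its composite with \<open>a\<close> by composing further
      with \<open>b\<close>, and composites with \<open>a\<close> are governed by the canonical
      sum.\<close>
    have "Comp theta a b = Idn theta c"
    proof (rule F.A.globular_sum_ext[OF sum _ _ _ ns D_arr_hom])
      show "Comp theta (Comp theta a b) (p i) = Comp theta (Idn theta c) (p i)" if "i < length ns" for i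
        using that a b p[OF that] by (metis F.A.comp_assoc F.A.idn_left)
    qed (use a b c in \<open>auto intro: F.A.comp_hom F.A.idn_hom\<close>)
    then have ab: "Comp T (Str T a) (Str T b) = Idn T c"
      using a b c by (metis F.comp_map F.idn_map)
    have aT: "Str T a \<in> hom T ns c" and bT: "Str T b \<in> hom T c ns"
      using a b by (blast intro: F.arr_map)+
    have pT: "Str T (p i) \<in> hom T [ns ! i] c" "Str T (theta_incl ns i) \<in> hom T [ns ! i] ns"
      "Comp T (Str T a) (Str T (theta_incl ns i)) = Str T (p i)"
      "Comp T (Str T b) (Str T (p i)) = Str T (theta_incl ns i)" if "i < length ns" for i
      using that p[OF that] t[OF that] a b by (auto intro: F.arr_map simp flip: F.comp_map)
    show ?thesis
      unfolding globular_sum_def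
    proof (intro conjI allI impI)
      show "globular_cocone T D_obj (\<lambda>f. Str T (D_arr f)) ns c (\<lambda>i. Str T (p i))"
        by (rule globular_cocone_image[OF F globular_sum_cocone[OF sum] ns D_arr_hom])
    next
      fix c' q assume q: "globular_cocone T D_obj (\<lambda>f. Str T (D_arr f)) ns c' q"
      obtain h where h: "h \<in> hom T ns c'"
        "\<And>i. i < length ns \<Longrightarrow> Comp T h (Str T (theta_incl ns i)) = q i"
        using globular_sum_tuple[OF can[OF ns] q] by metis
      show "\<exists>!k. k \<in> hom T c c' \<and> (\<forall>i<length ns. Comp T k (Str T (p i)) = q i)"
      proof (rule ex1I[of _ "Comp T h (Str T b)"])
        show "Comp T h (Str T b) \<in> hom T c c' \<and>
            (\<forall>i<length ns. Comp T (Comp T h (Str T b)) (Str T (p i)) = q i)"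
        proof (intro conjI allI impI)
          show "Comp T (Comp T h (Str T b)) (Str T (p i)) = q i" if "i < length ns" for i
            using F.B.comp_assoc[OF pT(1)[OF that] bT h(1)] pT[OF that] h that by simp
        qed (use h bT in \<open>blast intro: F.B.comp_hom\<close>)
      next
        fix k assume k: "k \<in> hom T c c' \<and> (\<forall>i<length ns. Comp T k (Str T (p i)) = q i)"
        have "Comp T k (Str T a) = h"
        proof (rule F.B.globular_sum_ext[OF can[OF ns] _ h(1) _ ns Da])
          show "Comp T (Comp T k (Str T a)) (Str T (theta_incl ns i)) =
              Comp T h (Str T (theta_incl ns i))" if "i < length ns" for i
            using F.B.comp_assoc[OF pT(2)[OF that] aT] k pT[OF that] h that by metis
        qed (use k aT in \<open>auto intro: F.B.comp_hom\<close>)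
        then show "k = Comp T h (Str T b)"
          using F.B.comp_assoc[OF bT aT] ab k by (metis F.B.idn_right)
      qed
    qed
  qed
  then show ?thesis
    by (simp add: globular_theory_def globular_theory_axioms_def F obj)
qed

lemma (in globular_theory) canonical_sum:
  "ns \<in> tables \<Longrightarrow> globular_sum T D_obj (\<lambda>f. Str T (D_arr f)) ns ns (\<lambda>i. Str T (theta_incl ns i))"
  by (intro preserves_sums theta_globular_sum)

lemma (in globular_theory) Str_D_arr_hom:
  "f \<in> hom globe k l \<Longrightarrow> Str T (D_arr f) \<in> hom T [k] [l]"
  by (blast intro: J.arr_map D_arr_hom)

lemma (in globular_theory) incl_hom:
  "ns \<in> tables \<Longrightarrow> i < length ns \<Longrightarrow> Str T (theta_incl ns i) \<in> hom T [ns ! i] ns"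
  by (blast intro: J.arr_map theta_incl_hom)

lemma (in globular_theory) incl_ext:
  assumes "ns \<in> tables" "h \<in> hom T ns c" "k \<in> hom T ns c"
    and "\<And>i. i < length ns \<Longrightarrow> Comp T h (Str T (theta_incl ns i)) = Comp T k (Str T (theta_incl ns i))"
  shows "h = k"
  by (rule J.B.globular_sum_ext[OF canonical_sum[OF assms(1)] assms(2,3,4,1) Str_D_arr_hom])

section \<open>Morphisms of theories and the preservation of liftings\<close>

lemma theory_morphismD:
  assumes "theory_morphism T S Q"
  shows "cat_functor T S (\<lambda>ns. ns) Q" "\<And>x. x \<in> Arr theta \<Longrightarrow> Q (Str T x) = Str S x"
    "\<And>f a b. f \<in> hom T a b \<Longrightarrow> Q f \<in> hom S a b"
    "\<And>f g a b c. f \<in> hom T a b \<Longrightarrow> g \<in> hom T b c \<Longrightarrow> Q (Comp T g f) = Comp S (Q g) (Q f)"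
  using assms cat_functor.arr_map[of T S "\<lambda>ns. ns" Q] cat_functor.comp_map[of T S "\<lambda>ns. ns" Q]
  by (auto simp: theory_morphism_def)

lemma theory_morphism_Arr: "theory_morphism T S Q \<Longrightarrow> f \<in> Arr T \<Longrightarrow> Q f \<in> Arr S"
  using theory_morphismD(3)[of T S Q f] by (auto simp: hom_def)

lemma theory_morphism_comp:
  assumes "theory_morphism T S Q" "theory_morphism S U R"
  shows "theory_morphism T U (\<lambda>f. R (Q f))"
proof -
  interpret Q: cat_functor T S "\<lambda>ns. ns" Q by (rule theory_morphismD(1)[OF assms(1)])
  interpret R: cat_functor S U "\<lambda>ns. ns" R by (rule theory_morphismD(1)[OF assms(2)])
  have "cat_functor T U (\<lambda>ns. ns) (\<lambda>f. R (Q f))"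
  proof
    fix f g a b c assume "f \<in> hom T a b" "g \<in> hom T b c"
    then show "R (Q (Comp T g f)) = Comp U (R (Q g)) (R (Q f))"
      by (metis Q.arr_map Q.comp_map R.comp_map)
  next
    fix a assume "a \<in> Obj T" then show "R (Q (Idn T a)) = Idn U a"
      by (metis Q.obj_map Q.idn_map R.idn_map)
  qed (blast intro: Q.obj_map R.obj_map Q.arr_map R.arr_map)+
  then show ?thesis
    using assms by (simp add: theory_morphism_def)
qed

lemma (in globular_theory) lifting_map:
  assumes "theory_morphism T S Q" "lifting T n ms u v h"
  shows "lifting S n ms (Q u) (Q v) (Q h)"
proof -
  interpret Q: cat_functor T S "\<lambda>ns. ns" Q by (rule theory_morphismD(1)[OF assms(1)])
  have st: "Str T (D_arr (Sig n (n + 1))) \<in> hom T [n] [n + 1]"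
    "Str T (D_arr (Tau n (n + 1))) \<in> hom T [n] [n + 1]"
    by (auto intro!: Str_D_arr_hom simp: globe_hom)
  have "D_arr (Sig n (n + 1)) \<in> Arr theta" "D_arr (Tau n (n + 1)) \<in> Arr theta"
    using D_arr_hom[of "Sig n (n + 1)" n "n + 1"] D_arr_hom[of "Tau n (n + 1)" n "n + 1"]
    by (simp_all add: globe_hom) (simp_all add: hom_def)
  then show ?thesis
    using assms(2) Q.comp_map[OF st(1)] Q.comp_map[OF st(2)] theory_morphismD(2)[OF assms(1)]
    unfolding lifting_def by (metis Q.arr_map)
qed

lemma (in globular_theory) parallel_map:
  assumes "theory_morphism T S Q" "parallel T n ms u v"
  shows "parallel S n ms (Q u) (Q v)"
proof (cases "n = 0")
  case False
  interpret Q: cat_functor T S "\<lambda>ns. ns" Q by (rule theory_morphismD(1)[OF assms(1)])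
  have st: "Str T (D_arr (Sig (n - 1) n)) \<in> hom T [n - 1] [n]"
    "Str T (D_arr (Tau (n - 1) n)) \<in> hom T [n - 1] [n]"
    using False by (auto intro!: Str_D_arr_hom simp: globe_hom)
  have "D_arr (Sig (n - 1) n) \<in> Arr theta" "D_arr (Tau (n - 1) n) \<in> Arr theta"
    using False D_arr_hom[of "Sig (n - 1) n" "n - 1" n] D_arr_hom[of "Tau (n - 1) n" "n - 1" n]
    by (simp_all add: globe_hom) (simp_all add: hom_def)
  then show ?thesis
    using False assms(2) Q.comp_map[OF st(1)] Q.comp_map[OF st(2)] theory_morphismD(2)[OF assms(1)]
    unfolding parallel_def by (metis Q.arr_map)
qed (use assms theory_morphismD(3)[OF assms(1)] in \<open>auto simp: parallel_def\<close>)

section \<open>Subtheories\<close>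

text \<open>Closure under tupling keeps the mediating arrows inside \<open>A\<close>; their
  uniqueness is inherited from \<open>T\<close>. Identities lie in \<open>A\<close> because they are
  images of identities of \<open>theta\<close>.\<close>

lemma globular_theory_restrict:
  assumes "globular_theory T" and A: "A \<subseteq> Arr T"
    and Str: "\<And>x. x \<in> Arr theta \<Longrightarrow> Str T x \<in> A"
    and comp: "\<And>f g a b c. f \<in> hom T a b \<Longrightarrow> g \<in> hom T b c \<Longrightarrow> f \<in> A \<Longrightarrow> g \<in> A \<Longrightarrow> Comp T g f \<in> A"
    and tuple: "\<And>h ns c. h \<in> hom T ns c \<Longrightarrow> ns \<in> tables \<Longrightarrow>
      (\<And>i. i < length ns \<Longrightarrow> Comp T h (Str T (theta_incl ns i)) \<in> A) \<Longrightarrow> h \<in> A"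
  shows "globular_theory (T\<lparr>Arr := A\<rparr>)"
proof -
  interpret T: globular_theory T by fact
  let ?S = "T\<lparr>Arr := A\<rparr>"
  have hom: "f \<in> hom ?S a b \<longleftrightarrow> f \<in> hom T a b \<and> f \<in> A" for f a b
    using A by (auto simp: hom_def)
  have StrA: "Str T x \<in> A" if "x \<in> hom theta a b" for x a b
    using that Str by (auto simp: hom_def)
  have "category ?S"
  proof
    fix a assume a: "a \<in> Obj ?S"
    then have "a \<in> tables" by (simp add: T.obj_eq)
    then have "Idn T a = Str T (Idn theta a)" "Idn theta a \<in> hom theta a a"
      using T.J.idn_map T.J.A.idn_hom by (simp_all add: theta_simps)
    then show "Idn ?S a \<in> hom ?S a a"
      using a T.J.B.idn_hom[of a] StrA by (simp add: hom)
  qed (use A in \<open>auto simp: hom intro: T.J.B.dom_obj T.J.B.cod_obj T.J.B.comp_hom comp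
      T.J.B.idn_left T.J.B.idn_right T.J.B.comp_assoc\<close>)
  moreover have "cat_functor_axioms theta ?S (\<lambda>ns. ns) (Str ?S)"
    by unfold_locales
      (auto simp: hom T.J.idn_map T.J.comp_map intro: StrA T.J.arr_map T.J.obj_map)
  ultimately have F: "cat_functor theta ?S (\<lambda>ns. ns) (Str ?S)"
    by (simp add: cat_functor_def category_theta)
  show ?thesis
  proof (rule globular_theoryI[OF F])
    show "Obj ?S = tables" by (simp add: T.obj_eq)
  next
    fix ns assume ns: "ns \<in> tables"
    have coc: "globular_cocone ?S D_obj (\<lambda>f. Str ?S (D_arr f)) ns c q \<longleftrightarrow>
        globular_cocone T D_obj (\<lambda>f. Str T (D_arr f)) ns c q \<and> (\<forall>i<length ns. q i \<in> A)" for c q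
      by (auto simp: globular_cocone_def hom)
    note sum = T.canonical_sum[OF ns]
    show "globular_sum ?S D_obj (\<lambda>f. Str ?S (D_arr f)) ns ns (\<lambda>i. Str ?S (theta_incl ns i))"
      unfolding globular_sum_def coc
    proof (intro conjI allI impI)
      fix c q assume q: "globular_cocone T D_obj (\<lambda>f. Str T (D_arr f)) ns c q \<and> (\<forall>i<length ns. q i \<in> A)"
      then obtain h where h: "h \<in> hom T ns c"
        "\<And>i. i < length ns \<Longrightarrow> Comp T h (Str T (theta_incl ns i)) = q i"
        using globular_sum_tuple[OF sum] by metis
      have "h \<in> A" by (rule tuple[OF h(1) ns]) (use h(2) q in auto)
      then show "\<exists>!h. h \<in> hom ?S ns c \<and> (\<forall>i<length ns. Comp ?S h (Str ?S (theta_incl ns i)) = q i)"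
        using h T.incl_ext[OF ns] by (intro ex1I[of _ h]) (auto simp: hom)
    qed (use globular_sum_cocone[OF sum] StrA[OF theta_incl_hom[OF ns]] in auto)
  qed
qed

lemma theory_morphism_restrict:
  assumes "theory_morphism T S Q" "category (S\<lparr>Arr := A\<rparr>)" "\<And>f. f \<in> Arr T \<Longrightarrow> Q f \<in> A"
  shows "theory_morphism T (S\<lparr>Arr := A\<rparr>) Q"
proof -
  interpret Q: cat_functor T S "\<lambda>ns. ns" Q by (rule theory_morphismD(1)[OF assms(1)])
  interpret S: category "S\<lparr>Arr := A\<rparr>" by fact
  have "cat_functor T (S\<lparr>Arr := A\<rparr>) (\<lambda>ns. ns) Q"
  proof
    fix f a b assume "f \<in> hom T a b"
    then show "Q f \<in> hom (S\<lparr>Arr := A\<rparr>) a b"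
      using Q.arr_map[of f a b] assms(3)[of f] by (simp add: hom_def)
  qed (auto simp: Q.idn_map Q.comp_map Q.obj_map)
  then show ?thesis using assms(1) by (simp add: theory_morphism_def)
qed

lemma theory_morphism_incl:
  assumes "globular_theory S" "globular_theory (S\<lparr>Arr := A\<rparr>)" "A \<subseteq> Arr S"
  shows "theory_morphism (S\<lparr>Arr := A\<rparr>) S (\<lambda>f. f)"
proof -
  interpret S: globular_theory S by fact
  interpret A: globular_theory "S\<lparr>Arr := A\<rparr>" by fact
  have "cat_functor (S\<lparr>Arr := A\<rparr>) S (\<lambda>ns. ns) (\<lambda>f. f)"
    by unfold_locales (use assms(3) in \<open>auto simp: hom_def\<close>)
  then show ?thesis by (simp add: theory_morphism_def)
qed

lemma theory_morphism_id: "globular_theory T \<Longrightarrow> theory_morphism T T (\<lambda>f. f)"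
  using theory_morphism_incl[of T "Arr T"] by simp

section \<open>Uniqueness and induction for freely adjoined liftings\<close>

text \<open>Both maps solve the extension problem posed by \<open>R\<close> after \<open>P\<close>
  and the liftings \<open>R (\<phi> i)\<close>, and its solutions agree on arrows of
  \<open>T'\<close>.\<close>

lemma free_liftings_unique:
  fixes S T :: "'m gtheory"
  assumes free: "free_liftings T F T' P \<phi>" and S: "globular_theory S"
    and R: "theory_morphism T' S R" and R': "theory_morphism T' S R'"
    and P: "\<And>f. f \<in> Arr T \<Longrightarrow> R (P f) = R' (P f)" and \<phi>: "\<And>i. i \<in> idx F \<Longrightarrow> R (\<phi> i) = R' (\<phi> i)"
    and "f \<in> Arr T'"
  shows "R f = R' f"
proof -
  have T': "globular_theory T'" and Pm: "theory_morphism T T' P" and lift: "liftings_along P T' F \<phi>"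
    using free by (simp_all add: free_liftings_def)
  interpret T': globular_theory T' by fact
  have lift': "liftings_along (\<lambda>f. R (P f)) S F (\<lambda>i. R (\<phi> i))"
    using lift T'.lifting_map[OF R] by (simp add: liftings_along_def)
  have "\<exists>R0. (theory_morphism T' S R0 \<and> (\<forall>f\<in>Arr T. R0 (P f) = R (P f)) \<and> (\<forall>i\<in>idx F. R0 (\<phi> i) = R (\<phi> i))) \<and>
      (\<forall>R'. theory_morphism T' S R' \<and> (\<forall>f\<in>Arr T. R' (P f) = R (P f)) \<and> (\<forall>i\<in>idx F. R' (\<phi> i) = R (\<phi> i))
        \<longrightarrow> (\<forall>f\<in>Arr T'. R' f = R0 f))"
    by (rule free[unfolded free_liftings_def, THEN conjunct2, THEN conjunct2, THEN conjunct2,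
          THEN conjunct2, THEN conjunct2, THEN spec, THEN spec, THEN spec, THEN mp,
          OF conjI[OF S conjI[OF theory_morphism_comp[OF Pm R] lift']]])
  then obtain R0 where R0: "\<And>R'. theory_morphism T' S R' \<and> (\<forall>f\<in>Arr T. R' (P f) = R (P f)) \<and>
      (\<forall>i\<in>idx F. R' (\<phi> i) = R (\<phi> i)) \<Longrightarrow> \<forall>f\<in>Arr T'. R' f = R0 f"
    by (elim exE conjE) blast
  have "\<forall>f\<in>Arr T'. R f = R0 f" "\<forall>f\<in>Arr T'. R' f = R0 f"
    by (rule R0, use R R' P \<phi> in simp)+
  then show ?thesis
    using \<open>f \<in> Arr T'\<close> by simp
qed

text \<open>A subtheory through which \<open>P\<close> and \<open>\<phi>\<close> factor is everything: it is itself a test object, and the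
  map it receives composes with the inclusion to the identity.\<close>

lemma free_liftings_induct:
  assumes free: "free_liftings T F T' P \<phi>" and h: "h \<in> Arr T'"
    and P: "\<And>f. f \<in> Arr T \<Longrightarrow> P f \<in> A" and \<phi>: "\<And>i. i \<in> idx F \<Longrightarrow> \<phi> i \<in> A"
    and comp: "\<And>f g a b c. f \<in> hom T' a b \<Longrightarrow> g \<in> hom T' b c \<Longrightarrow> f \<in> A \<Longrightarrow> g \<in> A \<Longrightarrow> Comp T' g f \<in> A"
    and tuple: "\<And>h ns c. h \<in> hom T' ns c \<Longrightarrow> ns \<in> tables \<Longrightarrow>
      (\<And>i. i < length ns \<Longrightarrow> Comp T' h (Str T' (theta_incl ns i)) \<in> A) \<Longrightarrow> h \<in> A"
  shows "h \<in> A"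
proof -
  let ?A = "A \<inter> Arr T'"
  let ?S = "T'\<lparr>Arr := ?A\<rparr>"
  have T: "globular_theory T" and T': "globular_theory T'" and Pm: "theory_morphism T T' P"
    and lift: "liftings_along P T' F \<phi>"
    using free by (simp_all add: free_liftings_def)
  interpret T: globular_theory T by fact
  interpret T': globular_theory T' by fact
  have S: "globular_theory ?S"
  proof (rule globular_theory_restrict[OF T'])
    fix x assume x: "x \<in> Arr theta"
    then have x': "x \<in> hom theta (Dom theta x) (Cod theta x)" by (simp add: hom_def)
    have "Str T x \<in> Arr T" "Str T' x \<in> Arr T'"
      using T.J.arr_map[OF x'] T'.J.arr_map[OF x'] by (simp_all add: hom_def)
    then show "Str T' x \<in> ?A" using P theory_morphismD(2)[OF Pm x] by force
  next
    fix f g a b c assume "f \<in> hom T' a b" "g \<in> hom T' b c" "f \<in> ?A" "g \<in> ?A"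
    then show "Comp T' g f \<in> ?A" using comp T'.J.B.comp_hom[of f a b g c] by (auto simp: hom_def)
  next
    fix h ns c assume "h \<in> hom T' ns c" "ns \<in> tables"
      "\<And>i. i < length ns \<Longrightarrow> Comp T' h (Str T' (theta_incl ns i)) \<in> ?A"
    then show "h \<in> ?A" using tuple[of h ns c] by (auto simp: hom_def)
  qed auto
  then interpret S: globular_theory ?S .
  have incl: "theory_morphism ?S T' (\<lambda>f. f)" by (rule theory_morphism_incl[OF T' S]) auto
  have PS: "theory_morphism T ?S P"
    by (rule theory_morphism_restrict[OF Pm S.J.B.category_axioms])
      (use P theory_morphism_Arr[OF Pm] in auto)
  have "liftings_along P ?S F \<phi>"
    using lift \<phi> by (auto simp: liftings_along_def lifting_def hom_def)
  then obtain R where R: "theory_morphism T' ?S R" "\<forall>f\<in>Arr T. R (P f) = P f" "\<forall>i\<in>idx F. R (\<phi> i) = \<phi> i"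
    using free S PS unfolding free_liftings_def by blast
  have R': "theory_morphism T' T' R"
    using theory_morphism_comp[OF R(1) incl] .
  have id: "theory_morphism T' T' (\<lambda>f. f)"
    by (rule theory_morphism_id[OF T'])
  have "R h = h"
    by (rule free_liftings_unique[OF free T' R' id _ _ h]) (use R in auto)
  then show ?thesis using theory_morphism_Arr[OF R(1) h] h by simp
qed

section \<open>Test objects with arrows in another type\<close>

text \<open>The copy of \<open>S\<close> has the codes \<open>\<iota> f\<close> as arrows. It turns
  a theory over any type into a legitimate test object for the universal properties, and
  \<open>\<kappa>\<close> brings the result back.\<close>

lemma globular_theory_transport:
  fixes S :: "'a gtheory" and \<iota> :: "'a \<Rightarrow> 'b"
  assumes "globular_theory S" and inj: "inj_on \<iota> (Arr S)"
  obtains S' :: "'b gtheory" and \<kappa> where "globular_theory S'" "theory_morphism S S' \<iota>" "theory_morphism S' S \<kappa>"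
    "\<And>f. f \<in> Arr S \<Longrightarrow> \<kappa> (\<iota> f) = f"
proof -
  interpret S: globular_theory S by fact
  define \<kappa> where "\<kappa> = inv_into (Arr S) \<iota>"
  have \<kappa>: "\<kappa> (\<iota> f) = f" if "f \<in> Arr S" for f
    using that inj by (simp add: \<kappa>_def)
  define S' :: "'b gtheory" where "S' = \<lparr>Obj = Obj S, Arr = \<iota> ` Arr S, Dom = (\<lambda>f. Dom S (\<kappa> f)),
      Cod = (\<lambda>f. Cod S (\<kappa> f)), Idn = (\<lambda>a. \<iota> (Idn S a)), Comp = (\<lambda>g f. \<iota> (Comp S (\<kappa> g) (\<kappa> f))),
      Str = (\<lambda>x. \<iota> (Str S x))\<rparr>"
  have homE: "\<exists>f'. f = \<iota> f' \<and> f' \<in> hom S a b \<and> \<kappa> f = f'" if "f \<in> hom S' a b" for f a b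
    using that \<kappa> by (auto simp: hom_def S'_def)
  have homI: "\<iota> f \<in> hom S' a b" if "f \<in> hom S a b" for f a b
    using that \<kappa> by (auto simp: hom_def S'_def)
  have \<kappa>h: "\<kappa> (\<iota> f) = f" if "f \<in> hom S a b" for f a b
    using that \<kappa> by (auto simp: hom_def)
  have sim: "Obj S' = Obj S" "Idn S' a = \<iota> (Idn S a)" "Comp S' g f = \<iota> (Comp S (\<kappa> g) (\<kappa> f))"
    "Str S' x = \<iota> (Str S x)" for a g f x
    by (simp_all add: S'_def)
  have "category S'"
  proof
    fix f assume "f \<in> Arr S'"
    then show "Dom S' f \<in> Obj S'" "Cod S' f \<in> Obj S'"
      using \<kappa> S.J.B.dom_obj S.J.B.cod_obj by (auto simp: S'_def)
  next
    fix f g a b c assume "f \<in> hom S' a b" "g \<in> hom S' b c"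
    then show "Comp S' g f \<in> hom S' a c"
      using S.J.B.comp_hom by (auto simp: sim dest!: homE intro!: homI)
  next
    fix f g h a b c d assume "f \<in> hom S' a b" "g \<in> hom S' b c" "h \<in> hom S' c d"
    then obtain f' g' h' where *: "\<kappa> f = f'" "\<kappa> g = g'" "\<kappa> h = h'"
      "f' \<in> hom S a b" "g' \<in> hom S b c" "h' \<in> hom S c d" by (auto dest!: homE)
    then show "Comp S' h (Comp S' g f) = Comp S' (Comp S' h g) f"
      using \<kappa>h[OF S.J.B.comp_hom[OF *(4,5)]] \<kappa>h[OF S.J.B.comp_hom[OF *(5,6)]] S.J.B.comp_assoc[OF *(4-6)]
      by (simp add: sim)
  next
    fix a assume "a \<in> Obj S'"
    then show "Idn S' a \<in> hom S' a a" by (auto simp: sim intro!: homI S.J.B.idn_hom)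
  next
    fix f a b assume "f \<in> hom S' a b"
    then obtain f' where f': "f = \<iota> f'" "f' \<in> hom S a b" "\<kappa> f = f'" by (auto dest!: homE)
    have "a \<in> Obj S" "b \<in> Obj S" using f'(2) S.J.B.dom_obj S.J.B.cod_obj by (auto simp: hom_def)
    then show "Comp S' (Idn S' b) f = f" "Comp S' f (Idn S' a) = f"
      using f' \<kappa>h[OF S.J.B.idn_hom] S.J.B.idn_left S.J.B.idn_right by (simp_all add: sim)
  qed
  then interpret S': category S' .
  have F\<iota>: "cat_functor S S' (\<lambda>ns. ns) \<iota>"
    by unfold_locales (auto simp: sim homI \<kappa>h)
  have F\<kappa>: "cat_functor S' S (\<lambda>ns. ns) \<kappa>"
  proof
    fix f g a b c assume "f \<in> hom S' a b" "g \<in> hom S' b c"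
    then show "\<kappa> (Comp S' g f) = Comp S (\<kappa> g) (\<kappa> f)"
      using \<kappa>h[OF S.J.B.comp_hom] by (auto simp: sim dest!: homE)
  qed (auto simp: sim \<kappa>h[OF S.J.B.idn_hom] dest: homE)
  have F: "cat_functor theta S' (\<lambda>ns. ns) (Str S')"
    by unfold_locales (auto simp: sim S.J.obj_map S.J.idn_map S.J.comp_map \<kappa>h[OF S.J.arr_map] intro!: homI S.J.arr_map)
  have "globular_theory S'"
  proof (rule globular_theoryI[OF F])
    show "Obj S' = tables" by (simp add: sim S.obj_eq)
  next
    fix ns assume ns: "ns \<in> tables"
    note sum = S.canonical_sum[OF ns]
    have coc: "globular_cocone S' D_obj (\<lambda>f. Str S' (D_arr f)) ns c (\<lambda>i. \<iota> (p i))"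
      if "globular_cocone S D_obj (\<lambda>f. Str S (D_arr f)) ns c p" for c p
      using globular_cocone_image[OF F\<iota> that ns S.Str_D_arr_hom] by (simp add: sim)
    have DS': "Str S' (D_arr f) \<in> hom S' [k] [l]" if "f \<in> hom globe k l" for f k l
      using that by (auto simp: sim intro!: homI S.Str_D_arr_hom)
    have "globular_cocone S D_obj (\<lambda>f. \<kappa> (Str S' (D_arr f))) ns c (\<lambda>i. \<kappa> (q i))"
      if "globular_cocone S' D_obj (\<lambda>f. Str S' (D_arr f)) ns c q" for c q
      using globular_cocone_image[OF F\<kappa> that ns DS'] .
    \<comment> \<open>\<open>\<kappa>\<close> inverts \<open>\<iota>\<close> only on arrows of
      \<open>S\<close>, and \<open>D_arr f\<close> is junk for \<open>f\<close> outside the globe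
      category, so the two diagrams are compared just at the maps that a cocone mentions.\<close>
    moreover have "\<kappa> (Str S' (D_arr (Sig k l))) = Str S (D_arr (Sig k l))"
      "\<kappa> (Str S' (D_arr (Tau k l))) = Str S (D_arr (Tau k l))" if "k < l" for k l
      using that \<kappa>h[OF S.Str_D_arr_hom[of _ k l]] by (simp_all add: sim globe_hom)
    ultimately have coc': "globular_cocone S D_obj (\<lambda>f. Str S (D_arr f)) ns c (\<lambda>i. \<kappa> (q i))"
      if "globular_cocone S' D_obj (\<lambda>f. Str S' (D_arr f)) ns c q" for c q
      using that tables_odd[OF ns] unfolding globular_cocone_def by (metis (no_types, lifting))
    show "globular_sum S' D_obj (\<lambda>f. Str S' (D_arr f)) ns ns (\<lambda>i. Str S' (theta_incl ns i))"
      unfolding globular_sum_def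
    proof (intro conjI allI impI)
      show "globular_cocone S' D_obj (\<lambda>f. Str S' (D_arr f)) ns ns (\<lambda>i. Str S' (theta_incl ns i))"
        using coc[OF globular_sum_cocone[OF sum]] by (simp add: sim)
    next
      fix c q assume q: "globular_cocone S' D_obj (\<lambda>f. Str S' (D_arr f)) ns c q"
      obtain h where h: "h \<in> hom S ns c"
        "\<And>i. i < length ns \<Longrightarrow> Comp S h (Str S (theta_incl ns i)) = \<kappa> (q i)"
        using globular_sum_tuple[OF sum coc'[OF q]] by metis
      have qq: "\<iota> (\<kappa> (q i)) = q i" if "i < length ns" for i
        using q that by (auto simp: globular_cocone_def dest!: homE)
      show "\<exists>!h. h \<in> hom S' ns c \<and> (\<forall>i<length ns. Comp S' h (Str S' (theta_incl ns i)) = q i)"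
      proof (rule ex1I[of _ "\<iota> h"])
        show "\<iota> h \<in> hom S' ns c \<and> (\<forall>i<length ns. Comp S' (\<iota> h) (Str S' (theta_incl ns i)) = q i)"
          using h qq ns by (auto simp: sim homI \<kappa>h \<kappa>h[OF S.incl_hom])
      next
        fix k assume k: "k \<in> hom S' ns c \<and> (\<forall>i<length ns. Comp S' k (Str S' (theta_incl ns i)) = q i)"
        then obtain k' where k': "k = \<iota> k'" "k' \<in> hom S ns c" "\<kappa> k = k'" by (auto dest!: homE)
        have "k' = h"
        proof (rule S.incl_ext[OF ns k'(2) h(1)])
          fix i assume i: "i < length ns"
          have "\<iota> (Comp S k' (Str S (theta_incl ns i))) = q i"
            using k k' i ns by (auto simp: sim \<kappa>h[OF S.incl_hom])
          then show "Comp S k' (Str S (theta_incl ns i)) = Comp S h (Str S (theta_incl ns i))"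
            using h(2)[OF i] \<kappa>h[OF S.J.B.comp_hom[OF S.incl_hom[OF ns i] k'(2)]] by simp
        qed
        then show "k = \<iota> h" using k' by simp
      qed
    qed
  qed
  moreover have "theory_morphism S S' \<iota>"
    using F\<iota> by (simp add: theory_morphism_def sim)
  moreover have "theory_morphism S' S \<kappa>"
  proof -
    have "\<kappa> (\<iota> (Str S x)) = Str S x" if "x \<in> Arr theta" for x
      using \<kappa>h[OF S.J.arr_map[of x "Dom theta x" "Cod theta x"]] that by (simp add: hom_def)
    then show ?thesis using F\<kappa> by (simp add: theory_morphism_def sim)
  qed
  ultimately show thesis using that \<kappa> by blast
qed

text \<open>The existence half of freeness for test objects over an arbitrary type, at the price of
  an injection of their arrows into \<open>'m\<close>: extend into the copy, then map back.\<close>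

lemma free_liftings_extend:
  fixes T :: "'m gtheory" and S :: "'a gtheory" and \<iota> :: "'a \<Rightarrow> 'm"
  assumes free: "free_liftings T F T' P \<phi>" and S: "globular_theory S" and small: "inj_on \<iota> (Arr S)"
    and Q: "theory_morphism T S Q" and \<theta>: "liftings_along Q S F \<theta>"
  obtains R where "theory_morphism T' S R" "\<And>f. f \<in> Arr T \<Longrightarrow> R (P f) = Q f"
    "\<And>i. i \<in> idx F \<Longrightarrow> R (\<phi> i) = \<theta> i"
proof -
  obtain S' :: "'m gtheory" and \<kappa> where S': "globular_theory S'" "theory_morphism S S' \<iota>" "theory_morphism S' S \<kappa>"
    and \<kappa>: "\<And>f. f \<in> Arr S \<Longrightarrow> \<kappa> (\<iota> f) = f"
    using globular_theory_transport[OF S small] by metis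
  have "liftings_along (\<lambda>f. \<iota> (Q f)) S' F (\<lambda>i. \<iota> (\<theta> i))"
    using \<theta> globular_theory.lifting_map[OF S S'(2)] by (simp add: liftings_along_def)
  then obtain R where R: "theory_morphism T' S' R" "\<forall>f\<in>Arr T. R (P f) = \<iota> (Q f)" "\<forall>i\<in>idx F. R (\<phi> i) = \<iota> (\<theta> i)"
    using free S'(1) theory_morphism_comp[OF Q S'(2)] unfolding free_liftings_def by blast
  have "\<theta> i \<in> Arr S" if "i \<in> idx F" for i
    using \<theta> that by (auto simp: liftings_along_def lifting_def hom_def)
  then show thesis
    using that[OF theory_morphism_comp[OF R(1) S'(3)]] R(2,3) \<kappa> theory_morphism_Arr[OF Q] by simp
qed

lemma chain_colimit_extend:
  fixes T :: "nat \<Rightarrow> 'm gtheory" and S :: "'a gtheory" and \<iota> :: "'a \<Rightarrow> 'm"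
  assumes colim: "chain_colimit T P T\<omega> K" and S: "globular_theory S" and small: "inj_on \<iota> (Arr S)"
    and L: "\<And>n. theory_morphism (T n) S (L n)" and LP: "\<And>n f. f \<in> Arr (T n) \<Longrightarrow> L (Suc n) (P n f) = L n f"
  obtains R where "\<And>n f. f \<in> Arr (T n) \<Longrightarrow> R (K n f) = L n f"
proof -
  obtain S' :: "'m gtheory" and \<kappa> where S': "globular_theory S'" "theory_morphism S S' \<iota>" "theory_morphism S' S \<kappa>"
    and \<kappa>: "\<And>f. f \<in> Arr S \<Longrightarrow> \<kappa> (\<iota> f) = f"
    using globular_theory_transport[OF S small] by metis
  have "chain_cocone T P S' (\<lambda>n f. \<iota> (L n f))"
    using S'(1) LP by (simp add: chain_cocone_def theory_morphism_comp[OF L S'(2)])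
  then obtain R where "\<forall>n. \<forall>f\<in>Arr (T n). R (K n f) = \<iota> (L n f)"
    using colim unfolding chain_colimit_def by blast
  then show thesis
    using that[of "\<lambda>f. \<kappa> (R f)"] \<kappa> theory_morphism_Arr[OF L] by simp
qed

section \<open>The endomorphism theory of a globular set\<close>

text \<open>By \<open>ysum_colimit\<close>, for a table \<open>ns\<close> and a globular set
  \<open>Y\<close> these are the families of cells of \<open>Y\<close> that match along the zigzag
  \<open>ns\<close>.\<close>

definition shapes :: "'y gset \<Rightarrow> nat list \<Rightarrow> (nat \<Rightarrow> ycell \<Rightarrow> 'y) set" where
  "shapes Y ns = {x. gset_map (ysum ns) Y x}"

definition pull :: "theta_arr \<Rightarrow> (nat \<Rightarrow> ycell \<Rightarrow> 'y) \<Rightarrow> nat \<Rightarrow> ycell \<Rightarrow> 'y" where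
  "pull a x = (\<lambda>d. compose (cells (ysum (fst a)) d) (x d) (snd (snd a) d))"

lemma pull_shape: "a \<in> hom theta c d \<Longrightarrow> x \<in> shapes Y d \<Longrightarrow> pull a x \<in> shapes Y c"
  by (auto simp: shapes_def pull_def theta_hom intro: gset_map_comp[OF globular_set_ysum])

lemma pull_idn: "x \<in> shapes Y d \<Longrightarrow> pull (Idn theta d) x = x"
  using gset_map_ext[of "ysum d" Y x]
  by (auto simp: shapes_def pull_def theta_simps compose_def extensional_def fun_eq_iff)

lemma pull_comp:
  "a \<in> hom theta c d \<Longrightarrow> b \<in> hom theta d e \<Longrightarrow> pull (Comp theta b a) x = pull a (pull b x)"
  by (auto simp: theta_hom theta_simps pull_def compose_def fun_eq_iff dest: gset_map_cell)

lemma pull_incl: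
  "f \<in> hom globe d (ns ! i) \<Longrightarrow> pull (theta_incl ns i) x d {(0, f)} = x d (ycls ns d i f)"
  by (simp add: pull_def theta_incl_def compose_def ysum_single yincl_def yoneda_def)

lemma pull_D_arr:
  "g \<in> hom globe n m \<Longrightarrow> f \<in> hom globe d n \<Longrightarrow> pull (D_arr g) x d {(0, f)} = x d {(0, gcomp g f)}"
  by (auto simp: pull_def D_arr_def compose_def ysum_single dest: globe_homD)

lemma shapes_single_eqI:
  "x \<in> shapes Y [n] \<Longrightarrow> y \<in> shapes Y [n] \<Longrightarrow>
    (\<And>d f. f \<in> hom globe d n \<Longrightarrow> x d {(0, f)} = y d {(0, f)}) \<Longrightarrow> x = y"
  unfolding shapes_def mem_Collect_eq by (rule single_map_eqI)

lemma shapes_eqI: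
  assumes "x \<in> shapes Y ns" "y \<in> shapes Y ns"
    and eq: "\<And>i. i < length ns \<Longrightarrow> pull (theta_incl ns i) x = pull (theta_incl ns i) y"
  shows "x = y"
proof (rule gset_map_eqI)
  show "gset_map (ysum ns) Y x" "gset_map (ysum ns) Y y" using assms by (simp_all add: shapes_def)
next
  fix d z assume "z \<in> cells (ysum ns) d"
  then obtain i f where "i < length ns" "f \<in> hom globe d (ns ! i)" "z = ycls ns d i f"
    by (rule ycls_cases)
  then show "x d z = y d z" using eq by (metis pull_incl)
qed

text \<open>The colimit property of \<open>ysum ns\<close> restated with maps out of
  \<open>ysum [n]\<close> in place of maps out of \<open>yoneda n\<close>, so that gluing becomes
  equality of restrictions along \<open>D_arr\<close>.\<close>

lemma shapes_tuple:
  assumes ns: "ns \<in> tables" and Y: "globular_set Y"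
    and q: "\<And>i. i < length ns \<Longrightarrow> q i \<in> shapes Y [ns ! i]"
    and glued: "\<And>i. i < length ns \<Longrightarrow> odd i \<Longrightarrow>
      pull (D_arr (Tau (ns ! i) (ns ! (i - 1)))) (q (i - 1)) = q i \<and>
      pull (D_arr (Sig (ns ! i) (ns ! (i + 1)))) (q (i + 1)) = q i"
  obtains x where "x \<in> shapes Y ns" "\<And>i. i < length ns \<Longrightarrow> pull (theta_incl ns i) x = q i"
proof -
  \<comment> \<open>The cell \<open>{(0, f)}\<close> of \<open>ysum [n]\<close> stands for the cell
    \<open>f\<close> of \<open>yoneda n\<close>; \<open>q'\<close> removes this wrapping.\<close>
  define q' where "q' = (\<lambda>i d. \<lambda>f\<in>hom globe d (ns ! i). q i d {(0, f)})"
  have q'm: "gset_map (yoneda (ns ! i)) Y (q' i)" if "i < length ns" for i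
  proof -
    have qi: "gset_map (ysum [ns ! i]) Y (q i)" using q[OF that] by (simp add: shapes_def)
    have "q i d {(0, f)} \<in> cells Y d" if "f \<in> hom globe d (ns ! i)" for d f
      using gset_map_cell[OF qi] that by (simp add: ysum_single)
    moreover have "q i d {(0, gcomp f g)} = act Y g (q i e {(0, f)})"
      if "f \<in> hom globe e (ns ! i)" "g \<in> hom globe d e" for d e f g
      using qi that by (simp add: gset_map_def act_single[symmetric] ysum_single)
    ultimately show ?thesis
      by (auto simp: gset_map_def q'_def yoneda_def gcomp_hom)
  qed
  have "q' (i - 1) d (gcomp (Tau (ns ! i) (ns ! (i - 1))) f) = q' i d f \<and>
      q' (i + 1) d (gcomp (Sig (ns ! i) (ns ! (i + 1))) f) = q' i d f"
    if i: "i < length ns" "odd i" and f: "f \<in> hom globe d (ns ! i)" for i d f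
  proof -
    note t = tables_odd[OF ns i]
    have h: "Tau (ns ! i) (ns ! (i - 1)) \<in> hom globe (ns ! i) (ns ! (i - 1))"
      "Sig (ns ! i) (ns ! (i + 1)) \<in> hom globe (ns ! i) (ns ! (i + 1))"
      using t by (auto simp: globe_hom)
    show ?thesis
      using glued[OF i] pull_D_arr[OF h(1) f, of "q (i - 1)"] pull_D_arr[OF h(2) f, of "q (i + 1)"]
        gcomp_hom[OF f h(1)] gcomp_hom[OF f h(2)] f
      by (simp add: q'_def)
  qed
  then obtain x where x: "gset_map (ysum ns) Y x"
    "\<forall>i<length ns. \<forall>d. \<forall>f\<in>hom globe d (ns ! i). x d (yincl ns i d f) = q' i d f"
    using ex1_implies_ex[OF ysum_colimit[OF ns Y q'm]] by blast
  have xs: "x \<in> shapes Y ns" using x by (simp add: shapes_def)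
  have "pull (theta_incl ns i) x = q i" if i: "i < length ns" for i
  proof (rule shapes_single_eqI[OF pull_shape[OF theta_incl_hom[OF ns i] xs] q[OF i]])
    fix d f assume f: "f \<in> hom globe d (ns ! i)"
    then show "pull (theta_incl ns i) x d {(0, f)} = q i d {(0, f)}"
      using x(2) i by (simp add: pull_incl q'_def yincl_def yoneda_def)
  qed
  then show thesis using that xs by blast
qed

lemma pull_lambda_hom:
  "a \<in> hom theta c d \<Longrightarrow> (\<lambda>x\<in>shapes Y d. pull a x) \<in> shapes Y d \<rightarrow>\<^sub>E shapes Y c"
  by (auto intro: pull_shape)

type_synonym 'y endo_arr = "nat list \<times> nat list \<times> ((nat \<Rightarrow> ycell \<Rightarrow> 'y) \<Rightarrow> nat \<Rightarrow> ycell \<Rightarrow> 'y)"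

text \<open>Contravariance: an arrow \<open>ns \<rightarrow> ms\<close> is an operation taking \<open>ms\<close>-shapes to \<open>ns\<close>-shapes.\<close>

definition endo :: "'y gset \<Rightarrow> 'y endo_arr gtheory" where
  "endo Y = \<lparr>Obj = tables,
     Arr = {(c, d, g). c \<in> tables \<and> d \<in> tables \<and> g \<in> shapes Y d \<rightarrow>\<^sub>E shapes Y c},
     Dom = (\<lambda>(c, d, g). c), Cod = (\<lambda>(c, d, g). d),
     Idn = (\<lambda>c. (c, c, \<lambda>x\<in>shapes Y c. x)),
     Comp = (\<lambda>(_, e, g) (c, _, f). (c, e, compose (shapes Y e) f g)),
     Str = (\<lambda>a. (Dom theta a, Cod theta a, \<lambda>x\<in>shapes Y (Cod theta a). pull a x))\<rparr>"

lemma endo_hom: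
  "a \<in> hom (endo Y) c d \<longleftrightarrow>
    c \<in> tables \<and> d \<in> tables \<and> (\<exists>g. a = (c, d, g) \<and> g \<in> shapes Y d \<rightarrow>\<^sub>E shapes Y c)"
  by (auto simp: hom_def endo_def)

lemma endo_simps:
  "Obj (endo Y) = tables"
  "Idn (endo Y) c = (c, c, \<lambda>x\<in>shapes Y c. x)"
  "Comp (endo Y) (d, e, g) (c, d', f) = (c, e, compose (shapes Y e) f g)"
  by (simp_all add: endo_def)

lemma endo_Str: "a \<in> hom theta c d \<Longrightarrow> Str (endo Y) a = (c, d, \<lambda>x\<in>shapes Y d. pull a x)"
  by (simp add: endo_def hom_def)

lemma endo_app: "a \<in> hom (endo Y) c d \<Longrightarrow> x \<in> shapes Y d \<Longrightarrow> snd (snd a) x \<in> shapes Y c"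
  by (auto simp: endo_hom)

lemma endo_eqI:
  assumes "a \<in> hom (endo Y) c d" "b \<in> hom (endo Y) c d"
    and "\<And>x. x \<in> shapes Y d \<Longrightarrow> snd (snd a) x = snd (snd b) x"
  shows "a = b"
proof -
  from assms obtain g g' where g: "a = (c, d, g)" "b = (c, d, g')"
    "g \<in> shapes Y d \<rightarrow>\<^sub>E shapes Y c" "g' \<in> shapes Y d \<rightarrow>\<^sub>E shapes Y c"
    by (auto simp: endo_hom)
  have "g = g'" by (rule PiE_ext[OF g(3,4)]) (use assms(3) g in auto)
  then show ?thesis using g by simp
qed

lemma endo_comp_app:
  "a \<in> hom (endo Y) c d \<Longrightarrow> b \<in> hom (endo Y) d e \<Longrightarrow> x \<in> shapes Y e \<Longrightarrow>
    snd (snd (Comp (endo Y) b a)) x = snd (snd a) (snd (snd b) x)"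
  by (auto simp: endo_hom endo_simps compose_def)

lemma endo_Str_app:
  "a \<in> hom theta c d \<Longrightarrow> x \<in> shapes Y d \<Longrightarrow> snd (snd (Str (endo Y) a)) x = pull a x"
  by (simp add: endo_Str)

lemma category_endo: "category (endo Y)"
proof
  fix a assume "a \<in> Arr (endo Y)"
  then show "Dom (endo Y) a \<in> Obj (endo Y)" "Cod (endo Y) a \<in> Obj (endo Y)" by (auto simp: endo_def)
next
  fix c assume "c \<in> Obj (endo Y)"
  then show "Idn (endo Y) c \<in> hom (endo Y) c c" by (simp add: endo_simps endo_hom)
next
  show comp: "Comp (endo Y) g f \<in> hom (endo Y) a c"
    if "f \<in> hom (endo Y) a b" "g \<in> hom (endo Y) b c" for f g a b c
  proof -
    obtain f' g' where "f = (a, b, f')" "g = (b, c, g')" "a \<in> tables" "c \<in> tables"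
      "f' \<in> shapes Y b \<rightarrow>\<^sub>E shapes Y a" "g' \<in> shapes Y c \<rightarrow>\<^sub>E shapes Y b"
      using \<open>f \<in> hom (endo Y) a b\<close> \<open>g \<in> hom (endo Y) b c\<close> by (auto simp: endo_hom)
    moreover from this have "compose (shapes Y c) f' g' \<in> shapes Y c \<rightarrow>\<^sub>E shapes Y a"
      by (simp add: PiE_def funcset_compose[of g' "shapes Y c" "shapes Y b"])
    ultimately show ?thesis by (simp add: endo_hom endo_simps)
  qed
  fix f a b assume f: "f \<in> hom (endo Y) a b"
  then have id: "Idn (endo Y) b \<in> hom (endo Y) b b" "Idn (endo Y) a \<in> hom (endo Y) a a"
    by (auto simp: endo_simps endo_hom)
  show "Comp (endo Y) (Idn (endo Y) b) f = f"
    by (rule endo_eqI[OF comp[OF f id(1)] f]) (subst endo_comp_app[OF f id(1)], simp_all add: endo_simps)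
  show "Comp (endo Y) f (Idn (endo Y) a) = f"
    by (rule endo_eqI[OF comp[OF id(2) f] f])
      (subst endo_comp_app[OF id(2) f], simp_all add: endo_simps endo_app[OF f])
next
  fix f g h a b c d assume "f \<in> hom (endo Y) a b" "g \<in> hom (endo Y) b c" "h \<in> hom (endo Y) c d"
  then obtain f' g' h' where "f = (a, b, f')" "g = (b, c, g')" "h = (c, d, h')"
    and h': "h' \<in> shapes Y d \<rightarrow>\<^sub>E shapes Y c"
    by (auto simp: endo_hom)
  then show "Comp (endo Y) h (Comp (endo Y) g f) = Comp (endo Y) (Comp (endo Y) h g) f"
    using compose_assoc[of h' "shapes Y d" "shapes Y c" f' g'] by (simp add: endo_simps PiE_def)
qed

text \<open>Giving a shape over \<open>ns\<close> is giving matching shapes over its globes, so an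
  operation with values in \<open>ns\<close>-shapes is a matching family of operations with values
  in globes. Contravariance turns this limit description into the required colimit.\<close>

lemma globular_theory_endo:
  assumes Y: "globular_set Y"
  shows "globular_theory (endo Y)"
proof (rule globular_theoryI)
  interpret E: category "endo Y" by (rule category_endo)
  interpret theta: category theta by (rule category_theta)
  have Str: "Str (endo Y) a \<in> hom (endo Y) c d" if a: "a \<in> hom theta c d" for a c d
    using a pull_lambda_hom[OF a, of Y] by (auto simp: endo_Str[OF a] endo_hom theta_hom)
  show "cat_functor theta (endo Y) (\<lambda>ns. ns) (Str (endo Y))"
  proof
    fix c assume "c \<in> Obj theta"
    then have id: "Idn theta c \<in> hom theta c c" by (rule theta.idn_hom)
    show "Str (endo Y) (Idn theta c) = Idn (endo Y) c"
      by (simp add: endo_Str[OF id] endo_simps pull_idn cong: restrict_cong)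
  next
    fix a b c d e assume a: "a \<in> hom theta c d" and b: "b \<in> hom theta d e"
    show "Str (endo Y) (Comp theta b a) = Comp (endo Y) (Str (endo Y) b) (Str (endo Y) a)"
      by (rule endo_eqI[OF Str[OF theta.comp_hom[OF a b]] E.comp_hom[OF Str[OF a] Str[OF b]]])
        (simp add: endo_comp_app[OF Str[OF a] Str[OF b]] endo_Str_app[OF a] endo_Str_app[OF b]
          endo_Str_app[OF theta.comp_hom[OF a b]] pull_comp[OF a b] pull_shape[OF b])
  qed (auto simp: endo_simps theta_simps intro: Str)
  fix ns assume ns: "ns \<in> tables"
  have incl: "Str (endo Y) (theta_incl ns i) \<in> hom (endo Y) [ns ! i] ns" if "i < length ns" for i
    using Str[OF theta_incl_hom[OF ns that]] .
  have D: "D_arr (Tau (ns ! i) (ns ! (i - 1))) \<in> hom theta [ns ! i] [ns ! (i - 1)]"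
    "D_arr (Sig (ns ! i) (ns ! (i + 1))) \<in> hom theta [ns ! i] [ns ! (i + 1)]"
    if "i < length ns" "odd i" for i
    using tables_odd[OF ns that] by (auto intro!: D_arr_hom simp: globe_hom)
  show "globular_sum (endo Y) D_obj (\<lambda>f. Str (endo Y) (D_arr f)) ns ns
      (\<lambda>i. Str (endo Y) (theta_incl ns i))"
    unfolding globular_sum_def
  proof (intro conjI allI impI)
    show "globular_cocone (endo Y) D_obj (\<lambda>f. Str (endo Y) (D_arr f)) ns ns
        (\<lambda>i. Str (endo Y) (theta_incl ns i))"
      by (rule globular_cocone_image[OF \<open>cat_functor theta (endo Y) (\<lambda>ns. ns) (Str (endo Y))\<close>
            globular_sum_cocone[OF theta_globular_sum[OF ns]] ns D_arr_hom])
  next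
    fix c q assume cocone: "globular_cocone (endo Y) D_obj (\<lambda>f. Str (endo Y) (D_arr f)) ns c q"
    then have c: "c \<in> tables" and q: "\<And>i. i < length ns \<Longrightarrow> q i \<in> hom (endo Y) [ns ! i] c"
      by (auto simp: globular_cocone_def endo_simps)
    \<comment> \<open>The cocone is evaluated at one argument \<open>x\<close>: its equations become
      the gluing conditions, and the tuples obtained for all \<open>x\<close> are then assembled by
      choice.\<close>
    have "\<exists>y\<in>shapes Y ns. \<forall>i<length ns. pull (theta_incl ns i) y = snd (snd (q i)) x"
      if x: "x \<in> shapes Y c" for x
    proof (rule shapes_tuple[OF ns Y, of "\<lambda>i. snd (snd (q i)) x"])
      show "snd (snd (q i)) x \<in> shapes Y [ns ! i]" if "i < length ns" for i
        using endo_app[OF q[OF that] x] .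
    next
      fix i assume i: "i < length ns" "odd i"
      note t = tables_odd[OF ns i]
      have "snd (snd (Comp (endo Y) (q (i - 1)) (Str (endo Y) (D_arr (Tau (ns ! i) (ns ! (i - 1))))))) x
          = snd (snd (q i)) x"
        "snd (snd (Comp (endo Y) (q (i + 1)) (Str (endo Y) (D_arr (Sig (ns ! i) (ns ! (i + 1))))))) x
          = snd (snd (q i)) x"
        using cocone i by (simp_all add: globular_cocone_def)
      then show "pull (D_arr (Tau (ns ! i) (ns ! (i - 1)))) (snd (snd (q (i - 1))) x) = snd (snd (q i)) x \<and>
          pull (D_arr (Sig (ns ! i) (ns ! (i + 1)))) (snd (snd (q (i + 1))) x) = snd (snd (q i)) x"
        using endo_comp_app[OF Str[OF D(1)[OF i]] q[OF t(1)] x] endo_comp_app[OF Str[OF D(2)[OF i]] q[OF t(2)] x]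
          endo_Str_app[OF D(1)[OF i] endo_app[OF q[OF t(1)] x]]
          endo_Str_app[OF D(2)[OF i] endo_app[OF q[OF t(2)] x]]
        by simp
    qed blast
    then obtain g where g: "\<And>x. x \<in> shapes Y c \<Longrightarrow> g x \<in> shapes Y ns"
      "\<And>x i. x \<in> shapes Y c \<Longrightarrow> i < length ns \<Longrightarrow> pull (theta_incl ns i) (g x) = snd (snd (q i)) x"
      by metis
    define h where "h = (ns, c, restrict g (shapes Y c))"
    have h: "h \<in> hom (endo Y) ns c" using g(1) ns c by (auto simp: h_def endo_hom)
    have app: "snd (snd (Comp (endo Y) k (Str (endo Y) (theta_incl ns i)))) x
        = pull (theta_incl ns i) (snd (snd k) x)"
      if "k \<in> hom (endo Y) ns c" "i < length ns" "x \<in> shapes Y c" for k i x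
      using endo_comp_app[OF incl[OF that(2)] that(1,3)]
        endo_Str_app[OF theta_incl_hom[OF ns that(2)] endo_app[OF that(1,3)]] by simp
    show "\<exists>!h. h \<in> hom (endo Y) ns c \<and>
        (\<forall>i<length ns. Comp (endo Y) h (Str (endo Y) (theta_incl ns i)) = q i)"
    proof (rule ex1I[of _ h])
      have "Comp (endo Y) h (Str (endo Y) (theta_incl ns i)) = q i" if "i < length ns" for i
        by (rule endo_eqI[OF E.comp_hom[OF incl[OF that] h] q[OF that]])
          (simp add: app[OF h that] g that, simp add: g that h_def)
      then show "h \<in> hom (endo Y) ns c \<and>
          (\<forall>i<length ns. Comp (endo Y) h (Str (endo Y) (theta_incl ns i)) = q i)"
        using h by blast
    next
      fix k assume k: "k \<in> hom (endo Y) ns c \<and>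
          (\<forall>i<length ns. Comp (endo Y) k (Str (endo Y) (theta_incl ns i)) = q i)"
      show "k = h"
      proof (rule endo_eqI[OF conjunct1[OF k] h])
        fix x assume x: "x \<in> shapes Y c"
        show "snd (snd k) x = snd (snd h) x"
          by (rule shapes_eqI[OF endo_app[OF conjunct1[OF k] x] endo_app[OF h x]])
            (use k x app[OF conjunct1[OF k] _ x] in \<open>auto simp: h_def g\<close>)
      qed
    qed
  qed
qed (simp add: endo_simps)

section \<open>Contractible completion\<close>

definition parallel_cells :: "'y gset \<Rightarrow> nat \<Rightarrow> 'y \<Rightarrow> 'y \<Rightarrow> bool" where
  "parallel_cells Y n a b \<longleftrightarrow> a \<in> cells Y n \<and> b \<in> cells Y n \<and>
     (n = 0 \<or> act Y (Sig (n - 1) n) a = act Y (Sig (n - 1) n) b \<and>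
       act Y (Tau (n - 1) n) a = act Y (Tau (n - 1) n) b)"

definition contractible :: "'y gset \<Rightarrow> bool" where
  "contractible Y \<longleftrightarrow> (\<forall>n a b. parallel_cells Y n a b \<longrightarrow>
     (\<exists>y\<in>cells Y (Suc n). act Y (Sig n (Suc n)) y = a \<and> act Y (Tau n (Suc n)) y = b))"

text \<open>Fillers may be nested, so that pairs involving new cells are filled in the same
  inductive construction. Terms carry no dimension and need not be well formed.\<close>

datatype 'x filled = Cell 'x | Filler "'x filled" "'x filled"

text \<open>A face of codimension one is \<open>a\<close> or \<open>b\<close> itself. A lower face
  is a face of either, since these are parallel in a well-formed term; taking \<open>a\<close> for
  \<open>Sig\<close> and \<open>b\<close> for \<open>Tau\<close> is a convention.\<close>

primrec filled_act :: "'x gset \<Rightarrow> 'x filled \<Rightarrow> garr \<Rightarrow> 'x filled" where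
  "filled_act X (Cell x) = (\<lambda>f. Cell (act X f x))"
| "filled_act X (Filler a b) = (\<lambda>f. case f of Ident n \<Rightarrow> Filler a b
     | Sig n m \<Rightarrow> if m = Suc n then a else filled_act X a (Sig n (m - 1))
     | Tau n m \<Rightarrow> if m = Suc n then b else filled_act X b (Tau n (m - 1)))"

text \<open>Parallelism of \<open>a\<close> and \<open>b\<close> refers to the action, so the action
  is defined on all terms beforehand and the cells are singled out afterwards.\<close>

inductive filled_cell :: "'x gset \<Rightarrow> nat \<Rightarrow> 'x filled \<Rightarrow> bool" for X where
  Cell: "x \<in> cells X n \<Longrightarrow> filled_cell X n (Cell x)"
| Filler: "filled_cell X n a \<Longrightarrow> filled_cell X n b \<Longrightarrow>
    n = 0 \<or> filled_act X a (Sig (n - 1) n) = filled_act X b (Sig (n - 1) n) \<and>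
      filled_act X a (Tau (n - 1) n) = filled_act X b (Tau (n - 1) n) \<Longrightarrow>
    filled_cell X (Suc n) (Filler a b)"

definition completion :: "'x gset \<Rightarrow> 'x filled gset" where
  "completion X = \<lparr>cells = (\<lambda>n. {y. filled_cell X n y}), act = (\<lambda>f y. filled_act X y f)\<rparr>"

lemma filled_act_cell:
  assumes X: "globular_set X" and "filled_cell X m y" "f \<in> hom globe n m"
  shows "filled_cell X n (filled_act X y f)"
  using assms(2,3)
proof (induction arbitrary: f rule: filled_cell.induct)
  case (Cell x m)
  then show ?case using X by (auto simp: globular_set_def intro: filled_cell.Cell)
next
  case (Filler m a b)
  then show ?case
    by (cases f) (auto simp: globe_hom intro: filled_cell.Filler)
qed

lemma filled_act_Ident: "globular_set X \<Longrightarrow> filled_cell X n y \<Longrightarrow> filled_act X y (Ident n) = y"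
  by (erule filled_cell.cases) (auto simp: globular_set_def)

text \<open>The critical case restricts a filler along \<open>g\<close> of one kind and then along
  \<open>f\<close> of the other: one side yields a face of \<open>a\<close>, the other a face of
  \<open>b\<close>, and parallelism identifies them.\<close>

lemma filled_act_comp:
  assumes X: "globular_set X" and "filled_cell X k y" "f \<in> hom globe n m" "g \<in> hom globe m k"
  shows "filled_act X y (gcomp g f) = filled_act X (filled_act X y g) f"
  using assms(2-4)
proof (induction arbitrary: f g n m rule: filled_cell.induct)
  case (Cell x k)
  then show ?case using X by (auto simp: globular_set_def)
next
  case (Filler k a b)
  \<comment> \<open>Parallelism, given for faces of codimension one, passes to all lower faces
    because these factor through dimension \<open>k - 1\<close>.\<close>
  have par: "filled_act X a (Sig n k) = filled_act X b (Sig n k) \<and>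
      filled_act X a (Tau n k) = filled_act X b (Tau n k)" if "n < k" for n
  proof (cases "n = k - 1")
    case False
    then have "Sig n (k - 1) \<in> hom globe n (k - 1)" "Sig (k - 1) k \<in> hom globe (k - 1) k"
      "Tau n (k - 1) \<in> hom globe n (k - 1)" "Tau (k - 1) k \<in> hom globe (k - 1) k"
      using that by (auto simp: globe_hom)
    then show ?thesis
      using Filler.hyps(3) that Filler.IH(1)[of "Sig n (k - 1)" n "k - 1" "Sig (k - 1) k"]
        Filler.IH(2)[of "Sig n (k - 1)" n "k - 1" "Sig (k - 1) k"]
        Filler.IH(1)[of "Tau n (k - 1)" n "k - 1" "Tau (k - 1) k"]
        Filler.IH(2)[of "Tau n (k - 1)" n "k - 1" "Tau (k - 1) k"]
      by simp
  qed (use Filler.hyps(3) that in auto)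
  have low: "m \<le> k" if "Sig m (Suc k) \<in> hom globe m (Suc k) \<or> Tau m (Suc k) \<in> hom globe m (Suc k)" for m
    using that by (auto simp: globe_hom)
  show ?case
  proof (cases f)
    case (Ident i)
    have "filled_cell X (Suc k) (Filler a b)"
      by (rule filled_cell.Filler) (use Filler.hyps in auto)
    then have "filled_cell X m (filled_act X (Filler a b) g)"
      using Filler.prems by (intro filled_act_cell[OF X])
    from filled_act_Ident[OF X this] show ?thesis
      using Ident Filler.prems by (auto simp: globe_hom simp del: filled_act.simps)
  next
    case (Sig i j)
    then have f: "f = Sig n m" "n < m" using Filler.prems by (auto simp: globe_hom)
    show ?thesis
    proof (cases g)
      case (Sig i' j')
      then show ?thesis
        using f Filler.prems Filler.IH(1)[of f n m "Sig m k"] by (auto simp: globe_hom)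
    next
      case (Tau i' j')
      then show ?thesis
        using f Filler.prems Filler.IH(2)[of f n m "Tau m k"] par by (auto simp: globe_hom)
    qed (use f Filler.prems in \<open>auto simp: globe_hom\<close>)
  next
    case (Tau i j)
    then have f: "f = Tau n m" "n < m" using Filler.prems by (auto simp: globe_hom)
    show ?thesis
    proof (cases g)
      case (Sig i' j')
      then show ?thesis
        using f Filler.prems Filler.IH(1)[of f n m "Sig m k"] par by (auto simp: globe_hom)
    next
      case (Tau i' j')
      then show ?thesis
        using f Filler.prems Filler.IH(2)[of f n m "Tau m k"] by (auto simp: globe_hom)
    qed (use f Filler.prems in \<open>auto simp: globe_hom\<close>)
  qed
qed

lemma globular_set_completion:
  assumes "globular_set X"
  shows "globular_set (completion X)"
  using filled_act_cell[OF assms] filled_act_Ident[OF assms] filled_act_comp[OF assms]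
  by (simp add: globular_set_def completion_def)

lemma contractible_completion: "contractible (completion X)"
  unfolding contractible_def parallel_cells_def
proof (intro allI impI)
  fix n a b
  assume "a \<in> cells (completion X) n \<and> b \<in> cells (completion X) n \<and>
    (n = 0 \<or> act (completion X) (Sig (n - 1) n) a = act (completion X) (Sig (n - 1) n) b \<and>
       act (completion X) (Tau (n - 1) n) a = act (completion X) (Tau (n - 1) n) b)"
  then show "\<exists>y\<in>cells (completion X) (Suc n).
      act (completion X) (Sig n (Suc n)) y = a \<and> act (completion X) (Tau n (Suc n)) y = b"
    by (intro bexI[of _ "Filler a b"]) (auto simp: completion_def intro: filled_cell.Filler)
qed

lemma completion_Cell:
  "x \<in> cells X n \<Longrightarrow> Cell x \<in> cells (completion X) n"
  "act (completion X) f (Cell x) = Cell (act X f x)"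
  by (simp_all add: completion_def filled_cell.Cell)

section \<open>Small subtheories\<close>

text \<open>Names for the arrows of the subtheory. \<open>Opn\<close> stands for a family of binary
  operations labelled by \<open>'m\<close>; in the application the labels come from adjoined
  liftings and the operations choose fillers.\<close>

datatype 'm tm = Gen 'm | Cmp "'m tm" "'m tm" | Tup "'m tm list" | Opn 'm "'m tm" "'m tm"

text \<open>An infinite type contains copies of the natural numbers and of its own square; a pairing
  together with a distinct tag for each constructor then codes terms injectively.\<close>

lemma tm_embedding:
  assumes inf: "infinite (UNIV :: 'm set)"
  obtains enc :: "'m tm \<Rightarrow> 'm" where "inj enc"
proof -
  obtain p :: "'m \<times> 'm \<Rightarrow> 'm" where p: "bij_betw p (UNIV \<times> UNIV) UNIV"
    using card_of_Times_same_infinite[OF inf] card_of_ordIso by blast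
  then have p: "p (a, b) = p (c, d) \<longleftrightarrow> a = c \<and> b = d" for a b c d
    using inj_eq[of p] by (simp add: bij_betw_def)
  obtain tag :: "nat \<Rightarrow> 'm" where "inj tag"
    using infinite_countable_subset[OF inf] by blast
  then have tag: "tag i = tag j \<longleftrightarrow> i = j" for i j by (rule inj_eq)
  define encl where "encl = rec_list (p (tag 0, tag 0)) (\<lambda>x xs r. p (tag 1, p (x, r)))"
  have encl: "xs = ys" if "encl xs = encl ys" for xs ys
    using that
  proof (induction xs arbitrary: ys)
    case Nil then show ?case by (cases ys) (auto simp: encl_def p tag)
  next
    case (Cons x xs) then show ?case by (cases ys) (auto simp: encl_def p tag)
  qed
  define enc where "enc = rec_tm (\<lambda>a. p (tag 0, a)) (\<lambda>s t x y. p (tag 1, p (x, y)))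
      (\<lambda>ts. p (tag 2, encl (map snd ts))) (\<lambda>a s t x y. p (tag 3, p (a, p (x, y))))"
  have enc: "enc (Gen a) = p (tag 0, a)" "enc (Cmp s t) = p (tag 1, p (enc s, enc t))"
    "enc (Tup ts) = p (tag 2, encl (map enc ts))" "enc (Opn a s t) = p (tag 3, p (a, p (enc s, enc t)))"
    for a s t ts
    by (simp_all add: enc_def comp_def)
  have "s = t" if "enc s = enc t" for s t
    using that
  proof (induction s arbitrary: t)
    case (Tup ss)
    then obtain ts where t: "t = Tup ts" by (cases t) (auto simp: enc p tag)
    then have eq: "map enc ss = map enc ts" using Tup.prems by (auto simp: enc p dest!: encl)
    have "ss = ts"
    proof (rule nth_equalityI)
      show len: "length ss = length ts" using eq by (rule map_eq_imp_length_eq)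
      fix i assume "i < length ss"
      then show "ss ! i = ts ! i"
        using Tup.IH[of "ss ! i" "ts ! i"] arg_cong[OF eq, of "\<lambda>xs. xs ! i"] len by simp
    qed
    then show ?case using t by simp
  next
    case (Gen a) then show ?case by (cases t) (auto simp: enc p tag)
  next
    case (Cmp a b) then show ?case by (cases t) (auto simp: enc p tag)
  next
    case (Opn c a b) then show ?case by (cases t) (auto simp: enc p tag)
  qed
  then show thesis using that by (blast intro: injI)
qed

text \<open>A downward Loewenheim--Skolem argument: the arrows denoted by terms over \<open>'m\<close> form a subtheory.\<close>

lemma small_subtheory:
  fixes E :: "'a gtheory" and gen :: "'m \<Rightarrow> 'a" and opn :: "'m \<Rightarrow> 'a \<Rightarrow> 'a \<Rightarrow> 'a"
  assumes E: "globular_theory E" and inf: "infinite (UNIV :: 'm set)"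
    and gen: "\<And>x. x \<in> Arr theta \<Longrightarrow> Str E x \<in> range gen"
  obtains A and \<iota> :: "'a \<Rightarrow> 'm" where "A \<subseteq> Arr E" "globular_theory (E\<lparr>Arr := A\<rparr>)" "inj_on \<iota> A"
    "\<And>x. x \<in> Arr theta \<Longrightarrow> Str E x \<in> A"
    "\<And>a f g. f \<in> A \<Longrightarrow> g \<in> A \<Longrightarrow> opn a f g \<in> Arr E \<Longrightarrow> opn a f g \<in> A"
proof -
  interpret E: globular_theory E by fact
  \<comment> \<open>A term \<open>Tup\<close> records components but neither source nor codomain;
    the choice is harmless because both can be read off from the components.\<close>
  define tuple where "tuple = (\<lambda>ps. SOME h. h \<in> Arr E \<and> length (Dom E h) = length ps \<and>
      (\<forall>i<length ps. Comp E h (Str E (theta_incl (Dom E h) i)) = ps ! i))"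
  have tuple: "tuple ps = h" if h: "h \<in> hom E ns c" and ns: "ns \<in> tables" and len: "length ps = length ns"
    and ps: "\<And>i. i < length ns \<Longrightarrow> Comp E h (Str E (theta_incl ns i)) = ps ! i" for ps h ns c
  proof -
    have "h \<in> Arr E \<and> length (Dom E h) = length ps \<and>
      (\<forall>i<length ps. Comp E h (Str E (theta_incl (Dom E h) i)) = ps ! i)"
      using h len ps by (auto simp: hom_def)
    then have k: "tuple ps \<in> Arr E \<and> length (Dom E (tuple ps)) = length ps \<and>
      (\<forall>i<length ps. Comp E (tuple ps) (Str E (theta_incl (Dom E (tuple ps)) i)) = ps ! i)"
      unfolding tuple_def by (rule someI)
    let ?k = "tuple ps"
    define ns' c' where "ns' = Dom E ?k" and "c' = Cod E ?k"
    have k': "?k \<in> hom E ns' c'" "ns' \<in> tables" "length ns' = length ns"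
      using k E.J.B.dom_obj[of ?k] by (simp_all add: hom_def ns'_def c'_def E.obj_eq len)
    have eq: "Comp E ?k (Str E (theta_incl ns' i)) = Comp E h (Str E (theta_incl ns i))"
      if "i < length ns" for i
      using k ps[OF that] that len by (simp add: ns'_def)
    have "[ns' ! i] = [ns ! i] \<and> c' = c" if i: "i < length ns" for i
      using E.J.B.comp_hom[OF E.incl_hom[OF ns i] h] eq[OF i]
        E.J.B.comp_hom[OF E.incl_hom[OF k'(2), of i] k'(1)] i k'(3) by (auto simp: hom_def)
    \<comment> \<open>A table has odd length, hence at least one entry, and a single component fixes
      the codomain.\<close>
    moreover have "0 < length ns" using ns by (auto simp: tables_def intro: odd_pos)
    ultimately have "ns' = ns" "c' = c" using k'(3) by (auto intro: nth_equalityI)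
    then show ?thesis
      using E.incl_ext[OF ns _ h, of ?k] k' eq by simp
  qed
  define eval where "eval = rec_tm gen (\<lambda>s t g f. Comp E g f) (\<lambda>ts. tuple (map snd ts)) (\<lambda>a s t. opn a)"
  have eval: "eval (Gen a) = gen a" "eval (Cmp s t) = Comp E (eval s) (eval t)"
    "eval (Tup ts) = tuple (map eval ts)" "eval (Opn a s t) = opn a (eval s) (eval t)"
    for a s t ts
    by (simp_all add: eval_def comp_def)
  \<comment> \<open>Terms may denote junk, such as composites of arrows that do not meet, so the
    range of \<open>eval\<close> is cut down to actual arrows.\<close>
  define A where "A = Arr E \<inter> range eval"
  have Str: "Str E x \<in> A" if x: "x \<in> Arr theta" for x
  proof -
    from gen[OF x] obtain a where "Str E x = eval (Gen a)" by (auto simp: eval)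
    moreover have "Str E x \<in> Arr E"
      using E.J.arr_map[of x "Dom theta x" "Cod theta x"] x by (simp add: hom_def)
    ultimately show ?thesis by (simp add: A_def)
  qed
  have "globular_theory (E\<lparr>Arr := A\<rparr>)"
  proof (rule globular_theory_restrict[OF E _ Str])
    fix f g a b c assume fg: "f \<in> hom E a b" "g \<in> hom E b c" "f \<in> A" "g \<in> A"
    then obtain s t where "f = eval s" "g = eval t" by (auto simp: A_def)
    then have "Comp E g f = eval (Cmp t s)" by (simp add: eval)
    then show "Comp E g f \<in> A" using E.J.B.comp_hom[OF fg(1,2)] by (simp add: A_def hom_def)
  next
    fix h ns c assume h: "h \<in> hom E ns c" and ns: "ns \<in> tables"
      and "\<And>i. i < length ns \<Longrightarrow> Comp E h (Str E (theta_incl ns i)) \<in> A"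
    then have "\<forall>i<length ns. \<exists>t. Comp E h (Str E (theta_incl ns i)) = eval t" by (auto simp: A_def)
    then obtain t where t: "\<And>i. i < length ns \<Longrightarrow> Comp E h (Str E (theta_incl ns i)) = eval (t i)"
      by metis
    have "tuple (map eval (map t [0..<length ns])) = h"
      by (rule tuple[OF h ns]) (simp_all add: t)
    then have "h = eval (Tup (map t [0..<length ns]))" by (simp only: eval)
    then show "h \<in> A" using h by (simp add: A_def hom_def)
  qed (auto simp: A_def)
  moreover obtain enc :: "'m tm \<Rightarrow> 'm" where "inj enc" using tm_embedding[OF inf] by metis
  then have "inj_on (\<lambda>a. enc (inv eval a)) A"
    by (intro inj_onI) (metis A_def IntD2 f_inv_into_f injD)
  moreover have "opn a f g \<in> A" if "f \<in> A" "g \<in> A" "opn a f g \<in> Arr E" for a f g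
  proof -
    from \<open>f \<in> A\<close> \<open>g \<in> A\<close> obtain s t where "f = eval s" "g = eval t" by (auto simp: A_def)
    then have "opn a f g = eval (Opn a s t)" by (simp only: eval)
    then show ?thesis using that(3) by (simp add: A_def)
  qed
  ultimately show thesis using that[of A "\<lambda>a. enc (inv eval a)"] Str by (auto simp: A_def)
qed

section \<open>The nerve of a theory and its completion\<close>

text \<open>The map that the Yoneda lemma assigns to the cell \<open>a\<close>. Cells of
  \<open>ysum [n]\<close> are singletons \<open>{(0, f)}\<close>, which \<open>the_elem\<close> and
  \<open>snd\<close> unwrap.\<close>

definition cell_map :: "'y gset \<Rightarrow> nat \<Rightarrow> 'y \<Rightarrow> nat \<Rightarrow> ycell \<Rightarrow> 'y" where
  "cell_map Y n a = (\<lambda>d. \<lambda>c\<in>cells (ysum [n]) d. act Y (snd (the_elem c)) a)"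

lemma cell_map_app: "f \<in> hom globe d n \<Longrightarrow> cell_map Y n a d {(0, f)} = act Y f a"
  by (simp add: cell_map_def ysum_single)

lemma cell_map_shape:
  assumes Y: "globular_set Y" and a: "a \<in> cells Y n"
  shows "cell_map Y n a \<in> shapes Y [n]"
  unfolding shapes_def gset_map_def mem_Collect_eq
proof (intro conjI allI ballI)
  fix d show "cell_map Y n a d \<in> cells (ysum [n]) d \<rightarrow>\<^sub>E cells Y d"
    using Y a by (auto simp: cell_map_def ysum_single globular_set_act)
next
  fix d e f x assume f: "f \<in> hom globe d e" and "x \<in> cells (ysum [n]) e"
  then obtain g where g: "g \<in> hom globe e n" "x = {(0, g)}" by (auto simp: ysum_single)
  then show "cell_map Y n a d (act (ysum [n]) f x) = act Y f (cell_map Y n a e x)"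
    using f Y a by (simp add: act_single cell_map_app gcomp_hom[OF f] globular_set_def)
qed

lemma shapes_single:
  assumes x: "x \<in> shapes Y [n]" and f: "f \<in> hom globe d n"
  shows "x d {(0, f)} = act Y f (x n {(0, Ident n)})"
proof -
  have id: "Ident n \<in> hom globe n n" by (simp add: globe_hom)
  have "x d (act (ysum [n]) f {(0, Ident n)}) = act Y f (x n {(0, Ident n)})"
    using x f id by (auto simp: shapes_def gset_map_def ysum_single)
  then show ?thesis using act_single[OF id f] gcomp_Ident[OF f] by simp
qed

lemma shapes_single_cell: "x \<in> shapes Y [n] \<Longrightarrow> x n {(0, Ident n)} \<in> cells Y n"
  by (auto simp: shapes_def ysum_single globe_hom intro!: gset_map_cell[of "ysum [n]" Y x])

lemma pull_cell_map:
  assumes Y: "globular_set Y" and a: "a \<in> cells Y m" and g: "g \<in> hom globe n m"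
  shows "pull (D_arr g) (cell_map Y m a) = cell_map Y n (act Y g a)"
proof (rule shapes_single_eqI)
  show "pull (D_arr g) (cell_map Y m a) \<in> shapes Y [n]"
    by (intro pull_shape[OF D_arr_hom[OF g]] cell_map_shape Y a)
  show "cell_map Y n (act Y g a) \<in> shapes Y [n]"
    by (intro cell_map_shape Y globular_set_act[OF Y g a])
  fix d f assume f: "f \<in> hom globe d n"
  then show "pull (D_arr g) (cell_map Y m a) d {(0, f)} = cell_map Y n (act Y g a) d {(0, f)}"
    using Y a g gcomp_hom[OF f g] by (simp add: pull_D_arr cell_map_app globular_set_def)
qed

lemma cell_map_eq:
  assumes Y: "globular_set Y" and x: "x \<in> shapes Y [n]"
  shows "cell_map Y n (x n {(0, Ident n)}) = x"
  by (rule shapes_single_eqI[OF cell_map_shape[OF Y shapes_single_cell[OF x]] x])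
    (simp add: cell_map_app shapes_single[OF x])

lemma theta_homI: "c \<in> tables \<Longrightarrow> d \<in> tables \<Longrightarrow> \<alpha> \<in> shapes (ysum d) c \<Longrightarrow> (c, d, \<alpha>) \<in> hom theta c d"
  by (simp add: theta_hom shapes_def)

lemma theta_comp_pull:
  "a \<in> hom theta c d \<Longrightarrow> Comp theta (d, e, \<beta>) a = (c, e, pull a \<beta>)"
  by (auto simp: theta_hom theta_simps pull_def)

text \<open>The arrow \<open>(e) \<rightarrow> ns\<close> corresponding to an \<open>e\<close>-cell of \<open>ysum ns\<close> under the Yoneda lemma.\<close>

definition cell_arr :: "nat list \<Rightarrow> nat \<Rightarrow> ycell \<Rightarrow> theta_arr" where
  "cell_arr ns e x = ([e], ns, cell_map (ysum ns) e x)"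

lemma cell_arr_hom: "ns \<in> tables \<Longrightarrow> x \<in> cells (ysum ns) e \<Longrightarrow> cell_arr ns e x \<in> hom theta [e] ns"
  unfolding cell_arr_def by (intro theta_homI single_table cell_map_shape globular_set_ysum)

lemma cell_arr_act:
  assumes "ns \<in> tables" "x \<in> cells (ysum ns) m" "f \<in> hom globe n m"
  shows "cell_arr ns n (act (ysum ns) f x) = Comp theta (cell_arr ns m x) (D_arr f)"
  using assms by (simp add: cell_arr_def theta_comp_pull[OF D_arr_hom[OF assms(3)]]
      pull_cell_map[OF globular_set_ysum])

lemma cell_arr_comp:
  assumes c: "c \<in> tables" and d: "d \<in> tables" and \<alpha>: "gset_map (ysum c) (ysum d) \<alpha>"
    and x: "x \<in> cells (ysum c) e"
  shows "cell_arr d e (\<alpha> e x) = Comp theta (c, d, \<alpha>) (cell_arr c e x)"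
proof -
  have h: "(c, d, \<alpha>) \<in> hom theta c d" using c d \<alpha> by (simp add: theta_hom)
  have "cell_map (ysum d) e (\<alpha> e x) = pull (cell_arr c e x) \<alpha>"
  proof (rule shapes_single_eqI)
    show "cell_map (ysum d) e (\<alpha> e x) \<in> shapes (ysum d) [e]"
      using gset_map_cell[OF \<alpha> x] by (intro cell_map_shape globular_set_ysum)
    show "pull (cell_arr c e x) \<alpha> \<in> shapes (ysum d) [e]"
      using \<alpha> by (intro pull_shape[OF cell_arr_hom[OF c x]]) (simp add: shapes_def)
    fix n f assume f: "f \<in> hom globe n e"
    then show "cell_map (ysum d) e (\<alpha> e x) n {(0, f)} = pull (cell_arr c e x) \<alpha> n {(0, f)}"
      using \<alpha> x by (simp add: cell_map_app pull_def cell_arr_def compose_def ysum_single gset_map_def)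
  qed
  then show ?thesis by (simp add: theta_comp_pull[OF cell_arr_hom[OF c x]]) (simp add: cell_arr_def)
qed

text \<open>Under Yoneda a coprojection is the top cell of its globe; \<open>nerve_emb_inj\<close>
  uses this to read off the restrictions of an arrow to globes.\<close>

lemma theta_incl_cell_arr:
  assumes ns: "ns \<in> tables" and i: "i < length ns"
  shows "theta_incl ns i = cell_arr ns (ns ! i) (ycls ns (ns ! i) i (Ident (ns ! i)))"
proof -
  let ?n = "ns ! i"
  let ?x = "ycls ns ?n i (Ident ?n)"
  have id: "Ident ?n \<in> hom globe ?n ?n" by (simp add: globe_hom)
  obtain \<beta> where \<beta>: "theta_incl ns i = ([?n], ns, \<beta>)" "\<beta> \<in> shapes (ysum ns) [?n]"
    using theta_incl_hom[OF ns i] by (auto simp: theta_hom shapes_def)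
  have "\<beta> = cell_map (ysum ns) ?n ?x"
  proof (rule shapes_single_eqI[OF \<beta>(2)])
    show "cell_map (ysum ns) ?n ?x \<in> shapes (ysum ns) [?n]"
      by (intro cell_map_shape globular_set_ysum ycls_cell[OF i id])
    fix d f assume f: "f \<in> hom globe d ?n"
    have "\<beta> = snd (snd (theta_incl ns i))" by (simp add: \<beta>)
    then have "\<beta> d {(0, f)} = ycls ns d i f"
      using f by (simp add: theta_incl_def ysum_single yincl_def yoneda_def)
    also have "\<dots> = cell_map (ysum ns) ?n ?x d {(0, f)}"
      using f by (simp add: cell_map_app act_ycls[OF i id f] gcomp_Ident)
    finally show "\<beta> d {(0, f)} = cell_map (ysum ns) ?n ?x d {(0, f)}" .
  qed
  then show ?thesis by (simp add: \<beta>(1) cell_arr_def)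
qed

section \<open>Represented globular sets and their completions\<close>

definition nerve :: "'m gtheory \<Rightarrow> nat list \<Rightarrow> 'm gset" where
  "nerve T b = \<lparr>cells = (\<lambda>n. hom T [n] b), act = (\<lambda>f x. Comp T x (Str T (D_arr f)))\<rparr>"

abbreviation filled_nerve :: "'m gtheory \<Rightarrow> nat list \<Rightarrow> 'm filled gset" where
  "filled_nerve T b \<equiv> completion (nerve T b)"

text \<open>A \<open>d\<close>-shape of the nerve is the same as an arrow \<open>z : d -> b\<close>,
  because \<open>d\<close> is the sum of its globes; this is that shape, viewed in the
  completion.\<close>

definition nerve_emb :: "'m gtheory \<Rightarrow> nat list \<Rightarrow> 'm \<Rightarrow> nat \<Rightarrow> ycell \<Rightarrow> 'm filled" where
  "nerve_emb T d z = (\<lambda>e. \<lambda>x\<in>cells (ysum d) e. Cell (Comp T z (Str T (cell_arr d e x))))"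

context globular_theory begin

lemma globular_set_nerve: "globular_set (nerve T b)"
  unfolding globular_set_def nerve_def gset.simps
proof (intro conjI allI ballI)
  fix n m f x assume "f \<in> hom globe n m" "x \<in> hom T [m] b"
  then show "Comp T x (Str T (D_arr f)) \<in> hom T [n] b"
    by (blast intro: J.B.comp_hom Str_D_arr_hom)
next
  fix n x assume x: "x \<in> hom T [n] b"
  have "D_arr (Ident n) = Idn theta [n]"
    using cat_functor.idn_map[OF cat_functor_D, of n] by (simp add: globe_def)
  then have "Str T (D_arr (Ident n)) = Idn T [n]"
    using J.idn_map[of "[n]"] by (simp add: theta_simps single_table)
  then show "Comp T x (Str T (D_arr (Ident n))) = x" using J.B.idn_right[OF x] by simp
next
  fix n m k f g x assume f: "f \<in> hom globe n m" and g: "g \<in> hom globe m k" and x: "x \<in> hom T [k] b"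
  have "D_arr (gcomp g f) = Comp theta (D_arr g) (D_arr f)"
    using cat_functor.comp_map[OF cat_functor_D f g] by (simp add: globe_def)
  then show "Comp T x (Str T (D_arr (gcomp g f))) = Comp T (Comp T x (Str T (D_arr g))) (Str T (D_arr f))"
    using J.comp_map[OF D_arr_hom[OF f] D_arr_hom[OF g]]
      J.B.comp_assoc[OF Str_D_arr_hom[OF f] Str_D_arr_hom[OF g] x] by simp
qed

lemma Str_cell_arr_hom:
  "ns \<in> tables \<Longrightarrow> x \<in> cells (ysum ns) e \<Longrightarrow> Str T (cell_arr ns e x) \<in> hom T [e] ns"
  by (blast intro: J.arr_map cell_arr_hom)

lemma nerve_emb_shape:
  assumes z: "z \<in> hom T d b"
  shows "nerve_emb T d z \<in> shapes (filled_nerve T b) d"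
  unfolding shapes_def gset_map_def mem_Collect_eq
proof (intro conjI allI ballI)
  have d: "d \<in> tables" using z J.B.dom_obj by (auto simp: hom_def obj_eq)
  note cell = Str_cell_arr_hom[OF d]
  fix n show "nerve_emb T d z n \<in> cells (ysum d) n \<rightarrow>\<^sub>E cells (filled_nerve T b) n"
    using cell z by (auto simp: nerve_emb_def nerve_def intro!: completion_Cell J.B.comp_hom)
next
  have d: "d \<in> tables" using z J.B.dom_obj by (auto simp: hom_def obj_eq)
  fix n m f x assume f: "f \<in> hom globe n m" and x: "x \<in> cells (ysum d) m"
  show "nerve_emb T d z n (act (ysum d) f x) = act (filled_nerve T b) f (nerve_emb T d z m x)"
    using x globular_set_act[OF globular_set_ysum f x] J.comp_map[OF D_arr_hom[OF f] cell_arr_hom[OF d x]]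
      J.B.comp_assoc[OF Str_D_arr_hom[OF f] Str_cell_arr_hom[OF d x] z]
    by (simp add: nerve_emb_def completion_Cell(2) nerve_def cell_arr_act[OF d x f])
qed

lemma pull_nerve_emb:
  assumes z: "z \<in> hom T d b" and a: "a \<in> hom theta c d"
  shows "pull a (nerve_emb T d z) = nerve_emb T c (Comp T z (Str T a))"
proof (intro ext)
  obtain \<alpha> where \<alpha>: "a = (c, d, \<alpha>)" "c \<in> tables" "d \<in> tables" "gset_map (ysum c) (ysum d) \<alpha>"
    using a by (auto simp: theta_hom)
  fix e x
  show "pull a (nerve_emb T d z) e x = nerve_emb T c (Comp T z (Str T a)) e x"
  proof (cases "x \<in> cells (ysum c) e")
    case True
    then show ?thesis
      using gset_map_cell[OF \<alpha>(4) True] cell_arr_comp[OF \<alpha>(2-4) True] J.comp_map[OF cell_arr_hom[OF \<alpha>(2) True] a]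
        J.B.comp_assoc[OF Str_cell_arr_hom[OF \<alpha>(2) True] J.arr_map[OF a] z]
      by (simp add: pull_def nerve_emb_def compose_def \<alpha>(1))
  qed (simp add: pull_def nerve_emb_def compose_def \<alpha>(1))
qed

lemma nerve_emb_inj:
  assumes z: "z \<in> hom T d b" "z' \<in> hom T d b" and eq: "nerve_emb T d z = nerve_emb T d z'"
  shows "z = z'"
proof -
  have d: "d \<in> tables" using z J.B.dom_obj by (auto simp: hom_def obj_eq)
  show ?thesis
  proof (rule incl_ext[OF d z])
    fix i assume i: "i < length d"
    let ?x = "ycls d (d ! i) i (Ident (d ! i))"
    have "?x \<in> cells (ysum d) (d ! i)" using i by (intro ycls_cell) (simp_all add: globe_hom)
    then show "Comp T z (Str T (theta_incl d i)) = Comp T z' (Str T (theta_incl d i))"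
      using fun_cong[OF fun_cong[OF eq], of "d ! i" ?x] by (simp add: nerve_emb_def theta_incl_cell_arr[OF d i])
  qed
qed

end

section \<open>Agreement with the nerve and chosen fillers\<close>

text \<open>The theory acts on its nerve by precomposition; the operation \<open>g\<close> on the
  completion has to extend that action, with no constraint on shapes outside the nerve.\<close>

definition agrees :: "'m gtheory \<Rightarrow> nat list \<Rightarrow> 'm \<Rightarrow> 'm filled endo_arr \<Rightarrow> bool" where
  "agrees T b h g \<longleftrightarrow> (\<forall>z\<in>hom T (Cod T h) b. snd (snd g) (nerve_emb T (Cod T h) z) = nerve_emb T (Dom T h) (Comp T z h))"

text \<open>Outside the image of \<open>nerve_emb\<close> the value is junk; \<open>fill\<close> uses it only if it happens to be a
  filler.\<close>

definition extension :: "'m gtheory \<Rightarrow> nat list \<Rightarrow> 'm \<Rightarrow> (nat \<Rightarrow> ycell \<Rightarrow> 'm filled) \<Rightarrow> nat \<Rightarrow> ycell \<Rightarrow> 'm filled" where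
  "extension T b h y = nerve_emb T (Dom T h) (Comp T (SOME z. z \<in> hom T (Cod T h) b \<and> y = nerve_emb T (Cod T h) z) h)"

lemma (in globular_theory) extension_nerve_emb:
  assumes "z \<in> hom T (Cod T h) b"
  shows "extension T b h (nerve_emb T (Cod T h) z) = nerve_emb T (Dom T h) (Comp T z h)"
proof -
  have "(SOME z'. z' \<in> hom T (Cod T h) b \<and> nerve_emb T (Cod T h) z = nerve_emb T (Cod T h) z') = z"
    using assms nerve_emb_inj by (intro some_equality) auto
  then show ?thesis by (simp add: extension_def)
qed

definition fill_spec :: "'y gset \<Rightarrow> nat \<Rightarrow> (nat \<Rightarrow> ycell \<Rightarrow> 'y) \<Rightarrow> (nat \<Rightarrow> ycell \<Rightarrow> 'y) \<Rightarrow> (nat \<Rightarrow> ycell \<Rightarrow> 'y) \<Rightarrow> bool" where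
  "fill_spec Y n u v x \<longleftrightarrow> x \<in> shapes Y [n + 1] \<and>
     pull (D_arr (Sig n (n + 1))) x = u \<and> pull (D_arr (Tau n (n + 1))) x = v"

text \<open>The proposal \<open>w\<close> is tested before it is used, so for parallel
  \<open>u\<close>, \<open>v\<close> over a contractible \<open>Y\<close> a lifting results whatever
  \<open>w\<close> is. Dimension and table are read off from \<open>u\<close>, which makes
  \<open>fill Y w\<close> a plain binary operation on arrows, the kind that
  \<open>small_subtheory\<close> closes under.\<close>

definition fill :: "'y gset \<Rightarrow> ((nat \<Rightarrow> ycell \<Rightarrow> 'y) \<Rightarrow> nat \<Rightarrow> ycell \<Rightarrow> 'y) \<Rightarrow> 'y endo_arr \<Rightarrow> 'y endo_arr \<Rightarrow> 'y endo_arr" where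
  "fill Y w u v = (let n = hd (fst u); d = fst (snd u) in
     ([n + 1], d, \<lambda>y\<in>shapes Y d.
       let good = fill_spec Y n (snd (snd u) y) (snd (snd v) y) in
       if good (w y) then w y else SOME x. good x))"

text \<open>Contractibility speaks of cells, liftings in \<open>endo Y\<close> of shapes; the Yoneda
  correspondence between \<open>n\<close>-cells and shapes over \<open>[n]\<close> mediates.\<close>

lemma shapes_filler:
  assumes Y: "globular_set Y" "contractible Y" and xy: "x \<in> shapes Y [n]" "y \<in> shapes Y [n]"
    and par: "n = 0 \<or> pull (D_arr (Sig (n - 1) n)) x = pull (D_arr (Sig (n - 1) n)) y \<and>
      pull (D_arr (Tau (n - 1) n)) x = pull (D_arr (Tau (n - 1) n)) y"
  shows "\<exists>z. fill_spec Y n x y z"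
proof -
  let ?x = "x n {(0, Ident n)}" and ?y = "y n {(0, Ident n)}"
  have "parallel_cells Y n ?x ?y"
    unfolding parallel_cells_def
  proof (intro conjI shapes_single_cell xy)
    show "n = 0 \<or> act Y (Sig (n - 1) n) ?x = act Y (Sig (n - 1) n) ?y \<and>
        act Y (Tau (n - 1) n) ?x = act Y (Tau (n - 1) n) ?y"
    proof (cases "n = 0")
      case False
      then have st: "Sig (n - 1) n \<in> hom globe (n - 1) n" "Tau (n - 1) n \<in> hom globe (n - 1) n"
        "Ident (n - 1) \<in> hom globe (n - 1) (n - 1)"
        by (simp_all add: globe_hom)
      have "act Y f ?x = act Y f ?y"
        if "f \<in> hom globe (n - 1) n" "pull (D_arr f) x = pull (D_arr f) y" "gcomp f (Ident (n - 1)) = f" for f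
        using pull_D_arr[OF that(1) st(3), of x] pull_D_arr[OF that(1) st(3), of y] that
        by (simp flip: shapes_single[OF xy(1) that(1)] shapes_single[OF xy(2) that(1)])
      then show ?thesis using par st False by auto
    qed simp
  qed
  then obtain a where a: "a \<in> cells Y (Suc n)" "act Y (Sig n (Suc n)) a = ?x" "act Y (Tau n (Suc n)) a = ?y"
    using Y(2) unfolding contractible_def by blast
  have "Sig n (Suc n) \<in> hom globe n (Suc n)" "Tau n (Suc n) \<in> hom globe n (Suc n)"
    by (simp_all add: globe_hom)
  then have "fill_spec Y n x y (cell_map Y (Suc n) a)"
    using a cell_map_shape[OF Y(1) a(1)] pull_cell_map[OF Y(1) a(1)]
    by (simp add: fill_spec_def cell_map_eq[OF Y(1) xy(1)] cell_map_eq[OF Y(1) xy(2)])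
  then show ?thesis by blast
qed

text \<open>At each argument \<open>y\<close> the values of \<open>u\<close> and \<open>v\<close>
  are parallel, so a filler exists and the choice succeeds pointwise. The second claim is the hook
  by which a prescribed action survives.\<close>

lemma fill:
  assumes Y: "globular_set Y" "contractible Y" and par: "parallel (endo Y) n d u v"
  shows "lifting (endo Y) n d u v (fill Y w u v)"
    and "y \<in> shapes Y d \<Longrightarrow> fill_spec Y n (snd (snd u) y) (snd (snd v) y) (w y) \<Longrightarrow>
      snd (snd (fill Y w u v)) y = w y"
proof -
  interpret E: globular_theory "endo Y" by (rule globular_theory_endo[OF Y(1)])
  have d: "d \<in> tables" and u: "u \<in> hom (endo Y) [n] d" and v: "v \<in> hom (endo Y) [n] d"
    using par by (simp_all add: parallel_def)
  have nd: "hd (fst u) = n" "fst (snd u) = d" using u by (auto simp: endo_hom)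
  have ex: "\<exists>x. fill_spec Y n (snd (snd u) y) (snd (snd v) y) x" if y: "y \<in> shapes Y d" for y
  proof (rule shapes_filler[OF Y endo_app[OF u y] endo_app[OF v y]])
    show "n = 0 \<or> pull (D_arr (Sig (n - 1) n)) (snd (snd u) y) = pull (D_arr (Sig (n - 1) n)) (snd (snd v) y) \<and>
      pull (D_arr (Tau (n - 1) n)) (snd (snd u) y) = pull (D_arr (Tau (n - 1) n)) (snd (snd v) y)"
    proof (cases "n = 0")
      case False
      have "pull (D_arr f) (snd (snd u) y) = pull (D_arr f) (snd (snd v) y)"
        if f: "f \<in> hom globe (n - 1) n"
          and "Comp (endo Y) u (Str (endo Y) (D_arr f)) = Comp (endo Y) v (Str (endo Y) (D_arr f))" for f
        using that(2) endo_comp_app[OF E.Str_D_arr_hom[OF f] u y] endo_comp_app[OF E.Str_D_arr_hom[OF f] v y]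
        by (simp add: endo_Str_app[OF D_arr_hom[OF f] endo_app[OF u y]]
            endo_Str_app[OF D_arr_hom[OF f] endo_app[OF v y]])
      then show ?thesis using False par by (simp add: parallel_def globe_hom)
    qed simp
  qed
  let ?g = "snd (snd (fill Y w u v))"
  have spec: "fill_spec Y n (snd (snd u) y) (snd (snd v) y) (?g y)" if y: "y \<in> shapes Y d" for y
    using y someI_ex[OF ex[OF y]] by (simp add: fill_def nd Let_def)
  then have "?g y \<in> shapes Y [n + 1]" if "y \<in> shapes Y d" for y
    using that by (auto simp: fill_spec_def)
  then have h: "fill Y w u v \<in> hom (endo Y) [n + 1] d"
    using d by (auto simp: endo_hom single_table fill_def nd Let_def)
  have st: "Sig n (n + 1) \<in> hom globe n (n + 1)" "Tau n (n + 1) \<in> hom globe n (n + 1)"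
    by (simp_all add: globe_hom)
  have face: "Comp (endo Y) (fill Y w u v) (Str (endo Y) (D_arr f)) = t"
    if f: "f \<in> hom globe n (n + 1)" and t: "t \<in> hom (endo Y) [n] d"
      and eq: "\<And>y. y \<in> shapes Y d \<Longrightarrow> pull (D_arr f) (?g y) = snd (snd t) y" for f t
    by (rule endo_eqI[OF E.J.B.comp_hom[OF E.Str_D_arr_hom[OF f] h] t])
      (simp add: endo_comp_app[OF E.Str_D_arr_hom[OF f] h] endo_Str_app[OF D_arr_hom[OF f] endo_app[OF h]] eq)
  show "lifting (endo Y) n d u v (fill Y w u v)"
    unfolding lifting_def using h face[OF st(1) u] face[OF st(2) v] spec by (auto simp: fill_spec_def)
  show "snd (snd (fill Y w u v)) y = w y"
    if "y \<in> shapes Y d" "fill_spec Y n (snd (snd u) y) (snd (snd v) y) (w y)"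
    using that by (simp add: fill_def nd Let_def)
qed

section \<open>Faithfulness\<close>

text \<open>\<open>T\<close> is \<open>theta\<close> with its arrows renamed, and a morphism has to
  commute with \<open>Str\<close>, which leaves only this formula.\<close>

lemma theory_morphism_initial:
  assumes "globular_theory T" "globular_theory S" and bij: "bij_betw (Str T) (Arr theta) (Arr T)"
  shows "theory_morphism T S (\<lambda>f. Str S (inv_into (Arr theta) (Str T) f))"
proof -
  interpret T: globular_theory T by fact
  interpret S: globular_theory S by fact
  let ?i = "inv_into (Arr theta) (Str T)"
  have inv: "?i (Str T x) = x" if "x \<in> Arr theta" for x
    using bij that by (simp add: bij_betw_def)
  have ihom: "?i f \<in> hom theta a b \<and> Str T (?i f) = f" if f: "f \<in> hom T a b" for f a b
  proof -
    have "f \<in> Str T ` Arr theta"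
      using f bij by (simp add: hom_def bij_betw_def)
    then obtain x where x: "x \<in> Arr theta" "f = Str T x" by blast
    then have "f \<in> hom T (Dom theta x) (Cod theta x)"
      using T.J.arr_map[of x "Dom theta x" "Cod theta x"] by (simp add: hom_def)
    then show ?thesis using f x inv by (auto simp: hom_def)
  qed
  have "cat_functor T S (\<lambda>ns. ns) (\<lambda>f. Str S (?i f))"
  proof
    fix a assume a: "a \<in> Obj T"
    then have "Idn theta a \<in> Arr theta" "Idn T a = Str T (Idn theta a)"
      using T.J.A.idn_hom[of a] T.J.idn_map by (simp_all add: T.obj_eq theta_simps(1) hom_def)
    then show "Str S (?i (Idn T a)) = Idn S a"
      using a inv S.J.idn_map by (simp add: T.obj_eq theta_simps(1))
  next
    fix f g a b c assume f: "f \<in> hom T a b" and g: "g \<in> hom T b c"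
    note fg = conjunct1[OF ihom[OF f]] conjunct1[OF ihom[OF g]]
    have "Comp T g f = Str T (Comp theta (?i g) (?i f))"
      using T.J.comp_map[OF fg] ihom[OF f] ihom[OF g] by simp
    moreover have "Comp theta (?i g) (?i f) \<in> Arr theta"
      using T.J.A.comp_hom[OF fg] by (simp add: hom_def)
    ultimately show "Str S (?i (Comp T g f)) = Comp S (Str S (?i g)) (Str S (?i f))"
      using S.J.comp_map[OF fg] inv by simp
  qed (use ihom in \<open>auto simp: T.obj_eq S.obj_eq intro: S.J.arr_map\<close>)
  then show ?thesis using inv by (simp add: theory_morphism_def)
qed

section \<open>Connecting maps of the chain\<close>

lemma chain_map_self [simp]: "chain_map P m m = id"
  by (cases m) simp_all

text \<open>\<open>chain_map\<close> recurses on its upper end, whereas the construction climbs with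
  the lower end towards a fixed \<open>m\<close>.\<close>

lemma chain_map_Suc_left: "k < m \<Longrightarrow> chain_map P (Suc k) m (P k h) = chain_map P k m h"
proof (induction m)
  case (Suc m)
  then show ?case by (cases "k = m") simp_all
qed simp

lemma theory_morphism_chain_map:
  assumes "\<And>n. globular_theory (T n)" "\<And>n. theory_morphism (T n) (T (Suc n)) (P n)" "k \<le> m"
  shows "theory_morphism (T k) (T m) (chain_map P k m)"
  using assms(3)
proof (induction m rule: dec_induct)
  case base
  then show ?case using theory_morphism_id[OF assms(1)] by (simp add: id_def)
next
  case (step m)
  then show ?case using theory_morphism_comp[OF step.IH assms(2)[of m]] by (simp add: comp_def)
qed

lemma chain_cocone_chain_map:
  assumes "\<And>n. theory_morphism (T n) (T (Suc n)) (P n)" "chain_cocone T P S K" "k \<le> m" "f \<in> Arr (T k)"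
  shows "chain_map P k m f \<in> Arr (T m) \<and> K m (chain_map P k m f) = K k f"
  using assms(3)
proof (induction m rule: dec_induct)
  case (step m)
  then show ?case
    using assms(2) theory_morphism_Arr[OF assms(1)[of m]] by (simp add: chain_cocone_def)
qed (use assms(4) in simp)

section \<open>Propagation of agreement\<close>

lemma agrees_hom:
  "h \<in> hom T c d \<Longrightarrow>
    agrees T b h g \<longleftrightarrow> (\<forall>z\<in>hom T d b. snd (snd g) (nerve_emb T d z) = nerve_emb T c (Comp T z h))"
  by (auto simp: agrees_def hom_def)

context globular_theory begin

lemma globular_set_filled_nerve: "globular_set (filled_nerve T b)"
  by (intro globular_set_completion globular_set_nerve)

lemma agrees_Str:
  assumes "x \<in> Arr theta"
  shows "agrees T b (Str T x) (Str (endo (filled_nerve T b)) x)"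
proof -
  have x: "x \<in> hom theta (Dom theta x) (Cod theta x)" using assms by (simp add: hom_def)
  show ?thesis
    by (simp add: agrees_hom[OF J.arr_map[OF x]] endo_Str_app[OF x nerve_emb_shape] pull_nerve_emb[OF _ x])
qed

text \<open>For \<open>z : d -> b\<close> the composite of \<open>z\<close> and \<open>h\<close> has
  as faces the composites of \<open>z\<close> with \<open>s\<close> and \<open>t\<close>, which are
  the values of \<open>u\<close> and \<open>v\<close> by assumption. The proposal is therefore an
  admissible filler and \<open>fill\<close> keeps it.\<close>

lemma agrees_fill:
  assumes par: "parallel (endo (filled_nerve T b)) n d u v" and h: "lifting T n d s t h"
    and "agrees T b s u" "agrees T b t v"
  shows "agrees T b h (fill (filled_nerve T b) (extension T b h) u v)"
proof -
  have hh: "h \<in> hom T [n + 1] d" using h by (simp add: lifting_def)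
  have st: "Sig n (n + 1) \<in> hom globe n (n + 1)" "Tau n (n + 1) \<in> hom globe n (n + 1)"
    by (simp_all add: globe_hom)
  have face: "pull (D_arr f) (nerve_emb T [n + 1] (Comp T z h)) = snd (snd w) (nerve_emb T d z)"
    if z: "z \<in> hom T d b" and f: "f \<in> hom globe n (n + 1)" and r: "Comp T h (Str T (D_arr f)) = r"
      and w: "agrees T b r w" for z f r w
  proof -
    have "r \<in> hom T [n] d" using J.B.comp_hom[OF Str_D_arr_hom[OF f] hh] r by simp
    then show ?thesis
      using w z r J.B.comp_assoc[OF Str_D_arr_hom[OF f] hh z]
        pull_nerve_emb[OF J.B.comp_hom[OF hh z] D_arr_hom[OF f]]
      by (simp add: agrees_hom)
  qed
  have hdc: "Dom T h = [n + 1]" "Cod T h = d" using hh by (simp_all add: hom_def)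
  show ?thesis
    unfolding agrees_hom[OF hh]
  proof
    fix z assume z: "z \<in> hom T d b"
    have ex: "extension T b h (nerve_emb T d z) = nerve_emb T [n + 1] (Comp T z h)"
      using extension_nerve_emb[of z h b] z by (simp add: hdc)
    have "fill_spec (filled_nerve T b) n (snd (snd u) (nerve_emb T d z)) (snd (snd v) (nerve_emb T d z)) (extension T b h (nerve_emb T d z))"
      unfolding fill_spec_def ex
      using face[OF z st(1) _ assms(3)] face[OF z st(2) _ assms(4)] h
      by (intro conjI nerve_emb_shape[OF J.B.comp_hom[OF hh z]]) (simp_all add: lifting_def)
    from fill(2)[where w = "extension T b h", OF globular_set_filled_nerve contractible_completion par nerve_emb_shape[OF z] this]
    show "snd (snd (fill (filled_nerve T b) (extension T b h) u v)) (nerve_emb T d z) = nerve_emb T [n + 1] (Comp T z h)"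
      by (simp only: ex)
  qed
qed

text \<open>Agreement is closed under composition, by associativity with \<open>z\<close>, and under
  tupling, since shapes are determined by their restrictions to globes. Induction over the free
  theory then reduces it to the generators.\<close>

lemma agrees_free_liftings:
  assumes free: "free_liftings U F U' P \<phi>"
    and J: "theory_morphism U' T J" and R: "theory_morphism U' (endo (filled_nerve T b)) R"
    and P: "\<And>f. f \<in> Arr U \<Longrightarrow> agrees T b (J (P f)) (R (P f))"
    and \<phi>: "\<And>i. i \<in> idx F \<Longrightarrow> agrees T b (J (\<phi> i)) (R (\<phi> i))"
    and h: "h \<in> Arr U'"
  shows "agrees T b (J h) (R h)"
proof -
  interpret U': globular_theory U' using free by (simp add: free_liftings_def)
  have "h \<in> {h. agrees T b (J h) (R h)}"
  proof (rule free_liftings_induct[OF free h])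
    fix f g c d e assume f: "f \<in> hom U' c d" and g: "g \<in> hom U' d e"
      and ag: "f \<in> {h. agrees T b (J h) (R h)}" "g \<in> {h. agrees T b (J h) (R h)}"
    note Jf = theory_morphismD(3)[OF J f] and Jg = theory_morphismD(3)[OF J g]
      and Rf = theory_morphismD(3)[OF R f] and Rg = theory_morphismD(3)[OF R g]
    have "snd (snd (R (Comp U' g f))) (nerve_emb T e z) = nerve_emb T c (Comp T z (J (Comp U' g f)))"
      if z: "z \<in> hom T e b" for z
      using ag z J.B.comp_hom[OF Jg z] J.B.comp_assoc[OF Jf Jg z]
      by (simp add: agrees_hom[OF Jf] agrees_hom[OF Jg] theory_morphismD(4)[OF J f g]
          theory_morphismD(4)[OF R f g] endo_comp_app[OF Rf Rg nerve_emb_shape[OF z]])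
    then show "Comp U' g f \<in> {h. agrees T b (J h) (R h)}"
      using agrees_hom[OF theory_morphismD(3)[OF J U'.J.B.comp_hom[OF f g]]] by simp
  next
    fix h ns c assume h: "h \<in> hom U' ns c" and ns: "ns \<in> tables"
      and ag: "\<And>i. i < length ns \<Longrightarrow> Comp U' h (Str U' (theta_incl ns i)) \<in> {h. agrees T b (J h) (R h)}"
    note Jh = theory_morphismD(3)[OF J h] and Rh = theory_morphismD(3)[OF R h]
    have "snd (snd (R h)) (nerve_emb T c z) = nerve_emb T ns (Comp T z (J h))" if z: "z \<in> hom T c b" for z
    proof (rule shapes_eqI[OF endo_app[OF Rh nerve_emb_shape[OF z]] nerve_emb_shape[OF J.B.comp_hom[OF Jh z]]])
      fix i assume i: "i < length ns"
      note t = theta_incl_hom[OF ns i] and tU = U'.incl_hom[OF ns i] and tT = incl_hom[OF ns i]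
      have tA: "theta_incl ns i \<in> Arr theta" using t by (simp add: hom_def)
      note JhT = theory_morphismD(4)[OF J tU h, unfolded theory_morphismD(2)[OF J tA]]
        and RhT = theory_morphismD(4)[OF R tU h, unfolded theory_morphismD(2)[OF R tA]]
      interpret E: globular_theory "endo (filled_nerve T b)" by (rule globular_theory_endo[OF globular_set_filled_nerve])
      have "pull (theta_incl ns i) (snd (snd (R h)) (nerve_emb T c z))
          = snd (snd (R (Comp U' h (Str U' (theta_incl ns i))))) (nerve_emb T c z)"
        unfolding RhT endo_comp_app[OF E.incl_hom[OF ns i] Rh nerve_emb_shape[OF z]]
        by (rule endo_Str_app[OF t endo_app[OF Rh nerve_emb_shape[OF z]], symmetric])
      also have "\<dots> = nerve_emb T [ns ! i] (Comp T z (Comp T (J h) (Str T (theta_incl ns i))))"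
        using ag[OF i] z by (simp add: JhT agrees_hom[OF J.B.comp_hom[OF tT Jh]])
      also have "\<dots> = pull (theta_incl ns i) (nerve_emb T ns (Comp T z (J h)))"
        by (simp add: pull_nerve_emb[OF J.B.comp_hom[OF Jh z] t] J.B.comp_assoc[OF tT Jh z])
      finally show "pull (theta_incl ns i) (snd (snd (R h)) (nerve_emb T c z))
          = pull (theta_incl ns i) (nerve_emb T ns (Comp T z (J h)))" .
    qed
    then show "h \<in> {h. agrees T b (J h) (R h)}" by (simp add: agrees_hom[OF Jh])
  qed (use P \<phi> in auto)
  then show ?thesis by simp
qed

end

text \<open>Since these arrows are in bijection with those of \<open>T 0\<close>, the type
  \<open>'m\<close> is infinite, which the coding of terms relies on.\<close>

lemma infinite_theta: "infinite (Arr theta)"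
proof -
  interpret category theta by (rule category_theta)
  have "inj (\<lambda>n. Idn theta [n])" by (auto simp: inj_def theta_simps)
  moreover have "range (\<lambda>n. Idn theta [n]) \<subseteq> Arr theta"
    using idn_hom by (auto simp: hom_def theta_simps(1) single_table)
  ultimately show ?thesis using infinite_iff_countable_subset by blast
qed

section \<open>Injectivity of the coprojections on hom sets\<close>

lemma coprojection_inj:
  fixes T :: "nat \<Rightarrow> 'm gtheory"
  assumes cell: "cellular_presentation T P F \<phi> T\<omega> K"
    and fg: "f \<in> hom (T m) a b" "g \<in> hom (T m) a b" and K: "K m f = K m g"
  shows "f = g"
proof -
  have free: "free_liftings (T n) (F n) (T (Suc n)) (P n) (\<phi> n)" for n
    using cell by (simp add: cellular_presentation_def)
  have Th: "globular_theory (T n)" and Pm: "theory_morphism (T n) (T (Suc n)) (P n)"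
    and par: "parallel_family (T n) (F n)" and lif: "liftings_along (P n) (T (Suc n)) (F n) (\<phi> n)" for n
    using free[of n] by (simp_all add: free_liftings_def)
  have bij: "bij_betw (Str (T 0)) (Arr theta) (Arr (T 0))" and colim: "chain_colimit T P T\<omega> K"
    using cell by (simp_all add: cellular_presentation_def)
  have "infinite (UNIV :: 'm set)"
    using bij_betw_finite[OF bij] infinite_theta by (metis finite_subset subset_UNIV)
  interpret Tm: globular_theory "T m" by (rule Th)
  define Y where "Y = filled_nerve (T m) b"
  define E where "E = endo Y"
  have Y: "globular_set Y" "contractible Y"
    using Tm.globular_set_filled_nerve contractible_completion by (auto simp: Y_def)
  have E: "globular_theory E" unfolding E_def by (rule globular_theory_endo[OF Y(1)])
  let ?inv = "inv_into (Arr theta) (Str (T 0))"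
  \<comment> \<open>The arrows of \<open>theta\<close> are named by those of \<open>T 0\<close>,
    that is by elements of \<open>'m\<close>; they become the leaves of the terms.\<close>
  have "Str E x \<in> range (\<lambda>f. Str E (?inv f))" if "x \<in> Arr theta" for x
    using that bij by (intro range_eqI[of _ _ "Str (T 0) x"]) (simp add: bij_betw_def)
  then obtain A and \<iota> :: "'m filled endo_arr \<Rightarrow> 'm"
    where A: "A \<subseteq> Arr E" "globular_theory (E\<lparr>Arr := A\<rparr>)" "inj_on \<iota> A"
      and StrA: "\<And>x. x \<in> Arr theta \<Longrightarrow> Str E x \<in> A"
      and fillA: "\<And>h u v. u \<in> A \<Longrightarrow> v \<in> A \<Longrightarrow> fill Y (extension (T m) b h) u v \<in> Arr E \<Longrightarrow>
        fill Y (extension (T m) b h) u v \<in> A"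
    using small_subtheory[OF E \<open>infinite UNIV\<close>, where opn = "\<lambda>h. fill Y (extension (T m) b h)"] by metis
  let ?S = "E\<lparr>Arr := A\<rparr>"
  have incl: "theory_morphism ?S E (\<lambda>f. f)" by (rule theory_morphism_incl[OF E A(2,1)])
  have small: "inj_on \<iota> (Arr ?S)" using A(3) by simp
  \<comment> \<open>Agreement makes sense for arrows that have an image in \<open>T m\<close>, hence
    the restriction to \<open>n \<le> m\<close>; past that stage the invariant asks for a morphism
    and nothing more.\<close>
  define good where "good = (\<lambda>n Q. theory_morphism (T n) ?S Q \<and>
      (n \<le> m \<longrightarrow> (\<forall>h\<in>Arr (T n). agrees (T m) b (chain_map P n m h) (Q h))))"
  have chain: "theory_morphism (T n) (T m) (chain_map P n m)" if "n \<le> m" for n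
    by (rule theory_morphism_chain_map[where T = T and P = P, OF Th Pm that])
  \<comment> \<open>Stage \<open>n + 1\<close> extends the particular morphism chosen at stage
    \<open>n\<close>, so the compatible sequence is produced by dependent choice.\<close>
  have "\<exists>L. \<forall>n. good n (L n) \<and> (\<forall>h\<in>Arr (T n). L (Suc n) (P n h) = L n h)"
  proof (rule dependent_nat_choice)
    have Q0: "theory_morphism (T 0) ?S (\<lambda>f. Str ?S (?inv f))"
      by (rule theory_morphism_initial[OF Th A(2) bij])
    have "agrees (T m) b (chain_map P 0 m h) (Str E (?inv h))" if h: "h \<in> Arr (T 0)" for h
    proof -
      have x: "?inv h \<in> Arr theta" "Str (T 0) (?inv h) = h"
        using h bij by (auto simp: bij_betw_def inv_into_into f_inv_into_f)
      then have "chain_map P 0 m h = Str (T m) (?inv h)"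
        using theory_morphismD(2)[OF chain[of 0] x(1)] by simp
      then show ?thesis using Tm.agrees_Str[OF x(1)] by (simp add: E_def Y_def)
    qed
    then show "\<exists>Q. good 0 Q"
      using Q0 by (intro exI[of _ "\<lambda>f. Str ?S (?inv f)"]) (simp add: good_def)
  next
    fix Q n assume "good n Q"
    then have Q: "theory_morphism (T n) ?S Q"
      and ag: "\<And>h. n \<le> m \<Longrightarrow> h \<in> Arr (T n) \<Longrightarrow> agrees (T m) b (chain_map P n m h) (Q h)"
      by (auto simp: good_def)
    interpret Tn: globular_theory "T n" by (rule Th)
    have QE: "theory_morphism (T n) E Q" using theory_morphism_comp[OF Q incl] by simp
    \<comment> \<open>For \<open>Suc n \<le> m\<close> this is the lifting seen in
      \<open>T m\<close>. Otherwise \<open>chain_map\<close> defaults to the identity and the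
      proposed extension is junk, which \<open>fill\<close> discards wherever it is no
      filler.\<close>
    define w where "w = (\<lambda>i. chain_map P (Suc n) m (\<phi> n i))"
    define \<theta> where "\<theta> = (\<lambda>i. fill Y (extension (T m) b (w i)) (Q (lft (F n) i)) (Q (rgt (F n) i)))"
    have parE: "parallel E (dim (F n) i) (tab (F n) i) (Q (lft (F n) i)) (Q (rgt (F n) i))"
      if "i \<in> idx (F n)" for i
      using Tn.parallel_map[OF QE] par that by (simp add: parallel_family_def)
    have "liftings_along Q ?S (F n) \<theta>"
      unfolding liftings_along_def
    proof
      fix i assume i: "i \<in> idx (F n)"
      have "lft (F n) i \<in> Arr (T n)" "rgt (F n) i \<in> Arr (T n)"
        using par i by (auto simp: parallel_family_def parallel_def hom_def)
      then have "Q (lft (F n) i) \<in> A" "Q (rgt (F n) i) \<in> A"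
        using theory_morphism_Arr[OF Q] by auto
      moreover have l: "lifting E (dim (F n) i) (tab (F n) i) (Q (lft (F n) i)) (Q (rgt (F n) i)) (\<theta> i)"
        unfolding \<theta>_def E_def by (rule fill(1)[OF Y parE[OF i, unfolded E_def]])
      \<comment> \<open>A lifting is an arrow of \<open>E\<close>, and the subtheory is closed under
        those results of \<open>fill\<close> that are arrows of \<open>E\<close>.\<close>
      ultimately have "\<theta> i \<in> A"
        unfolding \<theta>_def by (intro fillA) (auto simp: lifting_def hom_def)
      then show "lifting ?S (dim (F n) i) (tab (F n) i) (Q (lft (F n) i)) (Q (rgt (F n) i)) (\<theta> i)"
        using l by (simp add: lifting_def hom_def)
    qed
    then obtain R where R: "theory_morphism (T (Suc n)) ?S R" "\<And>f. f \<in> Arr (T n) \<Longrightarrow> R (P n f) = Q f"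
      "\<And>i. i \<in> idx (F n) \<Longrightarrow> R (\<phi> n i) = \<theta> i"
      using free_liftings_extend[OF free A(2) small Q] by metis
    have "agrees (T m) b (chain_map P (Suc n) m h) (R h)" if n: "Suc n \<le> m" and h: "h \<in> Arr (T (Suc n))" for h
    proof (rule Tm.agrees_free_liftings[OF free chain[OF n] _ _ _ h])
      show "theory_morphism (T (Suc n)) (endo (filled_nerve (T m) b)) R"
        using theory_morphism_comp[OF R(1) incl] by (simp add: E_def Y_def)
      show "agrees (T m) b (chain_map P (Suc n) m (P n f)) (R (P n f))" if "f \<in> Arr (T n)" for f
        using ag[OF _ that] n R(2)[OF that] by (simp add: chain_map_Suc_left)
      fix i assume i: "i \<in> idx (F n)"
      let ?J = "chain_map P (Suc n) m"
      have lr: "lft (F n) i \<in> Arr (T n)" "rgt (F n) i \<in> Arr (T n)"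
        using par i by (auto simp: parallel_family_def parallel_def hom_def)
      have "lifting (T m) (dim (F n) i) (tab (F n) i) (?J (P n (lft (F n) i))) (?J (P n (rgt (F n) i))) (w i)"
        unfolding w_def using lif i globular_theory.lifting_map[OF Th chain[OF n]]
        by (auto simp: liftings_along_def)
      from Tm.agrees_fill[OF parE[OF i, unfolded E_def Y_def] this] ag[OF _ lr(1)] ag[OF _ lr(2)] n
      show "agrees (T m) b (?J (\<phi> n i)) (R (\<phi> n i))"
        by (simp add: R(3)[OF i] \<theta>_def w_def chain_map_Suc_left Y_def)
    qed
    then show "\<exists>R. good (Suc n) R \<and> (\<forall>h\<in>Arr (T n). R (P n h) = Q h)"
      using R(1,2) by (auto simp: good_def)
  qed
  then obtain L where L: "\<And>n. good n (L n)" "\<And>n h. h \<in> Arr (T n) \<Longrightarrow> L (Suc n) (P n h) = L n h"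
    by blast
  have "theory_morphism (T n) ?S (L n)" for n using L(1) by (simp add: good_def)
  \<comment> \<open>The colimit makes \<open>L m\<close> factor through \<open>K m\<close>, so
    arrows identified by \<open>K m\<close> have the same action.\<close>
  then obtain R where R: "\<And>n f. f \<in> Arr (T n) \<Longrightarrow> R (K n f) = L n f"
    using chain_colimit_extend[where L = L, OF colim A(2) small _ L(2)] by blast
  have "b \<in> Obj (T m)" using fg Tm.J.B.cod_obj by (auto simp: hom_def)
  then have id: "Idn (T m) b \<in> hom (T m) b b" by (rule Tm.J.B.idn_hom)
  have app: "snd (snd (L m h)) (nerve_emb (T m) b (Idn (T m) b)) = nerve_emb (T m) a h" if h: "h \<in> hom (T m) a b" for h
  proof -
    have "agrees (T m) b h (L m h)"
      using L(1)[of m] h by (simp add: good_def hom_def)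
    then show ?thesis using id h Tm.J.B.idn_left[OF h] by (simp add: agrees_hom[OF h])
  qed
  have "L m f = L m g" using R K fg by (metis (no_types, lifting) hom_def mem_Collect_eq)
  then have "nerve_emb (T m) a f = nerve_emb (T m) a g" using app fg by metis
  then show ?thesis by (rule Tm.nerve_emb_inj[OF fg])
qed

theorem theorem5p2:
  fixes T :: "nat \<Rightarrow> 'm gtheory" and P :: "nat \<Rightarrow> 'm \<Rightarrow> 'm"
    and F :: "nat \<Rightarrow> ('i, 'm) pair_family" and \<phi> :: "nat \<Rightarrow> 'i \<Rightarrow> 'm"
    and T\<omega> :: "'m gtheory" and K :: "nat \<Rightarrow> 'm \<Rightarrow> 'm"
  assumes "cellular_presentation T P F \<phi> T\<omega> K"
  shows "\<forall>m::nat. \<forall>n::enat. enat m < n \<longrightarrow> faithful (T m) (connecting P K m n)"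
proof (intro allI impI)
  fix m :: nat and n :: enat assume mn: "enat m < n"
  have inj: "inj_on (K m) (hom (T m) a b)" for a b
    by (rule inj_onI) (rule coprojection_inj[OF assms])
  have Pm: "theory_morphism (T n) (T (Suc n)) (P n)" for n
    using assms by (simp add: cellular_presentation_def free_liftings_def)
  have cocone: "chain_cocone T P T\<omega> K"
    using assms by (simp add: cellular_presentation_def chain_colimit_def)
  show "faithful (T m) (connecting P K m n)"
  proof (cases n)
    case (enat k)
    then have "m \<le> k" using mn by simp
    \<comment> \<open>\<open>K m\<close> is \<open>K k\<close> after the map from stage
      \<open>m\<close> to stage \<open>k\<close>, so its injectivity on hom sets passes to that
      map.\<close>
    have "inj_on (chain_map P m k) (hom (T m) a b)" for a b
    proof (rule inj_onI)
      fix f g assume fg: "f \<in> hom (T m) a b" "g \<in> hom (T m) a b" and "chain_map P m k f = chain_map P m k g"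
      then have "K m f = K m g"
        using chain_cocone_chain_map[where T = T and P = P, OF Pm cocone \<open>m \<le> k\<close>] by (metis (no_types, lifting) hom_def mem_Collect_eq)
      then show "f = g" using inj fg by (meson inj_onD)
    qed
    then show ?thesis by (simp add: faithful_def connecting_def enat)
  next
    case infinity
    then show ?thesis using inj by (simp add: faithful_def connecting_def)
  qed
qed

end
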